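(* Assume that $\Omega\subset\mathbb R^n$ is open, that the functions $f_i$ and $g_i$ ($1\le i\le N$) are bounded, that there is a function $\widetilde F:[0,|\Omega|]^N\to\mathbb R$ such that $F(W_1,\dots,W_N)=\widetilde F(|W_1|,\dots,|W_N|)$ for all $(W_1,\dots,W_N)\in\mathcal W(\Omega)$, that $(\mathbf u,\mathbf W)$ is a minimizer for $J$ in $\mathcal F(\Omega)$, and that $\mathbf W$ fills $\Omega$, i.e. $\big|\Omega\setminus\bigcup_{i=1}^NW_i\big|=0$. Further assume that $g_i(x)>0$ for $1\le i\le N$ and almost every $x\in\Omega$, and that the definition of $\mathcal F(\Omega)$ allows all the functions $u_i$ to take positive values. Then $\mathbf u(x)\ne0$ for almost every $x\in\Omega$.
   Context: $n\ge2$ and $N\ge1$ are integers; $|A|$ is the Lebesgue measure of $A$; $|\Omega|<+\infty$. $W^{1,2}(\mathbb R^n)$ denotes the set of functions in $L^2_{loc}(\mathbb R^n)$ whose distributional gradient lies in $L^2(\mathbb R^n)$. $\mathcal W(\Omega)$ is the set of $N$-tuples $\mathbf W=(W_1,\dots,W_N)$ of pairwise disjoint Borel subsets of $\Omega$. $\mathcal F(\Omega)$ is the set of pairs $(\mathbf u,\mathbf W)$ with $\mathbf W\in\mathcal W(\Omega)$ and $\mathbf u=(u_1,\dots,u_N)$ an $N$-tuple of real-valued functions $u_i\in W^{1,2}(\mathbb R^n)$ such that $u_i(x)=0$ for almost every $x\in\mathbb R^n\setminus W_i$; moreover, for some (possibly empty) fixed set of indices $i$, the definition of $\mathcal F(\Omega)$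 may include the additional sign requirement $u_i\ge0$. (That all $u_i$ are allowed to take positive values means that for each $i$ either no sign condition or the condition $u_i\ge0$ is imposed.) For $(\mathbf u,\mathbf W)\in\mathcal F(\Omega)$ and $F:\mathcal W(\Omega)\to\mathbb R$, $$J(\mathbf u,\mathbf W)=\sum_{i=1}^N\int|\nabla u_i|^2\,dx+\sum_{i=1}^N\int[u_i^2f_i-u_ig_i]\,dx+F(W_1,\dots,W_N).$$ A minimizer for $J$ in $\mathcal F(\Omega)$ is a pair $(\mathbf u,\mathbf W)\in\mathcal F(\Omega)$ such that $J(\mathbf u,\mathbf W)\le J(\mathbf u^*,\mathbf W^* )$ for all $(\mathbf u^*,\mathbf W^* )\in\mathcal F(\Omega)$. *)

theory Defs
  imports "HOL-Analysis.Analysis"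
begin

text \<open>Points of \<open>\<real>\<^sup>n\<close> have type \<open>real ^ 'n\<close>, and \<open>N\<close>-tuples are functions on a finite index
  type \<open>'k\<close>, so that \<open>n = CARD('n)\<close> and \<open>N = CARD('k)\<close>.  All integrals and almost-everywhere
  statements are with respect to (completed) Lebesgue measure.\<close>

definition pderiv_at :: "(real ^ 'n \<Rightarrow> real) \<Rightarrow> 'n \<Rightarrow> real ^ 'n \<Rightarrow> real"
  where "pderiv_at \<phi> i x = frechet_derivative \<phi> (at x) (axis i 1)"

primrec Ck :: "nat \<Rightarrow> (real ^ 'n \<Rightarrow> real) \<Rightarrow> bool"
  where
    "Ck 0 \<phi> \<longleftrightarrow> continuous_on UNIV \<phi>"
  | "Ck (Suc k) \<phi> \<longleftrightarrow> (\<forall>x. \<phi> differentiable (at x)) \<and> (\<forall>i. Ck k (pderiv_at \<phi> i))"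

definition test_function :: "(real ^ 'n \<Rightarrow> real) \<Rightarrow> bool"
  where "test_function \<phi> \<longleftrightarrow> (\<forall>k. Ck k \<phi>) \<and> compact (closure {x. \<phi> x \<noteq> 0})"

definition L2_loc :: "(real ^ 'n \<Rightarrow> real) set"
  where "L2_loc = {u \<in> borel_measurable lebesgue.
           \<forall>K. compact K \<longrightarrow> (\<lambda>x. (u x)\<^sup>2) absolutely_integrable_on K}"

definition has_distributional_gradient ::
    "(real ^ 'n \<Rightarrow> real) \<Rightarrow> (real ^ 'n \<Rightarrow> real ^ 'n) \<Rightarrow> bool"
  where "has_distributional_gradient u G \<longleftrightarrow>
    (\<forall>K. compact K \<longrightarrow> G absolutely_integrable_on K) \<and>
    (\<forall>\<phi> i. test_function \<phi> \<longrightarrow>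
       (LINT x|lebesgue. u x * pderiv_at \<phi> i x) = - (LINT x|lebesgue. G x $ i * \<phi> x))"

definition W12 :: "(real ^ 'n \<Rightarrow> real) set"
  where "W12 = {u \<in> L2_loc. \<exists>G. has_distributional_gradient u G \<and>
                                  integrable lebesgue (\<lambda>x. (norm (G x))\<^sup>2)}"

text \<open>Local integrability of \<open>G\<close> makes the distributional gradient unique up to a null set, so
  integrals involving the following representative do not depend on the choice.\<close>

definition weak_gradient :: "(real ^ 'n \<Rightarrow> real) \<Rightarrow> real ^ 'n \<Rightarrow> real ^ 'n"
  where "weak_gradient u = (SOME G. has_distributional_gradient u G)"

definition disjoint_tuples :: "(real ^ 'n) set \<Rightarrow> ('k::finite \<Rightarrow> (real ^ 'n) set) set"
  where "disjoint_tuples \<Omega> =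
    {W. (\<forall>i. W i \<in> sets borel \<and> W i \<subseteq> \<Omega>) \<and> disjoint_family W}"

text \<open>\<open>S\<close> is the (possibly empty) set of indices \<open>i\<close> for which the requirement \<open>u\<^sub>i \<ge> 0\<close> is imposed.
  As elements of \<open>W12\<close> stand for their almost-everywhere classes, so does the sign condition.\<close>

definition admissible_pairs :: "'k set \<Rightarrow> (real ^ 'n) set \<Rightarrow>
    (('k::finite \<Rightarrow> real ^ 'n \<Rightarrow> real) \<times> ('k \<Rightarrow> (real ^ 'n) set)) set"
  where "admissible_pairs S \<Omega> =
    {(u, W). W \<in> disjoint_tuples \<Omega> \<and>
       (\<forall>i. u i \<in> W12 \<and> (AE x in lebesgue. x \<notin> W i \<longrightarrow> u i x = 0)) \<and>
       (\<forall>i\<in>S. AE x in lebesgue. 0 \<le> u i x)}"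

definition J_functional ::
    "('k::finite \<Rightarrow> real ^ 'n \<Rightarrow> real) \<Rightarrow> ('k \<Rightarrow> real ^ 'n \<Rightarrow> real) \<Rightarrow>
     (('k \<Rightarrow> (real ^ 'n) set) \<Rightarrow> real) \<Rightarrow>
     ('k \<Rightarrow> real ^ 'n \<Rightarrow> real) \<times> ('k \<Rightarrow> (real ^ 'n) set) \<Rightarrow> real"
  where "J_functional f g F = (\<lambda>(u, W).
    (\<Sum>i\<in>UNIV. LINT x|lebesgue. (norm (weak_gradient (u i) x))\<^sup>2) +
    (\<Sum>i\<in>UNIV. LINT x|lebesgue. (u i x)\<^sup>2 * f i x - u i x * g i x) +
    F W)"

definition is_minimizer :: "('p \<Rightarrow> real) \<Rightarrow> 'p set \<Rightarrow> 'p \<Rightarrow> bool"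
  where "is_minimizer J A p \<longleftrightarrow> p \<in> A \<and> (\<forall>q\<in>A. J p \<le> J q)"

end

theory Submission
  imports Defs
begin

text \<open>If \<open>u\<close> vanished on a subset of \<open>\<Omega>\<close> of positive measure, then, as \<open>W\<close> fills \<open>\<Omega>\<close>, so would it on a Borel set
  \<open>E \<subseteq> W k\<close> of positive measure on which \<open>g k \<ge> c > 0\<close>, for some index \<open>k\<close>
  (\<open>exists_vanishing_set\<close>).  Let \<open>a\<close> be a point of density of \<open>E\<close> (\<open>density_point\<close>).  The minimizer
  is compared with the following competitor on a small ball \<open>B = ball a r\<close>: every \<open>u j\<close> is cut off so
  that it vanishes on \<open>B\<close>, the ball is given to the region \<open>k\<close>, and a bump of height
  \<open>\<tau> r\<^sup>2\<close> living in \<open>B\<close> is added to \<open>u k\<close>.  What the other regions lose in \<open>B\<close> is paid back to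
  them by pieces of \<open>E - B\<close>, where all the functions vanish; so all volumes are unchanged, and with
  them the term \<open>F\<close> (\<open>volume_exchange\<close>).

  The bump lowers the energy by an amount of order \<open>r\<^bsup>n+2\<^esup>\<close>, because its contribution to
  \<open>\<integral> u g\<close> is linear in \<open>\<tau>\<close> and its cost is quadratic.  With
  \<open>D r = \<Sum> \<integral>\<^bsub>ball a r\<^esub> |\<nabla>u j|\<^sup>2\<close> and \<open>I r = \<Sum> \<integral>\<^bsub>ball a r\<^esub> (u j)\<^sup>2\<close>, minimality then says
  (\<open>minimizer_inequality\<close>) that
    \<open>D r + 2 \<gamma> r\<^bsup>n+2\<^esup> \<le> D (2r) / K + C I (2r) / r\<^sup>2 + \<gamma> r\<^bsup>n+2\<^esup>\<close>
  where \<open>K\<close> may be as large as desired, at the expense of \<open>C\<close>.  The last term comes from the linear part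
  of the energy and is small because \<open>u\<close> vanishes on most of \<open>ball a (2r)\<close>.

  The function \<open>u\<close> is supported in a tiny portion of \<open>ball a (4r)\<close>.  A Faber-Krahn inequality
  (\<open>faber_krahn\<close>), localized in \<open>local_poincare\<close>, therefore bounds \<open>I (2r) / r\<^sup>2\<close> by a small multiple
  of \<open>\<alpha> (4r)\<close>, where \<open>\<alpha> r = D r + I r / r\<^sup>2\<close>.  Together,
    \<open>\<alpha> r + \<gamma> r\<^bsup>n+2\<^esup> \<le> 4\<^bsup>-(n+3)\<^esup> \<alpha> (4r)\<close>
  for all small \<open>r\<close>.  Iterating this along \<open>r = r0 / 4\<^bsup>i\<^esup>\<close> makes \<open>\<alpha>\<close> decay faster than \<open>r\<^bsup>n+2\<^esup>\<close>,
  while the same inequality keeps \<open>\<alpha>\<close> above a multiple of \<open>r\<^bsup>n+2\<^esup>\<close>; this is absurd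
  (\<open>decay_contradiction\<close>).

  The Faber-Krahn inequality is proved by translations: \<open>u (x + h) - u x = \<integral>\<^sub>0\<^sup>1 h \<bullet> \<nabla>u (x + t h) dt\<close>
  almost everywhere (\<open>translation_identity\<close>), so translating by \<open>h\<close> moves \<open>u\<close> by at most
  \<open>|h| \<parallel>\<nabla>u\<parallel>\<close> in \<open>L\<^sup>2\<close>; but if \<open>h\<close> ranges over a ball of twice the volume of the support, then
  at each \<open>x\<close> at least half of the translates vanish and so differ from \<open>u\<close> by \<open>|u x|\<close>.\<close>

section \<open>Smooth functions\<close>

definition smooth :: "(real ^ 'n \<Rightarrow> real) \<Rightarrow> bool"
  where "smooth \<phi> \<longleftrightarrow> (\<forall>k. Ck k \<phi>)"

definition grad :: "(real ^ 'n \<Rightarrow> real) \<Rightarrow> real ^ 'n \<Rightarrow> real ^ 'n"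
  where "grad \<phi> x = (\<chi> i. pderiv_at \<phi> i x)"

lemma pderiv_at_eq:
  assumes "(\<phi> has_derivative D) (at x)"
  shows "pderiv_at \<phi> i x = D (axis i 1)"
  using frechet_derivative_at[OF assms] by (simp add: pderiv_at_def)

text \<open>Partial derivatives are values of the Frechet derivative on the coordinate axes, so linearity recovers
  the derivative from them.\<close>

lemma has_derivative_grad:
  fixes \<phi> :: "real ^ 'n \<Rightarrow> real"
  assumes "\<phi> differentiable (at x)"
  shows "(\<phi> has_derivative (\<lambda>v. v \<bullet> grad \<phi> x)) (at x)"
proof -
  let ?D = "frechet_derivative \<phi> (at x)"
  have D: "(\<phi> has_derivative ?D) (at x)"
    using assms frechet_derivative_works by blast
  then have lin: "linear ?D" by (rule has_derivative_linear)
  have "?D v = v \<bullet> grad \<phi> x" for v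
  proof -
    have "?D v = ?D (\<Sum>i\<in>UNIV. v $ i *\<^sub>R axis i 1)"
      by (simp add: basis_expansion flip: scalar_mult_eq_scaleR)
    also have "\<dots> = (\<Sum>i\<in>UNIV. v $ i * ?D (axis i 1))"
      using lin by (simp add: linear_sum linear_cmul)
    finally show ?thesis
      by (simp add: grad_def pderiv_at_def inner_vec_def)
  qed
  then have "?D = (\<lambda>v. v \<bullet> grad \<phi> x)" by blast
  with D show ?thesis by simp
qed

lemma grad_eqI:
  assumes "(\<phi> has_derivative (\<lambda>v. v \<bullet> w)) (at x)"
  shows "grad \<phi> x = w"
  by (simp add: grad_def vec_eq_iff pderiv_at_eq[OF assms] inner_axis')

lemma smooth_differentiable: "smooth \<phi> \<Longrightarrow> \<phi> differentiable (at x)"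
  unfolding smooth_def by (metis Ck.simps(2))

lemma smooth_pderiv_at: "smooth \<phi> \<Longrightarrow> smooth (pderiv_at \<phi> i)"
  unfolding smooth_def by (metis Ck.simps(2))

lemma smooth_continuous: "smooth \<phi> \<Longrightarrow> continuous_on UNIV \<phi>"
  unfolding smooth_def by (metis Ck.simps(1))

lemma smooth_has_derivative:
  "smooth \<phi> \<Longrightarrow> (\<phi> has_derivative (\<lambda>v. v \<bullet> grad \<phi> x)) (at x)"
  by (intro has_derivative_grad smooth_differentiable)

lemma Ck_Suc_imp: "Ck (Suc k) \<phi> \<Longrightarrow> Ck k \<phi>"
proof (induction k arbitrary: \<phi>)
  case 0
  then show ?case
    by (auto intro!: continuous_at_imp_continuous_on differentiable_imp_continuous_within)
qed auto

lemma pderiv_at_add: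
  assumes "\<phi> differentiable (at x)" "\<psi> differentiable (at x)"
  shows "pderiv_at (\<lambda>x. \<phi> x + \<psi> x) i x = pderiv_at \<phi> i x + pderiv_at \<psi> i x"
  using pderiv_at_eq[OF has_derivative_add[OF assms[THEN has_derivative_grad]]]
  by (simp add: grad_def inner_axis')

lemma pderiv_at_mult:
  assumes "\<phi> differentiable (at x)" "\<psi> differentiable (at x)"
  shows "pderiv_at (\<lambda>x. \<phi> x * \<psi> x) i x = \<phi> x * pderiv_at \<psi> i x + pderiv_at \<phi> i x * \<psi> x"
  using pderiv_at_eq[OF has_derivative_mult[OF assms[THEN has_derivative_grad]]]
  by (simp add: grad_def inner_axis')

lemma pderiv_at_const: "pderiv_at (\<lambda>x. c) i = (\<lambda>x. 0)"
  by (rule ext) (simp add: pderiv_at_eq[OF has_derivative_const])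

lemma pderiv_at_coord: "pderiv_at (\<lambda>x. x $ j) i = (\<lambda>x. if i = j then 1 else 0)"
proof
  fix x :: "real ^ 'a"
  have "((\<lambda>x. x $ j) has_derivative (\<lambda>x. x $ j)) (at x)"
    by (rule bounded_linear_imp_has_derivative) (rule bounded_linear_vec_nth)
  from pderiv_at_eq[OF this] show "pderiv_at (\<lambda>x. x $ j) i x = (if i = j then 1 else 0)"
    by (simp add: axis_def)
qed

lemma Ck_const: "Ck k (\<lambda>x. c)"
  by (induction k arbitrary: c) (auto simp: pderiv_at_const)

lemma Ck_coord: "Ck k (\<lambda>x. x $ j)"
  by (cases k) (auto simp: pderiv_at_coord Ck_const intro!: bounded_linear_imp_differentiable
      bounded_linear_vec_nth continuous_intros)

lemma Ck_add: "Ck k \<phi> \<Longrightarrow> Ck k \<psi> \<Longrightarrow> Ck k (\<lambda>x. \<phi> x + \<psi> x)"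
proof (induction k arbitrary: \<phi> \<psi>)
  case (Suc k)
  have eq: "pderiv_at (\<lambda>x. \<phi> x + \<psi> x) i = (\<lambda>x. pderiv_at \<phi> i x + pderiv_at \<psi> i x)" for i
    using Suc.prems by (intro ext pderiv_at_add) auto
  show ?case
    using Suc.prems by (auto simp: eq intro!: Suc.IH)
qed (auto intro!: continuous_intros)

lemma Ck_mult: "Ck k \<phi> \<Longrightarrow> Ck k \<psi> \<Longrightarrow> Ck k (\<lambda>x. \<phi> x * \<psi> x)"
proof (induction k arbitrary: \<phi> \<psi>)
  case (Suc k)
  have eq: "pderiv_at (\<lambda>x. \<phi> x * \<psi> x) i = (\<lambda>x. \<phi> x * pderiv_at \<psi> i x + pderiv_at \<phi> i x * \<psi> x)" for i
    using Suc.prems by (intro ext pderiv_at_mult) auto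
  have "Ck k \<phi>" "Ck k \<psi>" using Suc.prems by (blast intro: Ck_Suc_imp)+
  then show ?case
    using Suc.prems by (auto simp: eq intro!: Suc.IH Ck_add)
qed (auto intro!: continuous_intros)

lemma smooth_const: "smooth (\<lambda>x. c)"
  and smooth_coord: "smooth (\<lambda>x. x $ j)"
  and smooth_add: "smooth \<phi> \<Longrightarrow> smooth \<psi> \<Longrightarrow> smooth (\<lambda>x. \<phi> x + \<psi> x)"
  and smooth_mult: "smooth \<phi> \<Longrightarrow> smooth \<psi> \<Longrightarrow> smooth (\<lambda>x. \<phi> x * \<psi> x)"
  by (auto simp: smooth_def Ck_const Ck_coord Ck_add Ck_mult)

lemma smooth_cmult: "smooth \<phi> \<Longrightarrow> smooth (\<lambda>x. c * \<phi> x)"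
  by (intro smooth_mult smooth_const)

lemma smooth_diff: "smooth \<phi> \<Longrightarrow> smooth \<psi> \<Longrightarrow> smooth (\<lambda>x. \<phi> x - \<psi> x)"
  using smooth_add[OF _ smooth_cmult, of \<phi> \<psi> "-1"] by simp

lemma smooth_prod: "finite I \<Longrightarrow> (\<And>i. i \<in> I \<Longrightarrow> smooth (\<phi> i)) \<Longrightarrow> smooth (\<lambda>x. \<Prod>i\<in>I. \<phi> i x)"
  by (induction I rule: finite_induct) (auto intro!: smooth_const smooth_mult)

lemma smooth_sum: "finite I \<Longrightarrow> (\<And>i. i \<in> I \<Longrightarrow> smooth (\<phi> i)) \<Longrightarrow> smooth (\<lambda>x. \<Sum>i\<in>I. \<phi> i x)"
  by (induction I rule: finite_induct) (auto intro!: smooth_const smooth_add)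

lemma pderiv_at_translate: "pderiv_at (\<lambda>x. \<phi> (x - a)) i x = pderiv_at \<phi> i (x - a)"
proof -
  have "((\<lambda>x. \<phi> (x - a)) has_derivative D) (at x) \<longleftrightarrow> (\<phi> has_derivative D) (at (x - a))" for D
  proof
    assume *: "((\<lambda>x. \<phi> (x - a)) has_derivative D) (at x)"
    have "((\<lambda>x. \<phi> (x + a - a)) has_derivative D) (at (x - a))"
      by (rule has_derivative_compose[of "\<lambda>x. x + a" "\<lambda>x. x" "x - a" UNIV "\<lambda>x. \<phi> (x - a)" D])
        (auto intro!: derivative_eq_intros simp: *)
    then show "(\<phi> has_derivative D) (at (x - a))" by simp
  next
    assume *: "(\<phi> has_derivative D) (at (x - a))"
    show "((\<lambda>x. \<phi> (x - a)) has_derivative D) (at x)"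
      by (rule has_derivative_compose[of "\<lambda>x. x - a" "\<lambda>x. x" "x" UNIV "\<phi>" D])
        (auto intro!: derivative_eq_intros simp: *)
  qed
  then show ?thesis
    by (simp add: pderiv_at_def frechet_derivative_def)
qed

lemma Ck_translate: "Ck k \<phi> \<Longrightarrow> Ck k (\<lambda>x. \<phi> (x - a))"
proof (induction k arbitrary: \<phi>)
  case 0
  then show ?case by (auto intro!: continuous_intros intro: continuous_on_compose2)
next
  case (Suc k)
  have "(\<lambda>x. \<phi> (x - a)) differentiable (at x)" for x
    using differentiable_chain_at[of "\<lambda>x. x - a" x \<phi>] Suc.prems by (auto simp: o_def)
  moreover have "pderiv_at (\<lambda>x. \<phi> (x - a)) i = (\<lambda>x. pderiv_at \<phi> i (x - a))" for i
    by (intro ext pderiv_at_translate)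
  ultimately show ?case using Suc by auto
qed

section \<open>Flat functions and cut-off functions\<close>

text \<open>The functions \<open>e\<^bsup>-1/t\<^esup> / t\<^sup>m\<close> are the terms that appear in the derivatives of the flat function
  \<open>flat 0\<close>.  Treating all \<open>m\<close> at once makes the family closed under differentiation, up to linear
  combinations.\<close>

definition flat :: "nat \<Rightarrow> real \<Rightarrow> real"
  where "flat m t = (if t \<le> 0 then 0 else exp (- (1 / t)) / t ^ m)"

lemma flat_nonneg: "0 \<le> flat m t"
  by (simp add: flat_def)

text \<open>The exponential \<open>e\<^bsup>1/t\<^esup>\<close> dominates the single term of degree \<open>m + k\<close> of its series.\<close>

lemma flat_le_power:
  assumes "0 \<le> t"
  shows "flat m t \<le> fact (m + k) * t ^ k"
proof (cases "t = 0")
  case False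
  with assms have t: "t > 0" by simp
  have "(1 / t) ^ (m + k) / fact (m + k) \<le> exp (1 / t)"
  proof -
    have "(\<Sum>j\<in>{m + k}. (1 / t) ^ j / fact j) \<le> (\<Sum>j. (1 / t) ^ j / fact j)"
      using t summable_exp[of "1 / t"] by (intro sum_le_suminf) (auto simp: field_simps)
    then show ?thesis by (simp add: exp_def divide_inverse scaleR_conv_of_real mult_ac)
  qed
  then have "exp (- (1 / t)) \<le> fact (m + k) * t ^ (m + k)"
    using t by (simp add: exp_minus field_simps)
  then show ?thesis
    using t by (simp add: flat_def field_simps power_add)
qed (simp add: flat_def)

lemma flat_has_derivative:
  "(flat m has_real_derivative (flat (m + 2) t - m * flat (m + 1) t)) (at t)"
proof -
  consider "t < 0" | "t = 0" | "t > 0" by linarith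
  then show ?thesis
  proof cases
    case 1
    have "((\<lambda>_. 0) has_real_derivative (flat (m + 2) t - m * flat (m + 1) t)) (at t)"
      using 1 by (simp add: flat_def)
    then show ?thesis
      by (rule has_field_derivative_transform_within_open[where S="{..<0}"])
        (use 1 in \<open>auto simp: flat_def\<close>)
  next
    case 2
    \<comment> \<open>At the origin the function is \<open>O(t\<^sup>2)\<close>, so its difference quotient tends to zero.\<close>
    have "((\<lambda>h. flat m h / h) \<longlongrightarrow> 0) (at 0)"
    proof (rule Lim_null_comparison)
      show "\<forall>\<^sub>F h in at 0. norm (flat m h / h) \<le> fact (m + 2) * \<bar>h\<bar>"
      proof (rule always_eventually, rule allI)
        fix h :: real
        show "norm (flat m h / h) \<le> fact (m + 2) * \<bar>h\<bar>"
        proof (cases "h > 0")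
          case True
          then show ?thesis
            using flat_le_power[of h m 2] flat_nonneg[of m h]
            by (simp add: field_simps power2_eq_square abs_mult)
        next
          case False
          then have "flat m h = 0" by (simp add: flat_def)
          then show ?thesis by simp
        qed
      qed
      show "((\<lambda>h::real. fact (m + 2) * \<bar>h\<bar>) \<longlongrightarrow> 0) (at 0)"
        by (auto intro!: tendsto_eq_intros)
    qed
    then show ?thesis
      using 2 by (simp add: DERIV_def flat_def[of _ 0])
  next
    case 3
    define i where "i = inverse t"
    have pos: "flat j t = exp (- i) * i ^ j" for j
      using 3 by (simp add: flat_def i_def divide_inverse power_inverse)
    have "((\<lambda>t. exp (- inverse t) * inverse t ^ m) has_real_derivative
        exp (- i) * (i * i) * i ^ m + real m * (- (i * i) * i ^ (m - 1)) * exp (- i)) (at t)"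
      using 3 by (auto intro!: derivative_eq_intros simp: i_def)
    also have "exp (- i) * (i * i) * i ^ m + real m * (- (i * i) * i ^ (m - 1)) * exp (- i) =
        flat (m + 2) t - m * flat (m + 1) t"
      unfolding pos by (cases m) (simp_all add: algebra_simps)
    finally have "((\<lambda>t. exp (- inverse t) * inverse t ^ m) has_real_derivative
        (flat (m + 2) t - m * flat (m + 1) t)) (at t)" .
    then show ?thesis
      by (rule has_field_derivative_transform_within_open[where S="{0<..}"])
        (use 3 in \<open>auto simp: flat_def divide_inverse power_inverse\<close>)
  qed
qed

text \<open>By the chain rule a partial derivative is a combination of the same functions with larger \<open>m\<close>,
  which is why the induction hypothesis has to range over all \<open>m\<close>.\<close>

lemma Ck_flat:
  assumes "smooth \<phi>"
  shows "Ck k (\<lambda>x. flat m (\<phi> x))"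
proof (induction k arbitrary: m)
  have der: "((\<lambda>x. flat m (\<phi> x)) has_derivative
      (\<lambda>v. v \<bullet> grad \<phi> x * (flat (m + 2) (\<phi> x) - m * flat (m + 1) (\<phi> x)))) (at x)" for m x
    using has_derivative_compose[OF smooth_has_derivative[OF assms]
        flat_has_derivative[unfolded has_field_derivative_def]] by (simp add: mult_ac)
  {
    case 0
    show ?case
      using der by (auto intro!: continuous_at_imp_continuous_on has_derivative_continuous)
  next
    case (Suc k)
    have eq: "pderiv_at (\<lambda>x. flat m (\<phi> x)) i =
        (\<lambda>x. pderiv_at \<phi> i x * (flat (m + 2) (\<phi> x) + (- real m) * flat (m + 1) (\<phi> x)))" for i
      by (rule ext) (simp add: pderiv_at_eq[OF der] inner_axis' grad_def)
    have "Ck k (pderiv_at \<phi> i)" for i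
      using smooth_pderiv_at[OF assms] by (simp add: smooth_def)
    then have "Ck k (pderiv_at (\<lambda>x. flat m (\<phi> x)) i)" for i
      unfolding eq by (intro Ck_mult Ck_add Ck_const Suc)
    then show ?case
      using der unfolding Ck.simps differentiable_def by blast
  }
qed

lemma smooth_flat: "smooth \<phi> \<Longrightarrow> smooth (\<lambda>x. flat m (\<phi> x))"
  by (simp add: Ck_flat smooth_def[of "\<lambda>x. flat m (\<phi> x)"])

text \<open>A smooth function that is \<open>0\<close> for \<open>t \<le> 0\<close> and \<open>1\<close> for \<open>t \<ge> 1\<close>, obtained by composing \<open>flat 0\<close>
  with itself.  As \<open>e \<cdot> flat 0 (1 - t)\<close> is \<open>0\<close> for \<open>t \<ge> 1\<close> and at least \<open>1\<close> for
  \<open>t \<le> 0\<close>, the outer flat function is evaluated at \<open>1\<close>, respectively at a nonpositive point.\<close>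

definition step :: "real \<Rightarrow> real"
  where "step t = exp 1 * flat 0 (1 - exp 1 * flat 0 (1 - t))"

text \<open>The derivative of \<open>step\<close>.\<close>

definition step' :: "real \<Rightarrow> real"
  where "step' t = exp 1 * flat 2 (1 - exp 1 * flat 0 (1 - t)) * (exp 1 * flat 2 (1 - t))"

lemma flat_0_ge: "1 \<le> t \<Longrightarrow> 1 \<le> exp 1 * flat 0 t"
  by (simp add: flat_def field_simps flip: exp_add)

lemma step_eq_0: "t \<le> 0 \<Longrightarrow> step t = 0"
  and step'_eq_0: "t \<le> 0 \<Longrightarrow> step' t = 0"
  using flat_0_ge[of "1 - t"] by (auto simp: step_def step'_def flat_def[of _ "_ - exp 1 * _"])

lemma step_eq_1: "1 \<le> t \<Longrightarrow> step t = 1"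
  by (simp add: step_def flat_def flip: exp_add)

lemma step'_eq_0': "1 \<le> t \<Longrightarrow> step' t = 0"
  by (simp add: step'_def flat_def)

lemma step_nonneg: "0 \<le> step t"
  by (simp add: step_def flat_nonneg)

lemma step_le_1: "step t \<le> 1"
proof -
  have "exp 1 * flat 0 s \<le> 1" if "s \<le> 1" for s
    using that by (simp add: flat_def field_simps flip: exp_add)
  then show ?thesis
    by (simp add: step_def flat_nonneg)
qed

lemma step_has_derivative: "(step has_real_derivative step' t) (at t)"
proof -
  note d = flat_has_derivative[of 0, simplified, THEN DERIV_chain2]
  have "((\<lambda>t. exp 1 * flat 0 (1 - exp 1 * flat 0 (1 - t))) has_real_derivative step' t) (at t)"
    unfolding step'_def
    by (rule derivative_eq_intros d refl | simp add: numeral_2_eq_2)+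
  then show ?thesis unfolding step_def[abs_def] .
qed

lemma step'_nonneg: "0 \<le> step' t"
  by (simp add: step'_def flat_nonneg)

lemma step'_le: "step' t \<le> 4 * (exp 1)\<^sup>2"
proof -
  have f: "flat 2 s \<le> 2" for s
    using flat_le_power[of s 2 0] by (cases "s \<ge> 0") (auto simp: flat_def fact_numeral)
  have "step' t = (exp 1)\<^sup>2 * (flat 2 (1 - exp 1 * flat 0 (1 - t)) * flat 2 (1 - t))"
    by (simp add: step'_def power2_eq_square)
  also have "\<dots> \<le> (exp 1)\<^sup>2 * (2 * 2)"
    by (intro mult_left_mono mult_mono f flat_nonneg) auto
  finally show ?thesis by simp
qed

text \<open>Equal to \<open>1\<close> on the ball of radius \<open>r\<close> and to \<open>0\<close> off the ball of radius \<open>2r\<close> about \<open>a\<close>.  The argument of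
  \<open>step\<close> is quadratic in \<open>x\<close>, hence smooth also at \<open>a\<close>.\<close>

definition cutoff :: "real ^ 'n \<Rightarrow> real \<Rightarrow> real ^ 'n \<Rightarrow> real"
  where "cutoff a r x = step ((4 * r\<^sup>2 - (norm (x - a))\<^sup>2) / (3 * r\<^sup>2))"

lemma smooth_cutoff:
  fixes a :: "real ^ 'n"
  shows "smooth (cutoff a r)"
proof -
  have n: "(norm (x - a))\<^sup>2 = (\<Sum>i\<in>UNIV. (x $ i - a $ i) * (x $ i - a $ i))" for x :: "real ^ 'n"
    by (simp only: power2_norm_eq_inner inner_vec_def vector_minus_component inner_real_def)
  have q: "(4 * r\<^sup>2 - (norm (x - a))\<^sup>2) / (3 * r\<^sup>2) =
      inverse (3 * r\<^sup>2) * (4 * r\<^sup>2 - (\<Sum>i\<in>UNIV. (x $ i - a $ i) * (x $ i - a $ i)))" for x :: "real ^ 'n"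
    unfolding n by (simp only: divide_inverse mult.commute)
  show ?thesis
    unfolding cutoff_def[abs_def] step_def q
    by (intro smooth_cmult smooth_flat smooth_diff smooth_const smooth_sum smooth_mult smooth_coord finite)
qed

lemma cutoff_nonneg: "0 \<le> cutoff a r x"
  and cutoff_le_1: "cutoff a r x \<le> 1"
  by (simp_all add: cutoff_def step_nonneg step_le_1)

lemma cutoff_eq_1: "0 < r \<Longrightarrow> dist a x \<le> r \<Longrightarrow> cutoff a r x = 1"
  unfolding cutoff_def
  by (rule step_eq_1) (auto simp: dist_norm norm_minus_commute intro: power_mono)

lemma cutoff_arg_le_0: "0 < r \<Longrightarrow> 2 * r \<le> dist a x \<Longrightarrow> (4 * r\<^sup>2 - (norm (x - a))\<^sup>2) / (3 * r\<^sup>2) \<le> 0"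
  using power_mono[of "2 * r" "dist a x" 2]
  by (auto simp: dist_norm norm_minus_commute divide_nonpos_nonneg)

lemma cutoff_eq_0: "0 < r \<Longrightarrow> 2 * r \<le> dist a x \<Longrightarrow> cutoff a r x = 0"
  unfolding cutoff_def by (intro step_eq_0 cutoff_arg_le_0)

lemma grad_cutoff:
  assumes "0 < r"
  shows "grad (cutoff a r) x = (- 2 * step' ((4 * r\<^sup>2 - (norm (x - a))\<^sup>2) / (3 * r\<^sup>2)) / (3 * r\<^sup>2)) *\<^sub>R (x - a)"
proof (rule grad_eqI)
  let ?q = "\<lambda>x. (4 * r\<^sup>2 - (norm (x - a))\<^sup>2) / (3 * r\<^sup>2)"
  have q: "(?q has_derivative (\<lambda>v. - 2 * (v \<bullet> (x - a)) / (3 * r\<^sup>2))) (at x)"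
    unfolding power2_norm_eq_inner using assms
    by (auto intro!: derivative_eq_intros simp: inner_commute field_simps)
  show "(cutoff a r has_derivative (\<lambda>v. v \<bullet> (- 2 * step' (?q x) / (3 * r\<^sup>2)) *\<^sub>R (x - a))) (at x)"
    using has_derivative_compose[OF q step_has_derivative[unfolded has_field_derivative_def]]
    unfolding cutoff_def[abs_def] by (simp add: mult_ac)
qed

lemma grad_cutoff_eq_0:
  assumes "0 < r" "dist a x \<le> r \<or> 2 * r \<le> dist a x"
  shows "grad (cutoff a r) x = 0"
  using assms(2)
proof
  assume "dist a x \<le> r"
  then have "1 \<le> (4 * r\<^sup>2 - (norm (x - a))\<^sup>2) / (3 * r\<^sup>2)"
    using assms(1) by (auto simp: dist_norm norm_minus_commute intro: power_mono)
  then show ?thesis by (simp add: grad_cutoff assms(1) step'_eq_0')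
next
  assume "2 * r \<le> dist a x"
  then show ?thesis
    by (simp add: grad_cutoff assms(1) step'_eq_0 cutoff_arg_le_0 del: divide_le_0_iff)
qed

text \<open>A bound for \<open>r |\<nabla>cutoff a r|\<close>: the derivative of \<open>step\<close> is at most \<open>4e\<^sup>2\<close>, and the gradient of
  its argument at most \<open>4 / (3r)\<close> on the ball of radius \<open>2r\<close>.\<close>

definition cutoff_const :: real where "cutoff_const = 6 * (exp 1)\<^sup>2"

lemma norm_grad_cutoff_le:
  assumes "0 < r"
  shows "norm (grad (cutoff a r) x) \<le> cutoff_const / r"
proof (cases "2 * r \<le> dist a x")
  case True
  then show ?thesis using assms by (simp add: grad_cutoff_eq_0 cutoff_const_def)
next
  case False
  let ?s = "step' ((4 * r\<^sup>2 - (norm (x - a))\<^sup>2) / (3 * r\<^sup>2))"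
  have "norm (grad (cutoff a r) x) = 2 * ?s / (3 * r\<^sup>2) * norm (x - a)"
    using assms by (simp add: grad_cutoff step'_nonneg abs_mult)
  also have "\<dots> \<le> 2 * (4 * (exp 1)\<^sup>2) / (3 * r\<^sup>2) * (2 * r)"
    using False assms
    by (intro mult_mono divide_right_mono mult_left_mono step'_le)
      (auto simp: dist_norm norm_minus_commute step'_nonneg)
  also have "\<dots> \<le> cutoff_const / r"
    using assms by (simp add: cutoff_const_def field_simps power2_eq_square)
  finally show ?thesis .
qed

section \<open>Test functions\<close>

lemma test_functionD: "test_function \<phi> \<Longrightarrow> smooth \<phi>"
  by (simp add: test_function_def smooth_def)

lemma test_functionI:
  assumes "smooth \<phi>" "\<And>x. \<phi> x \<noteq> 0 \<Longrightarrow> x \<in> K" "bounded K"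
  shows "test_function \<phi>"
proof -
  have "{x. \<phi> x \<noteq> 0} \<subseteq> K" using assms by auto
  then show ?thesis
    using assms by (auto simp: test_function_def smooth_def compact_eq_bounded_closed
        intro: bounded_closure bounded_subset)
qed

lemma test_function_support:
  assumes "test_function \<phi>"
  obtains R where "R > 0" "\<And>x. R \<le> norm x \<Longrightarrow> \<phi> x = 0"
proof -
  have "bounded (closure {x. \<phi> x \<noteq> 0})"
    using assms by (simp add: test_function_def compact_imp_bounded)
  then obtain R where "R > 0" "\<forall>x\<in>closure {x. \<phi> x \<noteq> 0}. norm x < R"
    using bounded_pos_less by blast
  then show thesis
    using that[of R] closure_subset[of "{x. \<phi> x \<noteq> 0}"] by force
qed

lemma test_function_mult:
  assumes "smooth \<psi>" "test_function \<phi>"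
  shows "test_function (\<lambda>x. \<psi> x * \<phi> x)"
proof -
  obtain R where "\<And>x. R \<le> norm x \<Longrightarrow> \<phi> x = 0"
    using test_function_support[OF assms(2)] by blast
  then show ?thesis
    using assms test_functionD
    by (intro test_functionI[where K="ball 0 R"] smooth_mult) force+
qed

lemma test_function_pderiv_at:
  assumes "test_function \<phi>"
  shows "test_function (pderiv_at \<phi> i)"
proof -
  obtain R where R: "\<And>x. R \<le> norm x \<Longrightarrow> \<phi> x = 0"
    using test_function_support[OF assms] by blast
  have "pderiv_at \<phi> i x = 0" if "R < norm x" for x
  proof -
    have "(\<phi> has_derivative (\<lambda>v. 0)) (at x)"
      by (rule has_derivative_transform_within_open[OF has_derivative_const[of 0], where s="- cball 0 R"])
        (use that R in auto)
    from pderiv_at_eq[OF this] show ?thesis .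
  qed
  then show ?thesis
    using smooth_pderiv_at[OF test_functionD[OF assms]]
    by (intro test_functionI[where K="cball 0 R"]) force+
qed

lemma test_function_translate:
  assumes "test_function \<phi>"
  shows "test_function (\<lambda>x. \<phi> (x - a))"
proof -
  obtain R where "R > 0" "\<And>x. R \<le> norm x \<Longrightarrow> \<phi> x = 0"
    using test_function_support[OF assms] by blast
  then show ?thesis
    using Ck_translate assms
    by (intro test_functionI[where K="ball a R"])
      (force simp: smooth_def test_function_def dist_norm norm_minus_commute)+
qed

lemma test_function_bounded:
  assumes "test_function \<phi>"
  obtains B where "B \<ge> 0" "\<And>x. \<bar>\<phi> x\<bar> \<le> B"
proof -
  obtain R where R: "\<And>x. R \<le> norm x \<Longrightarrow> \<phi> x = 0"
    using test_function_support[OF assms] by blast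
  have "compact (\<phi> ` cball 0 R)"
    using smooth_continuous[OF test_functionD[OF assms]]
    by (intro compact_continuous_image) (auto intro: continuous_on_subset)
  then obtain B where B: "B > 0" "\<forall>y\<in>\<phi> ` cball 0 R. norm y \<le> B"
    using compact_imp_bounded bounded_pos by blast
  have "\<bar>\<phi> x\<bar> \<le> B" for x
    using B R[of x] by (cases "R \<le> norm x") auto
  with B show thesis by (intro that[of B]) auto
qed

lemma test_function_cutoff: "0 < r \<Longrightarrow> test_function (cutoff a r)"
  using cutoff_eq_0[of r a]
  by (intro test_functionI[where K="ball a (2 * r)"] smooth_cutoff) force+

lemma smooth_measurable: "smooth \<phi> \<Longrightarrow> \<phi> \<in> borel_measurable borel"
  by (intro borel_measurable_continuous_onI smooth_continuous)

section \<open>Local integrability and the fundamental lemma\<close>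

text \<open>Balls about the origin are enough, since every compact set lies in one of them.\<close>

definition loc_int :: "('a::euclidean_space \<Rightarrow> 'b::{banach, second_countable_topology}) \<Rightarrow> bool"
  where "loc_int w \<longleftrightarrow> (\<forall>R. set_integrable lebesgue (cball 0 R) w)"

lemma bounded_subset_cball_0:
  fixes S :: "'a::real_normed_vector set"
  assumes "bounded S"
  obtains R where "S \<subseteq> cball 0 R"
proof -
  obtain R where "\<forall>x\<in>S. norm x \<le> R" using assms bounded_iff by blast
  then show thesis by (intro that[of R]) auto
qed

lemma loc_int_compact: "loc_int w \<Longrightarrow> compact K \<Longrightarrow> set_integrable lebesgue K w"
proof -
  assume w: "loc_int w" and K: "compact K"
  obtain R where "K \<subseteq> cball 0 R"
    using compact_imp_bounded[OF K] bounded_subset_cball_0 by blast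
  then show ?thesis
    using w K unfolding loc_int_def
    by (blast intro: set_integrable_subset lmeasurable_compact fmeasurableD)
qed

lemma loc_int_iff: "loc_int w \<longleftrightarrow> (\<forall>K. compact K \<longrightarrow> set_integrable lebesgue K w)"
  using loc_int_compact compact_cball unfolding loc_int_def by blast

lemma loc_int_measurable:
  assumes "loc_int w"
  shows "w \<in> borel_measurable lebesgue"
proof (rule borel_measurable_LIMSEQ_metric)
  show "(\<lambda>x. indicator (cball 0 (real n)) x *\<^sub>R w x) \<in> borel_measurable lebesgue" for n
    using assms unfolding loc_int_def set_integrable_def by (blast intro: borel_measurable_integrable)
  show "(\<lambda>n. indicator (cball 0 (real n)) x *\<^sub>R w x) \<longlonglongrightarrow> w x" for x
  proof (rule tendsto_eventually)
    obtain N where "norm x \<le> real N" using real_arch_simple by blast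
    then have "\<forall>n\<ge>N. norm x \<le> real n" by (meson of_nat_mono order_trans)
    then show "\<forall>\<^sub>F n in sequentially. indicator (cball 0 (real n)) x *\<^sub>R w x = w x"
      unfolding eventually_sequentially by (auto simp: indicator_def)
  qed
qed

lemma loc_int_bounded_mult:
  fixes w :: "'a::euclidean_space \<Rightarrow> 'b::{banach, second_countable_topology}"
  assumes w: "loc_int w" and \<phi>: "\<phi> \<in> borel_measurable lebesgue"
    and B: "\<And>x. \<bar>\<phi> x\<bar> \<le> B" and supp: "\<And>x. R \<le> norm x \<Longrightarrow> \<phi> x = 0"
  shows "integrable lebesgue (\<lambda>x. \<phi> x *\<^sub>R w x)"
proof (rule Bochner_Integration.integrable_bound)
  show "integrable lebesgue (\<lambda>x. B *\<^sub>R (indicator (cball 0 R) x *\<^sub>R w x))"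
    using w unfolding loc_int_def set_integrable_def by (intro integrable_scaleR_right) blast
  show "(\<lambda>x. \<phi> x *\<^sub>R w x) \<in> borel_measurable lebesgue"
    using loc_int_measurable[OF w] \<phi> by measurable
  have "B \<ge> 0" using B[of undefined] by linarith
  then show "AE x in lebesgue. norm (\<phi> x *\<^sub>R w x) \<le> norm (B *\<^sub>R (indicator (cball 0 R) x *\<^sub>R w x))"
    using B supp by (auto intro!: AE_I2 mult_right_mono split: split_indicator)
qed

lemma continuous_lebesgue_measurable:
  "continuous_on UNIV \<phi> \<Longrightarrow> \<phi> \<in> borel_measurable (lebesgue :: 'a::euclidean_space measure)"
  by (intro measurable_completion) (simp add: borel_measurable_continuous_onI)

lemma loc_int_test:
  assumes "loc_int w" "test_function \<phi>"
  shows "integrable lebesgue (\<lambda>x. \<phi> x *\<^sub>R w x)"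
proof -
  obtain R where R: "\<And>x. R \<le> norm x \<Longrightarrow> \<phi> x = 0" using test_function_support assms(2) by blast
  obtain B where B: "\<And>x. \<bar>\<phi> x\<bar> \<le> B" using test_function_bounded assms(2) by blast
  show ?thesis
    using smooth_continuous[OF test_functionD[OF assms(2)]]
    by (intro loc_int_bounded_mult[OF assms(1) _ B R] continuous_lebesgue_measurable)
qed

lemma loc_int_continuous_mult:
  fixes w :: "'a::euclidean_space \<Rightarrow> 'b::{banach, second_countable_topology}"
  assumes w: "loc_int w" and \<phi>: "continuous_on UNIV \<phi>"
  shows "loc_int (\<lambda>x. \<phi> x *\<^sub>R w x)"
  unfolding loc_int_def
proof
  fix R :: real
  have "compact (\<phi> ` cball 0 R)"
    using \<phi> by (intro compact_continuous_image) (auto intro: continuous_on_subset)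
  then obtain B where B: "B > 0" "\<forall>y\<in>\<phi> ` cball 0 R. norm y \<le> B"
    using compact_imp_bounded bounded_pos by blast
  have "integrable lebesgue (\<lambda>x. (indicator (cball 0 R) x * \<phi> x) *\<^sub>R w x)"
    using B by (intro loc_int_bounded_mult[OF w, where B=B and R="R + 1"] borel_measurable_times
        continuous_lebesgue_measurable[OF \<phi>] borel_measurable_indicator fmeasurableD lmeasurable_cball)
      (auto split: split_indicator)
  then show "set_integrable lebesgue (cball 0 R) (\<lambda>x. \<phi> x *\<^sub>R w x)"
    by (simp add: set_integrable_def)
qed

lemma loc_int_add: "loc_int v \<Longrightarrow> loc_int w \<Longrightarrow> loc_int (\<lambda>x. v x + w x)"
  by (auto simp: loc_int_def)

lemma loc_int_diff: "loc_int v \<Longrightarrow> loc_int w \<Longrightarrow> loc_int (\<lambda>x. v x - w x)"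
  by (auto simp: loc_int_def)

lemma loc_int_bounded_linear:
  "bounded_linear T \<Longrightarrow> loc_int w \<Longrightarrow> loc_int (\<lambda>x. T (w x))"
  unfolding loc_int_def set_integrable_def
  by (metis (no_types, lifting) integrable_bounded_linear linear_simps(5) Bochner_Integration.integrable_cong)

lemma loc_int_nth: "loc_int G \<Longrightarrow> loc_int (\<lambda>x. G x $ i)"
  by (rule loc_int_bounded_linear[OF bounded_linear_vec_nth])

lemma loc_int_const: "loc_int (\<lambda>x. c)"
  unfolding loc_int_def set_integrable_def
  by (intro allI integrable_scaleR_left integrable_real_indicator)
    (auto simp: emeasure_lborel_cball_finite[unfolded infinity_ennreal_def])

lemma loc_int_continuous: "continuous_on UNIV w \<Longrightarrow> loc_int (w :: 'a::euclidean_space \<Rightarrow> real)"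
  using loc_int_continuous_mult[OF loc_int_const[of "1::real"]] by simp

text \<open>On a bounded set, \<open>|w| \<le> 1 + |w|\<^sup>2\<close> is integrable.\<close>

lemma loc_int_if_square:
  fixes w :: "'a::euclidean_space \<Rightarrow> 'b::{banach, second_countable_topology}"
  assumes w[measurable]: "w \<in> borel_measurable lebesgue" and "loc_int (\<lambda>x. (norm (w x))\<^sup>2)"
  shows "loc_int w"
  unfolding loc_int_def set_integrable_def
proof
  fix R :: real
  have [measurable]: "cball 0 R \<in> sets (lebesgue :: 'a measure)" by auto
  show "integrable lebesgue (\<lambda>x. indicat_real (cball 0 R) x *\<^sub>R w x)"
  proof (rule Bochner_Integration.integrable_bound)
    show "integrable lebesgue (\<lambda>x. indicat_real (cball 0 R) x *\<^sub>R (1 + (norm (w x))\<^sup>2))"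
      using loc_int_add[OF loc_int_const[of "1::real"] assms(2)]
      unfolding loc_int_def set_integrable_def by blast
    have "norm y \<le> 1 + (norm y)\<^sup>2" for y :: 'b
      using zero_le_power2[of "norm y - 1"] norm_ge_zero[of y] unfolding power2_diff one_power2 mult_1_right by linarith
    then show "AE x in lebesgue. norm (indicat_real (cball 0 R) x *\<^sub>R w x)
        \<le> norm (indicat_real (cball 0 R) x *\<^sub>R (1 + (norm (w x))\<^sup>2))"
      by (auto intro!: AE_I2 split: split_indicator)
  qed measurable
qed

lemma L2_loc_loc_int:
  assumes "u \<in> L2_loc"
  shows "loc_int u"
proof (rule loc_int_if_square)
  show "u \<in> borel_measurable lebesgue"
    using assms unfolding L2_loc_def by blast
  show "loc_int (\<lambda>x. (norm (u x))\<^sup>2)"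
    using assms unfolding L2_loc_def loc_int_iff real_norm_def power2_abs by blast
qed

lemma lebesgue_measurable_ae_borel:
  fixes w :: "'a::euclidean_space \<Rightarrow> real"
  assumes "w \<in> borel_measurable lebesgue"
  obtains w' where "w' \<in> borel_measurable borel" "AE x in lebesgue. w x = w' x"
  using completion_ex_borel_measurable_real[OF assms] AE_completion by fastforce

lemma flat_0_le_1: "flat 0 t \<le> 1"
  by (simp add: flat_def)

lemma flat_0_tendsto: "(\<lambda>k. flat 0 (real (Suc k) * t)) \<longlonglongrightarrow> (if 0 < t then 1 else 0)"
proof (cases "0 < t")
  case True
  have "(\<lambda>k. exp (- ((1 / t) * inverse (real (Suc k))))) \<longlonglongrightarrow> exp (- ((1 / t) * 0))"
    by (intro tendsto_intros LIMSEQ_inverse_real_of_nat)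
  moreover have "flat 0 (real (Suc k) * t) = exp (- ((1 / t) * inverse (real (Suc k))))" for k
    using True by (simp add: flat_def mult_le_0_iff divide_inverse mult.commute del: of_nat_Suc)
  ultimately show ?thesis using True by simp
next
  case False
  then have "flat 0 (real (Suc k) * t) = 0" for k
    by (simp add: flat_def mult_nonneg_nonpos del: of_nat_Suc)
  then show ?thesis using False by simp
qed

text \<open>Test functions that converge boundedly to the indicator of the open box, as \<open>flat 0 (k t)\<close> tends to \<open>1\<close> for \<open>t > 0\<close>.\<close>

definition box_bump :: "real ^ 'n \<Rightarrow> real ^ 'n \<Rightarrow> nat \<Rightarrow> real ^ 'n \<Rightarrow> real"
  where "box_bump l u k x =
    (\<Prod>i\<in>UNIV. flat 0 (real (Suc k) * (x $ i - l $ i)) * flat 0 (real (Suc k) * (u $ i - x $ i)))"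

lemma box_bump_nonneg: "0 \<le> box_bump l u k x"
  and box_bump_le_1: "box_bump l u k x \<le> 1"
  unfolding box_bump_def
  by (auto intro!: prod_nonneg prod_le_1 mult_le_one simp: flat_nonneg flat_0_le_1)

lemma box_bump_eq_0: "x \<notin> box l u \<Longrightarrow> box_bump l u k x = 0"
proof -
  assume "x \<notin> box l u"
  then obtain i where "x $ i \<le> l $ i \<or> u $ i \<le> x $ i"
    by (auto simp: mem_box_cart not_less)
  then have "real (Suc k) * (x $ i - l $ i) \<le> 0 \<or> real (Suc k) * (u $ i - x $ i) \<le> 0"
    by (simp add: mult_le_0_iff del: of_nat_Suc)
  then have "flat 0 (real (Suc k) * (x $ i - l $ i)) * flat 0 (real (Suc k) * (u $ i - x $ i)) = 0"
    by (auto simp: flat_def)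
  then show ?thesis unfolding box_bump_def by (intro prod_zero) auto
qed

lemma test_function_box_bump: "test_function (box_bump l u k)"
proof (rule test_functionI)
  show "smooth (box_bump l u k)"
    unfolding box_bump_def[abs_def]
    by (intro smooth_prod smooth_mult smooth_flat smooth_cmult smooth_diff smooth_coord smooth_const finite)
  show "x \<in> box l u" if "box_bump l u k x \<noteq> 0" for x
    using box_bump_eq_0 that by blast
qed (rule bounded_box)

lemma box_bump_tendsto: "(\<lambda>k. box_bump l u k x) \<longlonglongrightarrow> indicator (box l u) x"
proof -
  have "(\<lambda>k. box_bump l u k x) \<longlonglongrightarrow>
      (\<Prod>i\<in>UNIV. (if 0 < x $ i - l $ i then 1 else 0) * (if 0 < u $ i - x $ i then 1 else 0))"
    unfolding box_bump_def by (intro tendsto_prod tendsto_mult flat_0_tendsto)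
  also have "(\<Prod>i\<in>UNIV. (if 0 < x $ i - l $ i then 1 else 0) * (if 0 < u $ i - x $ i then 1 else 0)) =
      (indicator (box l u) x :: real)"
  proof (cases "x \<in> box l u")
    case True
    then show ?thesis by (intro trans[OF prod.neutral]) (auto simp: mem_box_cart)
  next
    case False
    then obtain i where "\<not> (l $ i < x $ i \<and> x $ i < u $ i)" by (auto simp: mem_box_cart)
    then show ?thesis using False by (intro trans[OF prod_zero]) auto
  qed
  finally show ?thesis .
qed

text \<open>Testing with \<open>box_bump\<close> shows that \<open>w\<close> has integral zero over every box.  Boxes generate the Borel
  sets and are stable under intersection, so the integral over every bounded Borel set is zero.\<close>

lemma fundamental_lemma:
  fixes w :: "real ^ 'n \<Rightarrow> real"
  assumes w: "loc_int w"
    and test: "\<And>\<phi>. test_function \<phi> \<Longrightarrow> (LINT x|lebesgue. w x * \<phi> x) = 0"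
  shows "AE x in lebesgue. w x = 0"
proof -
  obtain w' where w'[measurable]: "w' \<in> borel_measurable borel" and ae: "AE x in lebesgue. w x = w' x"
    using lebesgue_measurable_ae_borel[OF loc_int_measurable[OF w]] by blast
  have box0: "(LINT x|lebesgue. indicator (box l u) x * w x) = 0" for l u
  proof -
    obtain R where R: "box l u \<subseteq> cball 0 R"
      using bounded_box bounded_subset_cball_0 by blast
    have "(\<lambda>k. LINT x|lebesgue. box_bump l u k x * w x) \<longlonglongrightarrow> (LINT x|lebesgue. indicator (box l u) x * w x)"
    proof (rule integral_dominated_convergence)
      show "integrable lebesgue (\<lambda>x. norm (indicator (cball 0 R) x *\<^sub>R w x))"
        using w unfolding loc_int_def set_integrable_def by auto
      show "(\<lambda>x. indicator (box l u) x * w x) \<in> borel_measurable lebesgue"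
        by (intro borel_measurable_times borel_measurable_indicator loc_int_measurable[OF w]) simp
      show "(\<lambda>x. box_bump l u k x * w x) \<in> borel_measurable lebesgue" for k
        using loc_int_test[OF w test_function_box_bump[of l u k]] by auto
      show "AE x in lebesgue. (\<lambda>k. box_bump l u k x * w x) \<longlonglongrightarrow> indicator (box l u) x * w x"
        by (intro AE_I2 tendsto_mult box_bump_tendsto tendsto_const)
      show "AE x in lebesgue. norm (box_bump l u k x * w x) \<le> norm (indicator (cball 0 R) x *\<^sub>R w x)" for k
      proof (intro AE_I2)
        fix x
        show "norm (box_bump l u k x * w x) \<le> norm (indicator (cball 0 R) x *\<^sub>R w x)"
        proof (cases "x \<in> box l u")
          case True
          then have "x \<in> cball 0 R" using R by blast
          then show ?thesis
            using box_bump_nonneg[of l u k x] box_bump_le_1[of l u k x]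
            by (simp add: abs_mult mult_left_le_one_le)
        qed (simp add: box_bump_eq_0)
      qed
    qed
    moreover have "(LINT x|lebesgue. box_bump l u k x * w x) = 0" for k
      using test[OF test_function_box_bump[of l u k]] by (simp add: mult.commute)
    ultimately show ?thesis by (simp add: LIMSEQ_const_iff)
  qed
  have "AE x in lborel. indicator (ball 0 (real n)) x * w' x = 0" for n
  proof -
    let ?B = "cball (0::real^'n) (real n)"
    let ?Q = "box (- (\<chi> i. real n) :: real^'n) (\<chi> i. real n)"
    let ?f = "\<lambda>x. indicator ?Q x * w' x"
    have "integrable lebesgue (\<lambda>x. indicator (cbox (- (\<chi> i. real n) :: real^'n) (\<chi> i. real n)) x *\<^sub>R w x)"
      using loc_int_compact[OF w, of "cbox (- (\<chi> i. real n)) (\<chi> i. real n)"] unfolding set_integrable_def by auto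
    then have "integrable lebesgue (\<lambda>x. indicator ?Q x *\<^sub>R w x)"
      unfolding set_integrable_def[symmetric]
      by (rule set_integrable_subset) (auto intro: box_subset_cbox[THEN subsetD])
    then have "integrable lebesgue ?f"
      by (rule integrable_cong_AE_imp) (use ae in \<open>auto simp: measurable_completion\<close>)
    then have int: "integrable lborel ?f"
      by (simp add: integrable_completion)
    have "AE x in lborel. ?f x = 0"
    proof (rule density_unique_real[OF int])
      fix A :: "(real^'n) set" assume "A \<in> sets lborel"
      then have A: "A \<in> sigma_sets UNIV (range (\<lambda>(a, b). box a b))"
        unfolding sets_lborel borel_eq_box by simp
      have stable: "Int_stable (range (\<lambda>(a, b). box a b :: (real^'n) set))"
        by (auto simp: Int_stable_def box_Int_box)
      have closed: "range (\<lambda>(a, b). box a b) \<subseteq> Pow (UNIV :: (real^'n) set)" by simp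
      from stable closed A have "(LINT x:A|lborel. ?f x) = 0"
      proof (induction rule: sigma_sets_induct_disjoint)
        case (basic A)
        then obtain l u where A: "A = box l u" by auto
        obtain l' u' where I: "A \<inter> ?Q = box l' u'"
          unfolding A box_Int_box by blast
        have "(LINT x:A|lborel. ?f x) = (LINT x|lborel. indicator (box l' u') x * w' x)"
          unfolding set_lebesgue_integral_def I[symmetric]
          by (intro Bochner_Integration.integral_cong) (auto split: split_indicator)
        also have "\<dots> = (LINT x|lebesgue. indicator (box l' u') x * w' x)"
          by (rule integral_completion[symmetric]) measurable
        also have "\<dots> = (LINT x|lebesgue. indicator (box l' u') x * w x)"
          using ae
          by (intro integral_cong_AE borel_measurable_times borel_measurable_indicator
              loc_int_measurable[OF w]) (auto simp: measurable_completion)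
        finally show ?case using box0 by simp
      next
        case empty
        then show ?case by (simp add: set_lebesgue_integral_def)
      next
        case (compl A)
        then have "A \<in> sets lborel" unfolding sets_lborel borel_eq_box by simp
        moreover have "(LINT x:UNIV|lborel. ?f x) = (LINT x|lebesgue. ?f x)"
          unfolding set_lebesgue_integral_def
          by (subst integral_completion) simp_all
        moreover have "(LINT x|lebesgue. ?f x) = (LINT x|lebesgue. indicator ?Q x * w x)"
          using ae
          by (intro integral_cong_AE borel_measurable_times borel_measurable_indicator
              loc_int_measurable[OF w]) (auto simp: measurable_completion)
        moreover have "set_integrable lborel B ?f" if "B \<in> sets lborel" for B
          using int that unfolding set_integrable_def by (intro integrable_mult_indicator)
        ultimately show ?case
          using compl box0 set_integral_Un[of A "UNIV - A" lborel ?f] by auto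
      next
        case (union A)
        have A: "range A \<subseteq> sets lborel" unfolding sets_lborel borel_eq_box using union by simp
        have "set_integrable lborel (\<Union>i. A i) ?f"
          using int A unfolding set_integrable_def by (intro integrable_mult_indicator) auto
        then have "(LINT x:(\<Union>i. A i)|lborel. ?f x) = (\<Sum>i. (LINT x:A i|lborel. ?f x))"
          using A union by (intro lebesgue_integral_countable_add) (auto simp: disjoint_family_on_def)
        then show ?case using union by simp
      qed
      then show "(LINT x:A|lborel. ?f x) = (LINT x:A|lborel. 0)"
        by (simp add: set_lebesgue_integral_def)
    qed simp
    then show ?thesis
    proof eventually_elim
      case (elim x)
      have "x \<in> ?Q" if "norm x < real n"
      proof -
        have "\<bar>x $ i\<bar> < real n" for i
          using component_le_norm_cart[of x i] that by linarith
        then show ?thesis by (auto simp: mem_box_cart abs_less_iff minus_less_iff)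
      qed
      then show ?case using elim by (auto split: split_indicator)
    qed
  qed
  then have "AE x in lborel. \<forall>n. indicator (ball 0 (real n)) x * w' x = 0"
    unfolding AE_all_countable by blast
  then have "AE x in lborel. w' x = 0"
  proof eventually_elim
    case (elim x)
    obtain n where "norm x < real n" using reals_Archimedean2 by blast
    then show ?case using elim[THEN spec, of n] by simp
  qed
  then have "AE x in lebesgue. w' x = 0" by (rule AE_completion)
  with ae show ?thesis by eventually_elim simp
qed

section \<open>Distributional gradients\<close>

lemma distributional_gradient_iff:
  "has_distributional_gradient u G \<longleftrightarrow> loc_int G \<and>
    (\<forall>\<phi> i. test_function \<phi> \<longrightarrow>
       (LINT x|lebesgue. u x * pderiv_at \<phi> i x) = - (LINT x|lebesgue. G x $ i * \<phi> x))"
  by (simp add: has_distributional_gradient_def loc_int_iff)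

lemma distributional_gradient_unique:
  assumes "has_distributional_gradient u G" "has_distributional_gradient u H"
  shows "AE x in lebesgue. G x = H x"
proof -
  have G: "loc_int G" and H: "loc_int H"
    using assms by (auto simp: distributional_gradient_iff)
  have "AE x in lebesgue. G x $ i - H x $ i = 0" for i
  proof (rule fundamental_lemma)
    show "loc_int (\<lambda>x. G x $ i - H x $ i)"
      by (intro loc_int_diff loc_int_nth G H)
    fix \<phi> :: "real ^ 'a \<Rightarrow> real" assume \<phi>: "test_function \<phi>"
    have "integrable lebesgue (\<lambda>x. G x $ i * \<phi> x)" "integrable lebesgue (\<lambda>x. H x $ i * \<phi> x)"
      using loc_int_test[OF loc_int_nth[OF G] \<phi>] loc_int_test[OF loc_int_nth[OF H] \<phi>]
      by (simp_all add: mult.commute)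
    moreover have "(LINT x|lebesgue. G x $ i * \<phi> x) = (LINT x|lebesgue. H x $ i * \<phi> x)"
      using assms \<phi> by (simp add: distributional_gradient_iff)
    ultimately show "(LINT x|lebesgue. (G x $ i - H x $ i) * \<phi> x) = 0"
      by (simp add: left_diff_distrib)
  qed
  then have "AE x in lebesgue. \<forall>i. G x $ i - H x $ i = 0"
    by (simp add: AE_all_countable)
  then show ?thesis
    by eventually_elim (simp add: vec_eq_iff)
qed

lemma weak_gradient_unique:
  assumes "has_distributional_gradient u G"
  shows "AE x in lebesgue. weak_gradient u x = G x"
  unfolding weak_gradient_def
  using someI[of "has_distributional_gradient u" G, OF assms] assms
  by (rule distributional_gradient_unique)

lemma distributional_gradient_add:
  assumes u: "loc_int u" and v: "loc_int v"
    and G: "has_distributional_gradient u G" and H: "has_distributional_gradient v H"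
  shows "has_distributional_gradient (\<lambda>x. u x + v x) (\<lambda>x. G x + H x)"
  unfolding distributional_gradient_iff
proof (intro conjI allI impI)
  have lG: "loc_int G" and lH: "loc_int H"
    using G H by (auto simp: distributional_gradient_iff)
  then show "loc_int (\<lambda>x. G x + H x)" by (rule loc_int_add)
  fix \<phi> i assume \<phi>: "test_function (\<phi> :: real ^ 'a \<Rightarrow> real)"
  have "integrable lebesgue (\<lambda>x. G x $ i * \<phi> x)" "integrable lebesgue (\<lambda>x. H x $ i * \<phi> x)"
    "integrable lebesgue (\<lambda>x. u x * pderiv_at \<phi> i x)" "integrable lebesgue (\<lambda>x. v x * pderiv_at \<phi> i x)"
    using loc_int_test[OF loc_int_nth[OF lG] \<phi>] loc_int_test[OF loc_int_nth[OF lH] \<phi>]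
      loc_int_test[OF u test_function_pderiv_at[OF \<phi>]] loc_int_test[OF v test_function_pderiv_at[OF \<phi>]]
    by (simp_all add: mult.commute)
  then show "(LINT x|lebesgue. (u x + v x) * pderiv_at \<phi> i x) = - (LINT x|lebesgue. (G x + H x) $ i * \<phi> x)"
    using G H \<phi> by (simp add: distributional_gradient_iff distrib_right)
qed

lemma continuous_on_grad: "smooth \<eta> \<Longrightarrow> continuous_on UNIV (grad \<eta>)"
  unfolding grad_def[abs_def]
  by (intro continuous_on_vec_lambda smooth_continuous smooth_pderiv_at)

lemma loc_int_grad_mult:
  assumes u: "loc_int u" and \<eta>: "smooth \<eta>"
  shows "loc_int (\<lambda>x. u x *\<^sub>R grad \<eta> x :: real ^ 'n)"
proof -
  have "loc_int (\<lambda>x. pderiv_at \<eta> i x * u x)" for i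
    using loc_int_continuous_mult[OF u smooth_continuous[OF smooth_pderiv_at[OF \<eta>]]] by simp
  then have "loc_int (\<lambda>x. (pderiv_at \<eta> i x * u x) *\<^sub>R (axis i 1 :: real ^ 'n))" for i
    by (rule loc_int_bounded_linear[OF bounded_linear_scaleR_left])
  then have "loc_int (\<lambda>x. \<Sum>i\<in>UNIV. (pderiv_at \<eta> i x * u x) *\<^sub>R (axis i 1 :: real ^ 'n))"
    unfolding loc_int_def set_integrable_def scaleR_sum_right
    by (intro allI Bochner_Integration.integrable_sum) blast
  moreover have "(\<Sum>i\<in>UNIV. (pderiv_at \<eta> i x * u x) *\<^sub>R (axis i 1 :: real ^ 'n)) = u x *\<^sub>R grad \<eta> x" for x
    using basis_expansion[of "u x *\<^sub>R grad \<eta> x"]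
    by (simp add: grad_def mult.commute scalar_mult_eq_scaleR)
  ultimately show ?thesis by simp
qed

lemma distributional_gradient_mult:
  assumes u: "loc_int u" and \<eta>: "smooth \<eta>" and G: "has_distributional_gradient u G"
  shows "has_distributional_gradient (\<lambda>x. \<eta> x * u x) (\<lambda>x. \<eta> x *\<^sub>R G x + u x *\<^sub>R grad \<eta> x)"
  unfolding distributional_gradient_iff
proof (intro conjI allI impI)
  have lG: "loc_int G"
    using G by (auto simp: distributional_gradient_iff)
  then show "loc_int (\<lambda>x. \<eta> x *\<^sub>R G x + u x *\<^sub>R grad \<eta> x)"
    by (intro loc_int_add loc_int_continuous_mult loc_int_grad_mult smooth_continuous u \<eta>)
  fix \<phi> i assume \<phi>: "test_function (\<phi> :: real ^ 'a \<Rightarrow> real)"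
  note t = test_function_mult[OF \<eta> \<phi>]
  have eq: "pderiv_at (\<lambda>x. \<eta> x * \<phi> x) i x = \<eta> x * pderiv_at \<phi> i x + pderiv_at \<eta> i x * \<phi> x" for x
    by (intro pderiv_at_mult smooth_differentiable \<eta> test_functionD[OF \<phi>])
  have i1: "integrable lebesgue (\<lambda>x. u x * (\<eta> x * pderiv_at \<phi> i x))"
    using loc_int_test[OF u test_function_mult[OF \<eta> test_function_pderiv_at[OF \<phi>]]] by (simp add: mult_ac)
  have i2: "integrable lebesgue (\<lambda>x. u x * (pderiv_at \<eta> i x * \<phi> x))"
    using loc_int_test[OF u test_function_mult[OF smooth_pderiv_at[OF \<eta>] \<phi>]] by (simp add: mult_ac)
  have i3: "integrable lebesgue (\<lambda>x. G x $ i * (\<eta> x * \<phi> x))"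
    using loc_int_test[OF loc_int_nth[OF lG] t] by (simp add: mult_ac)
  have "(LINT x|lebesgue. u x * pderiv_at (\<lambda>x. \<eta> x * \<phi> x) i x) =
      - (LINT x|lebesgue. G x $ i * (\<eta> x * \<phi> x))"
    using G t by (auto simp: distributional_gradient_iff)
  moreover have "(LINT x|lebesgue. u x * pderiv_at (\<lambda>x. \<eta> x * \<phi> x) i x) =
      (LINT x|lebesgue. u x * (\<eta> x * pderiv_at \<phi> i x)) + (LINT x|lebesgue. u x * (pderiv_at \<eta> i x * \<phi> x))"
    using i1 i2 by (simp add: eq distrib_left)
  moreover have "(LINT x|lebesgue. (\<eta> x *\<^sub>R G x + u x *\<^sub>R grad \<eta> x) $ i * \<phi> x) =
      (LINT x|lebesgue. G x $ i * (\<eta> x * \<phi> x) + u x * (pderiv_at \<eta> i x * \<phi> x))"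
    by (intro Bochner_Integration.integral_cong) (auto simp: grad_def algebra_simps)
  ultimately show "(LINT x|lebesgue. \<eta> x * u x * pderiv_at \<phi> i x) =
      - (LINT x|lebesgue. (\<eta> x *\<^sub>R G x + u x *\<^sub>R grad \<eta> x) $ i * \<phi> x)"
    using i2 i3 by (simp add: mult_ac)
qed

lemma lborel_integral_translate:
  fixes f :: "'a::euclidean_space \<Rightarrow> real"
  assumes "f \<in> borel_measurable borel"
  shows "(LINT x|lborel. f (x + h)) = (LINT x|lborel. f x)"
proof -
  have "(LINT x|lborel. f x) = (LINT x|distr lborel borel ((+) h). f x)"
    by (simp add: lborel_distr_plus)
  also have "\<dots> = (LINT x|lborel. f (h + x))"
    using assms by (intro integral_distr) auto
  finally show ?thesis by (simp add: add.commute)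
qed

lemma lborel_nn_integral_translate:
  fixes f :: "'a::euclidean_space \<Rightarrow> ennreal"
  assumes "f \<in> borel_measurable borel"
  shows "(\<integral>\<^sup>+x. f (x + h) \<partial>lborel) = (\<integral>\<^sup>+x. f x \<partial>lborel)"
proof -
  have "(\<integral>\<^sup>+x. f x \<partial>lborel) = (\<integral>\<^sup>+x. f x \<partial>distr lborel borel ((+) h))"
    by (simp add: lborel_distr_plus)
  also have "\<dots> = (\<integral>\<^sup>+x. f (h + x) \<partial>lborel)"
    using assms by (intro nn_integral_distr) auto
  finally show ?thesis by (simp add: add.commute)
qed

lemma test_function_lborel_integrable:
  assumes "test_function \<phi>"
  shows "integrable lborel \<phi>"
proof -
  have "integrable lebesgue (\<lambda>x. \<phi> x *\<^sub>R (1::real))"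
    by (rule loc_int_test[OF loc_int_const assms])
  then show ?thesis
    using smooth_measurable[OF test_functionD[OF assms]] by (simp add: integrable_completion)
qed

text \<open>Difference quotients of a test function have integral zero by translation invariance; they are bounded
  by the mean value theorem, and dominated convergence applies.\<close>

lemma integral_pderiv_test_function:
  assumes \<phi>: "test_function (\<phi> :: real ^ 'n \<Rightarrow> real)"
  shows "(LINT x|lborel. pderiv_at \<phi> i x) = 0"
proof -
  define e :: "real ^ 'n" where "e = axis i 1"
  define t where "t n = inverse (real (Suc n))" for n
  have t: "0 < t n" "t n \<le> 1" "t \<longlonglongrightarrow> 0" for n
    using LIMSEQ_inverse_real_of_nat by (auto simp: t_def[abs_def] divide_simps)
  have sm: "smooth \<phi>" by (rule test_functionD[OF \<phi>])
  have [measurable]: "\<phi> \<in> borel_measurable borel" "pderiv_at \<phi> i \<in> borel_measurable borel"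
    using sm smooth_pderiv_at smooth_measurable by blast+
  obtain R where R: "R > 0" "\<And>x. R \<le> norm x \<Longrightarrow> \<phi> x = 0" using test_function_support \<phi> by blast
  obtain B where B: "B \<ge> 0" "\<And>x. \<bar>pderiv_at \<phi> i x\<bar> \<le> B"
    using test_function_bounded test_function_pderiv_at[OF \<phi>] by blast
  have line: "((\<lambda>s. \<phi> (x + s *\<^sub>R e)) has_real_derivative pderiv_at \<phi> i (x + s *\<^sub>R e)) (at s)" for x s
  proof -
    have "((\<lambda>s. \<phi> (x + s *\<^sub>R e)) has_derivative (\<lambda>h. (h *\<^sub>R e) \<bullet> grad \<phi> (x + s *\<^sub>R e))) (at s)"
      by (rule has_derivative_compose[OF _ smooth_has_derivative[OF sm]])
        (auto intro!: derivative_eq_intros)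
    then show ?thesis
      unfolding has_field_derivative_def
      by (rule has_derivative_eq_rhs) (auto simp: e_def grad_def inner_axis')
  qed
  have "(\<lambda>n. LINT x|lborel. (\<phi> (x + t n *\<^sub>R e) - \<phi> x) / t n) \<longlonglongrightarrow> (LINT x|lborel. pderiv_at \<phi> i x)"
  proof (rule integral_dominated_convergence)
    show "integrable lborel (\<lambda>x. B * indicator (cball 0 (R + 1)) x)"
      by (simp add: emeasure_lborel_cball_finite[unfolded infinity_ennreal_def])
    show "AE x in lborel. (\<lambda>n. (\<phi> (x + t n *\<^sub>R e) - \<phi> x) / t n) \<longlonglongrightarrow> pderiv_at \<phi> i x"
    proof (intro AE_I2)
      fix x
      have "((\<lambda>h. (\<phi> (x + h *\<^sub>R e) - \<phi> x) / h) \<longlongrightarrow> pderiv_at \<phi> i x) (at 0)"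
        using line[of x 0] by (simp add: DERIV_def)
      moreover have "filterlim t (at 0) sequentially"
        using t(1,3) by (auto simp: filterlim_at intro!: always_eventually) (metis less_irrefl)
      ultimately show "(\<lambda>n. (\<phi> (x + t n *\<^sub>R e) - \<phi> x) / t n) \<longlonglongrightarrow> pderiv_at \<phi> i x"
        by (rule filterlim_compose)
    qed
    show "AE x in lborel. norm ((\<phi> (x + t n *\<^sub>R e) - \<phi> x) / t n) \<le> B * indicator (cball 0 (R + 1)) x" for n
    proof (intro AE_I2)
      fix x
      show "norm ((\<phi> (x + t n *\<^sub>R e) - \<phi> x) / t n) \<le> B * indicator (cball 0 (R + 1)) x"
      proof (cases "norm x \<le> R + 1")
        case True
        obtain s where "\<phi> (x + t n *\<^sub>R e) - \<phi> (x + 0 *\<^sub>R e) = (t n - 0) * pderiv_at \<phi> i (x + s *\<^sub>R e)"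
          using MVT2[OF t(1)[of n] line] by blast
        then have "(\<phi> (x + t n *\<^sub>R e) - \<phi> x) / t n = pderiv_at \<phi> i (x + s *\<^sub>R e)"
          using t(1)[of n] by (simp add: field_simps)
        then show ?thesis using True B(2) by simp
      next
        case False
        have "norm (t n *\<^sub>R e) \<le> 1" using t(1,2)[of n] by (simp add: e_def)
        then have "norm (x + t n *\<^sub>R e) \<ge> R"
          using False norm_triangle_ineq4[of "x + t n *\<^sub>R e" "t n *\<^sub>R e"] by simp
        then show ?thesis using False R by simp
      qed
    qed
  qed measurable
  moreover have "(LINT x|lborel. (\<phi> (x + t n *\<^sub>R e) - \<phi> x) / t n) = 0" for n
  proof -
    have "integrable lborel (\<lambda>x. \<phi> (x - (- (t n *\<^sub>R e))))"
      by (intro test_function_lborel_integrable test_function_translate \<phi>)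
    then show ?thesis
      using test_function_lborel_integrable[OF \<phi>] lborel_integral_translate[of \<phi> "t n *\<^sub>R e"] by simp
  qed
  ultimately have "(\<lambda>n. 0) \<longlonglongrightarrow> (LINT x|lborel. pderiv_at \<phi> i x)"
    by (simp only:)
  then show ?thesis by (simp only: LIMSEQ_const_iff)
qed

text \<open>For the constant function \<open>1\<close> the claim is the vanishing of integrals of partial derivatives; the
  product rule, applied to \<open>\<eta> \<cdot> 1\<close>, gives the general case.\<close>

lemma distributional_gradient_smooth:
  assumes "smooth (\<eta> :: real ^ 'n \<Rightarrow> real)"
  shows "has_distributional_gradient \<eta> (grad \<eta>)"
proof -
  have "has_distributional_gradient (\<lambda>_. 1) (\<lambda>_. 0 :: real ^ 'n)"
    unfolding distributional_gradient_iff
  proof (intro conjI allI impI)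
    fix \<phi> :: "real ^ 'n \<Rightarrow> real" and i assume "test_function \<phi>"
    then have "(LINT x|lebesgue. pderiv_at \<phi> i x) = 0"
      using integral_pderiv_test_function[of \<phi> i] smooth_measurable[OF smooth_pderiv_at[OF test_functionD]]
      by (subst integral_completion) auto
    then show "(LINT x|lebesgue. 1 * pderiv_at \<phi> i x) = - (LINT x|lebesgue. (0::real^'n) $ i * \<phi> x)"
      by simp
  qed (rule loc_int_const)
  from distributional_gradient_mult[OF loc_int_const assms this] show ?thesis by simp
qed

section \<open>Translations of weakly differentiable functions\<close>

text \<open>The next facts permit passing to Borel representatives, for which Fubini on the product of two Borel
  measures is available.\<close>

lemma loc_int_cong_AE:
  assumes w: "loc_int w" and w': "w' \<in> borel_measurable lebesgue" and ae: "AE x in lebesgue. w x = w' x"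
  shows "loc_int w'"
  unfolding loc_int_def set_integrable_def
proof
  fix R
  show "integrable lebesgue (\<lambda>x. indicat_real (cball 0 R) x *\<^sub>R w' x)"
  proof (rule integrable_cong_AE_imp)
    show "integrable lebesgue (\<lambda>x. indicat_real (cball 0 R) x *\<^sub>R w x)"
      using w unfolding loc_int_def set_integrable_def by blast
    show "(\<lambda>x. indicat_real (cball 0 R) x *\<^sub>R w' x) \<in> borel_measurable lebesgue"
      by (intro borel_measurable_scaleR borel_measurable_indicator w') simp
    show "AE x in lebesgue. indicat_real (cball 0 R) x *\<^sub>R w x = indicat_real (cball 0 R) x *\<^sub>R w' x"
      using ae by eventually_elim simp
  qed
qed

lemma distributional_gradient_cong_AE:
  assumes G: "has_distributional_gradient u G" and u: "u \<in> borel_measurable lebesgue"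
    and u': "u' \<in> borel_measurable lebesgue" and G': "G' \<in> borel_measurable lebesgue"
    and ae: "AE x in lebesgue. u x = u' x" "AE x in lebesgue. G x = G' x"
  shows "has_distributional_gradient u' G'"
  unfolding distributional_gradient_iff
proof (intro conjI allI impI)
  have lG: "loc_int G" using G by (simp add: distributional_gradient_iff)
  note Gm = loc_int_measurable[OF lG]
  show "loc_int G'" by (rule loc_int_cong_AE[OF lG G' ae(2)])
  fix \<phi> :: "real ^ 'a \<Rightarrow> real" and i assume \<phi>: "test_function \<phi>"
  have m: "\<phi> \<in> borel_measurable lebesgue" "pderiv_at \<phi> i \<in> borel_measurable lebesgue"
    using \<phi> by (auto intro!: continuous_lebesgue_measurable smooth_continuous smooth_pderiv_at dest: test_functionD)
  have n: "(\<lambda>x. H x $ i) \<in> borel_measurable lebesgue" if "H \<in> borel_measurable lebesgue" for H :: "real ^ 'a \<Rightarrow> real ^ 'a"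
    using measurable_compose[OF that, of "\<lambda>v. v $ i" borel] by auto
  have "(LINT x|lebesgue. u' x * pderiv_at \<phi> i x) = (LINT x|lebesgue. u x * pderiv_at \<phi> i x)"
    using ae(1) by (intro integral_cong_AE borel_measurable_times u u' m) auto
  also have "\<dots> = - (LINT x|lebesgue. G x $ i * \<phi> x)"
    using G \<phi> by (simp add: distributional_gradient_iff)
  also have "(LINT x|lebesgue. G x $ i * \<phi> x) = (LINT x|lebesgue. G' x $ i * \<phi> x)"
    using ae(2) by (intro integral_cong_AE borel_measurable_times n Gm G' m) auto
  finally show "(LINT x|lebesgue. u' x * pderiv_at \<phi> i x) = - (LINT x|lebesgue. G' x $ i * \<phi> x)" .
qed

lemma lebesgue_measurable_ae_borel_vec:
  fixes G :: "'a::euclidean_space \<Rightarrow> real ^ 'n"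
  assumes "G \<in> borel_measurable lebesgue"
  obtains G' where "G' \<in> borel_measurable borel" "AE x in lebesgue. G x = G' x"
proof -
  have "(\<lambda>x. G x $ i) \<in> borel_measurable lebesgue" for i
    using measurable_compose[OF assms, of "\<lambda>v. v $ i" borel] by auto
  then have "\<exists>g. g \<in> borel_measurable borel \<and> (AE x in lebesgue. G x $ i = g x)" for i
    using lebesgue_measurable_ae_borel by metis
  then obtain g where g: "\<And>i. g i \<in> borel_measurable borel" "\<And>i. AE x in lebesgue. G x $ i = g i x"
    by metis
  show thesis
  proof (rule that)
    show "(\<lambda>x. \<chi> i. g i x) \<in> borel_measurable borel"
    proof -
      have "(\<chi> i. g i x) = (\<Sum>i\<in>UNIV. g i x *\<^sub>R axis i 1)" for x
        using basis_expansion[of "\<chi> i. g i x"] by (simp add: scalar_mult_eq_scaleR)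
      then show ?thesis
        using g(1) by (simp add: borel_measurable_sum borel_measurable_scaleR)
    qed
    have "AE x in lebesgue. \<forall>i. G x $ i = g i x"
      using g(2) by (simp add: AE_all_countable)
    then show "AE x in lebesgue. G x = (\<chi> i. g i x)"
      by eventually_elim (simp add: vec_eq_iff)
  qed
qed

lemma lborel_integrable_translate:
  fixes f :: "'a::euclidean_space \<Rightarrow> real"
  assumes "integrable lborel f"
  shows "integrable lborel (\<lambda>x. f (x + h))"
proof -
  have "integrable (distr lborel borel ((+) h)) f"
    using assms by (simp add: lborel_distr_plus)
  then have "integrable lborel (\<lambda>x. f (h + x))"
    using assms by (subst (asm) integrable_distr_eq) auto
  then show ?thesis by (simp add: add.commute)
qed

text \<open>A criterion for the two applications of Fubini below.  The majorant is composed with the shear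
  \<open>(t, x) \<mapsto> x + t h\<close>, which does not change its integral over \<open>x\<close>.\<close>

lemma integrable_pair_shear:
  fixes f :: "real \<times> 'a::euclidean_space \<Rightarrow> real" and k :: "'a \<Rightarrow> real"
  assumes [measurable]: "f \<in> borel_measurable (lborel \<Otimes>\<^sub>M lborel)" and k: "integrable lborel k"
    and le: "\<And>t x. 0 \<le> t \<Longrightarrow> t \<le> 1 \<Longrightarrow> \<bar>f (t, x)\<bar> \<le> k (x + t *\<^sub>R h)"
    and z: "\<And>t x. \<not> (0 \<le> t \<and> t \<le> 1) \<Longrightarrow> f (t, x) = 0"
  shows "integrable (lborel \<Otimes>\<^sub>M lborel) f"
proof (rule integrableI_bounded)
  have [measurable]: "k \<in> borel_measurable borel" using k by auto
  let ?I = "\<integral>\<^sup>+x. ennreal \<bar>k x\<bar> \<partial>lborel"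
  have "(\<integral>\<^sup>+p. ennreal (norm (f p)) \<partial>(lborel \<Otimes>\<^sub>M lborel)) = (\<integral>\<^sup>+t. \<integral>\<^sup>+x. ennreal \<bar>f (t, x)\<bar> \<partial>lborel \<partial>lborel)"
    by (subst lborel.nn_integral_fst[symmetric]) simp_all
  also have "\<dots> \<le> (\<integral>\<^sup>+t. indicator {0..1::real} t * ?I \<partial>lborel)"
  proof (rule nn_integral_mono)
    fix t :: real
    show "(\<integral>\<^sup>+x. ennreal \<bar>f (t, x)\<bar> \<partial>lborel) \<le> indicator {0..1} t * ?I"
    proof (cases "0 \<le> t \<and> t \<le> 1")
      case True
      have "(\<integral>\<^sup>+x. ennreal \<bar>f (t, x)\<bar> \<partial>lborel) \<le> (\<integral>\<^sup>+x. ennreal \<bar>k (x + t *\<^sub>R h)\<bar> \<partial>lborel)"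
        using True by (intro nn_integral_mono ennreal_leI order_trans[OF le abs_ge_self]) auto
      also have "\<dots> = ?I" by (rule lborel_nn_integral_translate) simp
      finally show ?thesis using True by simp
    qed (use z in simp)
  qed
  also have "\<dots> = ?I" by (simp add: nn_integral_multc)
  also have "\<dots> < \<infinity>" using k by (simp add: integrable_iff_bounded)
  finally show "(\<integral>\<^sup>+p. ennreal (norm (f p)) \<partial>(lborel \<Otimes>\<^sub>M lborel)) < \<infinity>" .
qed simp

text \<open>Both sides have the same integral against every test function \<open>\<phi>\<close>: moving the translation to \<open>\<phi>\<close>
  gives \<open>\<integral> u(x) (\<phi>(x - h) - \<phi>(x)) dx\<close>, the difference of \<open>\<phi>\<close> is an integral of \<open>h \<bullet> \<nabla>\<phi>\<close> along the
  segment, the definition of the distributional gradient transfers \<open>\<nabla>\<close> to \<open>u\<close>, and the translation is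
  moved back.  The fundamental lemma then gives equality almost everywhere.\<close>

lemma translation_identity:
  fixes u :: "real ^ 'n \<Rightarrow> real"
  assumes u[measurable]: "u \<in> borel_measurable borel" and G[measurable]: "G \<in> borel_measurable borel"
    and lu: "loc_int u" and hG: "has_distributional_gradient u G"
  shows "AE x in lborel. u (x + h) - u x = (LINT t|lborel. indicator {0..1} t * (h \<bullet> G (x + t *\<^sub>R h)))"
proof -
  \<comment> \<open>\<open>D\<close> is the right-hand side; \<open>Dfub\<close> integrates it against bounded functions of bounded support.\<close>
  define D where "D x = (LINT t|lborel. indicator {0..1} t * (h \<bullet> G (x + t *\<^sub>R h)))" for x
  define g where "g x = h \<bullet> G x" for x
  have [measurable]: "g \<in> borel_measurable borel" unfolding g_def by measurable
  have lG: "loc_int G" using hG by (simp add: distributional_gradient_iff)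
  then have lg: "loc_int g"
    unfolding g_def by (rule loc_int_bounded_linear[OF bounded_linear_inner_right])
  have bint: "integrable lborel (\<lambda>x. indicator (cball 0 R) x * w x)"
    if "loc_int w" "w \<in> borel_measurable borel" for R and w :: "real ^ 'n \<Rightarrow> real"
  proof -
    have m: "(\<lambda>x. indicator (cball 0 R) x * w x) \<in> borel_measurable lborel"
      using that(2) by (intro borel_measurable_times borel_measurable_indicator) auto
    have "integrable lebesgue (\<lambda>x. indicator (cball 0 R) x * w x)"
      using that(1) unfolding loc_int_def set_integrable_def by simp
    then show ?thesis using integrable_completion[OF m] by simp
  qed
  have Dint: "integrable (lborel \<Otimes>\<^sub>M lborel) (\<lambda>(t, x). indicator {0..1} t * g (x + t *\<^sub>R h) * \<psi> x)"
    if [measurable]: "\<psi> \<in> borel_measurable borel" and B: "\<And>x. \<bar>\<psi> x\<bar> \<le> B"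
      and R: "\<And>x. R \<le> norm x \<Longrightarrow> \<psi> x = 0" for \<psi> :: "real ^ 'n \<Rightarrow> real" and B R
  proof (rule integrable_pair_shear)
    show "integrable lborel (\<lambda>x. B * \<bar>indicator (cball 0 (R + norm h)) x * g x\<bar>)"
      by (intro integrable_mult_right integrable_abs bint lg) simp
    show "\<bar>case (t, x) of (t, x) \<Rightarrow> indicator {0..1} t * g (x + t *\<^sub>R h) * \<psi> x\<bar>
        \<le> B * \<bar>indicator (cball 0 (R + norm h)) (x + t *\<^sub>R h) * g (x + t *\<^sub>R h)\<bar>"
      if t: "0 \<le> t" "t \<le> 1" for t x
    proof (cases "R \<le> norm x")
      case True
      then show ?thesis using R[OF True] order_trans[OF abs_ge_zero B] by simp
    next
      case False
      have "norm (t *\<^sub>R h) \<le> norm h" using t by (simp add: mult_left_le_one_le)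
      then have "norm (x + t *\<^sub>R h) \<le> R + norm h"
        using False norm_triangle_ineq[of x "t *\<^sub>R h"] by linarith
      then show ?thesis using t B[of x]
        by (simp add: abs_mult mult.commute mult_right_mono)
    qed
  qed auto
  have Dfub: "integrable lborel (\<lambda>x. D x * \<psi> x)"
    "(LINT x|lborel. D x * \<psi> x) = (LINT t|lborel. indicator {0..1} t * (LINT x|lborel. g (x + t *\<^sub>R h) * \<psi> x))"
    if "\<psi> \<in> borel_measurable borel" and "\<And>x. \<bar>\<psi> x\<bar> \<le> B"
      and "\<And>x. R \<le> norm x \<Longrightarrow> \<psi> x = 0" for \<psi> :: "real ^ 'n \<Rightarrow> real" and B R
  proof -
    note i = Dint[of \<psi> B R, OF that]
    have eq: "(LINT t|lborel. indicator {0..1} t * g (x + t *\<^sub>R h) * \<psi> x) = D x * \<psi> x" for x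
      unfolding D_def g_def by simp
    show "integrable lborel (\<lambda>x. D x * \<psi> x)"
      using lborel_pair.integrable_snd[OF i] by (simp only: eq)
    show "(LINT x|lborel. D x * \<psi> x) = (LINT t|lborel. indicator {0..1} t * (LINT x|lborel. g (x + t *\<^sub>R h) * \<psi> x))"
      using lborel_pair.Fubini_integral[OF i] unfolding eq by (simp add: mult.assoc)
  qed
  have D_meas [measurable]: "D \<in> borel_measurable borel"
    unfolding D_def by measurable
  have lushift: "loc_int (\<lambda>x. u (x + h))"
    unfolding loc_int_def set_integrable_def
  proof
    fix R
    have "integrable lborel (\<lambda>x. indicat_real (cball 0 (R + norm h)) (x + h) * u (x + h))"
      by (rule lborel_integrable_translate[OF bint[OF lu u]])
    then have "integrable lborel (\<lambda>x. indicat_real (cball 0 R) x * u (x + h))"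
    proof (rule Bochner_Integration.integrable_bound)
      have "(\<lambda>x. u (x + h)) \<in> borel_measurable borel" by measurable
      then show "(\<lambda>x. indicat_real (cball 0 R) x * u (x + h)) \<in> borel_measurable lborel"
        by (intro borel_measurable_times borel_measurable_indicator) auto
      show "AE x in lborel. norm (indicat_real (cball 0 R) x * u (x + h))
          \<le> norm (indicat_real (cball 0 (R + norm h)) (x + h) * u (x + h))"
      proof (intro AE_I2)
        fix x
        show "norm (indicat_real (cball 0 R) x * u (x + h))
          \<le> norm (indicat_real (cball 0 (R + norm h)) (x + h) * u (x + h))"
          using norm_triangle_ineq[of x h] by (auto split: split_indicator)
      qed
    qed
    then show "integrable lebesgue (\<lambda>x. indicat_real (cball 0 R) x *\<^sub>R u (x + h))"
      by (subst integrable_completion) auto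
  qed
  have lD: "loc_int D"
    unfolding loc_int_def set_integrable_def
  proof
    fix R
    have "integrable lborel (\<lambda>x. D x * indicat_real (cball 0 R) x)"
      by (rule Dfub(1)[where B=1 and R="R + 1"])
        (auto intro!: borel_measurable_indicator split: split_indicator)
    then have "integrable lborel (\<lambda>x. indicat_real (cball 0 R) x *\<^sub>R D x)"
      by (simp add: mult.commute)
    then show "integrable lebesgue (\<lambda>x. indicat_real (cball 0 R) x *\<^sub>R D x)"
      by (subst integrable_completion) auto
  qed
  have "AE x in lebesgue. u (x + h) - u x - D x = 0"
  proof (rule fundamental_lemma)
    show "loc_int (\<lambda>x. u (x + h) - u x - D x)"
      by (intro loc_int_diff lushift lu lD)
    fix \<phi> :: "real ^ 'n \<Rightarrow> real" assume \<phi>: "test_function \<phi>"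
    have sm: "smooth \<phi>" by (rule test_functionD[OF \<phi>])
    have [measurable]: "\<phi> \<in> borel_measurable borel" by (rule smooth_measurable[OF sm])
    have gradm [measurable]: "grad \<phi> \<in> borel_measurable borel"
      by (intro borel_measurable_continuous_onI continuous_on_grad sm)
    obtain R where R: "R > 0" "\<And>x. R \<le> norm x \<Longrightarrow> \<phi> x = 0" using test_function_support \<phi> by blast
    obtain B where B: "B \<ge> 0" "\<And>x. \<bar>\<phi> x\<bar> \<le> B" using test_function_bounded[OF \<phi>] by blast
    define \<psi> where "\<psi> x = h \<bullet> grad \<phi> x" for x
    have [measurable]: "\<psi> \<in> borel_measurable borel" unfolding \<psi>_def by measurable
    have \<psi>_sum: "\<psi> x = (\<Sum>i\<in>UNIV. h $ i * pderiv_at \<phi> i x)" for x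
      by (simp add: \<psi>_def grad_def inner_vec_def)
    have t\<psi>: "test_function \<psi>"
    proof (rule test_functionI)
      show "smooth \<psi>" unfolding \<psi>_sum[abs_def]
        by (intro smooth_sum smooth_cmult smooth_pderiv_at sm finite)
      show "x \<in> closure {x. \<phi> x \<noteq> 0}" if "\<psi> x \<noteq> 0" for x
      proof (rule ccontr)
        assume x: "x \<notin> closure {x. \<phi> x \<noteq> 0}"
        have "(\<phi> has_derivative (\<lambda>v. v \<bullet> 0)) (at x)"
        proof (rule has_derivative_transform_within_open[where s="- closure {x. \<phi> x \<noteq> 0}" and f="\<lambda>_. 0"])
          show "\<And>y. y \<in> - closure {x. \<phi> x \<noteq> 0} \<Longrightarrow> 0 = \<phi> y"
            using closure_subset[of "{x. \<phi> x \<noteq> 0}"] by auto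
        qed (use x in auto)
        from grad_eqI[OF this] show False using that by (simp add: \<psi>_def)
      qed
      show "bounded (closure {x. \<phi> x \<noteq> 0})"
        using \<phi> by (simp add: test_function_def compact_imp_bounded)
    qed
    obtain R' where R': "R' > 0" "\<And>x. R' \<le> norm x \<Longrightarrow> \<psi> x = 0" using test_function_support t\<psi> by blast
    obtain B' where B': "B' \<ge> 0" "\<And>x. \<bar>\<psi> x\<bar> \<le> B'" using test_function_bounded[OF t\<psi>] by blast
    note trans = test_function_translate[OF \<phi>]
    have utest: "integrable lborel (\<lambda>x. w x * \<eta> x)"
      if "test_function \<eta>" "loc_int w" "w \<in> borel_measurable borel" for \<eta> w :: "real ^ 'n \<Rightarrow> real"
      using loc_int_test[OF that(2,1)] smooth_measurable[OF test_functionD[OF that(1)]] that(3)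
      by (simp add: integrable_completion mult.commute)
    \<comment> \<open>Fundamental theorem of calculus on the segment from \<open>x\<close> to \<open>x - h\<close>.\<close>
    have ftc: "\<phi> (x - h) - \<phi> x = - (LINT t|lborel. indicator {0..1} t * \<psi> (x - t *\<^sub>R h))" for x
    proof -
      have "((\<lambda>t. \<phi> (x - t *\<^sub>R h)) has_real_derivative - \<psi> (x - t *\<^sub>R h)) (at t)" for t
      proof -
        have "((\<lambda>t. \<phi> (x - t *\<^sub>R h)) has_derivative (\<lambda>s. (- (s *\<^sub>R h)) \<bullet> grad \<phi> (x - t *\<^sub>R h))) (at t)"
          by (rule has_derivative_compose[OF _ smooth_has_derivative[OF sm]])
            (auto intro!: derivative_eq_intros)
        then show ?thesis
          unfolding has_field_derivative_def
          by (rule has_derivative_eq_rhs) (auto simp: \<psi>_def)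
      qed
      moreover have "isCont (\<lambda>t. - \<psi> (x - t *\<^sub>R h)) t" for t
      proof -
        have "continuous_on UNIV (\<lambda>t. \<psi> (x - t *\<^sub>R h))"
          by (rule continuous_on_compose2[OF smooth_continuous[OF test_functionD[OF t\<psi>]]])
            (auto intro!: continuous_intros)
        then show ?thesis by (simp add: continuous_on_eq_continuous_at)
      qed
      ultimately have "(LINT t|lborel. - \<psi> (x - t *\<^sub>R h) * indicator {0..1} t) = \<phi> (x - 1 *\<^sub>R h) - \<phi> (x - 0 *\<^sub>R h)"
        by (intro integral_FTC_Icc_real) auto
      then show ?thesis by (simp add: mult.commute)
    qed
    have i1: "integrable (lborel \<Otimes>\<^sub>M lborel) (\<lambda>(t, x). indicator {0..1} t * \<psi> (x - t *\<^sub>R h) * u x)"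
    proof (rule integrable_pair_shear[where h=0])
      show "integrable lborel (\<lambda>x. B' * \<bar>indicator (cball 0 (R' + norm h)) x * u x\<bar>)"
        by (intro integrable_mult_right integrable_abs bint lu) simp
      show "\<bar>case (t, x) of (t, x) \<Rightarrow> indicator {0..1} t * \<psi> (x - t *\<^sub>R h) * u x\<bar>
          \<le> B' * \<bar>indicator (cball 0 (R' + norm h)) (x + t *\<^sub>R 0) * u (x + t *\<^sub>R 0)\<bar>"
        if t: "0 \<le> t" "t \<le> 1" for t x
      proof (cases "R' \<le> norm (x - t *\<^sub>R h)")
        case True
        then show ?thesis using R'(2)[OF True] B'(1) by simp
      next
        case False
        have "norm (t *\<^sub>R h) \<le> norm h" using t by (simp add: mult_left_le_one_le)
        then have "norm x \<le> R' + norm h"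
          using False norm_triangle_ineq[of "x - t *\<^sub>R h" "t *\<^sub>R h"] by simp
        then show ?thesis using t B'(2)[of "x - t *\<^sub>R h"]
          by (simp add: abs_mult mult_right_mono)
      qed
    qed auto
    have Gnth [measurable]: "(\<lambda>x. G x $ i) \<in> borel_measurable borel" for i
      using measurable_compose[OF G, of "\<lambda>v. v $ i" borel] by auto
    \<comment> \<open>The definition of the distributional gradient, for the translated test function.\<close>
    have parts: "(LINT x|lborel. \<psi> (x - a) * u x) = - (LINT x|lborel. g x * \<phi> (x - a))" for a
    proof -
      have "integrable lborel (\<lambda>x. u x * pderiv_at (\<lambda>x. \<phi> (x - a)) i x)" for i
        by (rule utest[OF test_function_pderiv_at[OF trans] lu u])
      moreover have Gi: "integrable lborel (\<lambda>x. G x $ i * \<phi> (x - a))" for i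
        by (rule utest[OF trans loc_int_nth[OF lG] Gnth])
      moreover have "(LINT x|lborel. u x * pderiv_at (\<lambda>x. \<phi> (x - a)) i x) = - (LINT x|lborel. G x $ i * \<phi> (x - a))" for i
      proof -
        have "(\<lambda>x. pderiv_at (\<lambda>x. \<phi> (x - a)) i x) \<in> borel_measurable borel"
          by (rule smooth_measurable[OF smooth_pderiv_at[OF test_functionD[OF trans]]])
        note [measurable] = this
        have "(LINT x|lborel. u x * pderiv_at (\<lambda>x. \<phi> (x - a)) i x) = (LINT x|lebesgue. u x * pderiv_at (\<lambda>x. \<phi> (x - a)) i x)"
          by (rule integral_completion[symmetric]) measurable
        also have "\<dots> = - (LINT x|lebesgue. G x $ i * \<phi> (x - a))"
          using hG trans[of a] unfolding distributional_gradient_iff by blast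
        also have "(LINT x|lebesgue. G x $ i * \<phi> (x - a)) = (LINT x|lborel. G x $ i * \<phi> (x - a))"
          by (rule integral_completion) measurable
        finally show ?thesis .
      qed
      moreover have "\<psi> (x - a) * u x = (\<Sum>i\<in>UNIV. h $ i * (u x * pderiv_at (\<lambda>x. \<phi> (x - a)) i x))" for x
        unfolding \<psi>_sum pderiv_at_translate sum_distrib_right
        by (intro sum.cong) simp_all
      moreover have "g x * \<phi> (x - a) = (\<Sum>i\<in>UNIV. h $ i * (G x $ i * \<phi> (x - a)))" for x
        unfolding g_def inner_vec_def sum_distrib_right
        by (intro sum.cong) simp_all
      ultimately show ?thesis by (simp add: sum_negf)
    qed
    have "(LINT x|lborel. u (x + h) * \<phi> x) = (LINT x|lborel. u x * \<phi> (x - h))"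
      using lborel_integral_translate[of "\<lambda>x. u x * \<phi> (x - h)" h] by simp
    moreover have "integrable lborel (\<lambda>x. u (x + h) * \<phi> x)" "integrable lborel (\<lambda>x. u x * \<phi> x)"
        "integrable lborel (\<lambda>x. u x * \<phi> (x - h))"
      by (intro utest \<phi> trans lushift lu u; measurable)+
    moreover have "(LINT x|lborel. u x * (\<phi> (x - h) - \<phi> x)) = (LINT x|lborel. D x * \<phi> x)"
    proof -
      have "(LINT x|lborel. u x * (\<phi> (x - h) - \<phi> x)) =
          - (LINT x|lborel. (LINT t|lborel. indicator {0..1} t * \<psi> (x - t *\<^sub>R h) * u x))"
        unfolding ftc by (simp add: mult.commute)
      also have "\<dots> = - (LINT t|lborel. (LINT x|lborel. indicator {0..1} t * \<psi> (x - t *\<^sub>R h) * u x))"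
        using lborel_pair.Fubini_integral[OF i1] by simp
      also have "\<dots> = (LINT t|lborel. indicator {0..1} t * (LINT x|lborel. g x * \<phi> (x - t *\<^sub>R h)))"
        using parts by (simp add: mult.assoc)
      also have "\<dots> = (LINT t|lborel. indicator {0..1} t * (LINT x|lborel. g (x + t *\<^sub>R h) * \<phi> x))"
      proof -
        have "(LINT x|lborel. g x * \<phi> (x - a)) = (LINT x|lborel. g (x + a) * \<phi> x)" for a
          using lborel_integral_translate[of "\<lambda>x. g x * \<phi> (x - a)" a] by simp
        then show ?thesis by simp
      qed
      also have "\<dots> = (LINT x|lborel. D x * \<phi> x)"
        by (rule Dfub(2)[symmetric, OF _ B(2) R(2)]) auto
      finally show ?thesis .
    qed
    moreover have "integrable lborel (\<lambda>x. D x * \<phi> x)"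
      by (rule Dfub(1)[OF _ B(2) R(2)]) auto
    ultimately have "(LINT x|lborel. (u (x + h) - u x - D x) * \<phi> x) = 0"
      by (simp add: left_diff_distrib right_diff_distrib)
    then show "(LINT x|lebesgue. (u (x + h) - u x - D x) * \<phi> x) = 0"
      by (subst integral_completion) auto
  qed
  then have "AE x in lborel. u (x + h) - u x - D x = 0"
    by (simp add: AE_completion_iff)
  then show ?thesis unfolding D_def by eventually_elim simp
qed

section \<open>A Faber-Krahn inequality\<close>

text \<open>Jensen for the square: expand \<open>0 \<le> \<integral> (f - I)\<^sup>2\<close>, where \<open>I\<close> is the mean of \<open>f\<close>.\<close>

lemma square_integral_unit_interval_le:
  fixes f :: "real \<Rightarrow> real"
  assumes [measurable]: "f \<in> borel_measurable borel"
  shows "ennreal ((LINT t|lborel. indicator {0..1} t * f t)\<^sup>2) \<le> (\<integral>\<^sup>+t. indicator {0..1} t * ennreal ((f t)\<^sup>2) \<partial>lborel)"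
proof -
  let ?i = "indicator {0..1::real} :: real \<Rightarrow> real"
  define I where "I = (LINT t|lborel. ?i t * f t)"
  let ?R = "\<integral>\<^sup>+t. ennreal (?i t * (f t)\<^sup>2) \<partial>lborel"
  have R: "(\<integral>\<^sup>+t. indicator {0..1} t * ennreal ((f t)\<^sup>2) \<partial>lborel) = ?R"
    by (intro nn_integral_cong) (auto split: split_indicator)
  show ?thesis
  proof (cases "integrable lborel (\<lambda>t. ?i t * f t) \<and> ?R < \<infinity>")
    case True
    then have i1: "integrable lborel (\<lambda>t. ?i t * f t)" and i2: "integrable lborel (\<lambda>t. ?i t * (f t)\<^sup>2)"
      by (auto simp: integrable_iff_bounded)
    have i0: "integrable lborel ?i" "(LINT t|lborel. ?i t) = 1" by simp_all
    have "0 \<le> (LINT t|lborel. ?i t * (f t - I)\<^sup>2)"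
      by (intro Bochner_Integration.integral_nonneg) auto
    also have "\<dots> = (LINT t|lborel. (?i t * (f t)\<^sup>2 - 2 * I * (?i t * f t)) + I\<^sup>2 * ?i t)"
      by (intro Bochner_Integration.integral_cong) (auto simp: power2_eq_square algebra_simps)
    also have "\<dots> = (LINT t|lborel. ?i t * (f t)\<^sup>2) - 2 * I * I + I\<^sup>2 * 1"
    proof -
      have j: "integrable lborel (\<lambda>t. 2 * I * (?i t * f t))" "integrable lborel (\<lambda>t. I\<^sup>2 * ?i t)"
        using i0(1) i1 by (auto simp only: integrable_mult_right)
      have "(LINT t|lborel. 2 * I * (?i t * f t)) = 2 * I * I" "(LINT t|lborel. I\<^sup>2 * ?i t) = I\<^sup>2 * 1"
        unfolding integral_mult_right_zero i0(2) I_def[symmetric] by (rule refl)+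
      then show ?thesis
        using Bochner_Integration.integral_add[OF Bochner_Integration.integrable_diff[OF i2 j(1)] j(2)]
          Bochner_Integration.integral_diff[OF i2 j(1)] by (simp only:)
    qed
    finally have "I\<^sup>2 \<le> (LINT t|lborel. ?i t * (f t)\<^sup>2)" by (simp add: power2_eq_square)
    then have "ennreal (I\<^sup>2) \<le> ?R"
      using i2 by (subst nn_integral_eq_integral) (auto intro: ennreal_leI)
    then show ?thesis unfolding R I_def .
  next
    case False
    then show ?thesis
    proof (cases "integrable lborel (\<lambda>t. ?i t * f t)")
      case True
      with False have "?R = \<infinity>" by (simp add: less_top[symmetric])
      then show ?thesis unfolding R by simp
    qed (simp add: not_integrable_integral_eq)
  qed
qed

lemma translation_estimate:
  fixes u :: "real ^ 'n \<Rightarrow> real"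
  assumes u[measurable]: "u \<in> borel_measurable borel" and G[measurable]: "G \<in> borel_measurable borel"
    and lu: "loc_int u" and hG: "has_distributional_gradient u G"
  shows "(\<integral>\<^sup>+x. ennreal ((u (x + h) - u x)\<^sup>2) \<partial>lborel) \<le>
    ennreal ((norm h)\<^sup>2) * (\<integral>\<^sup>+x. ennreal ((norm (G x))\<^sup>2) \<partial>lborel)"
proof -
  let ?\<Gamma> = "\<integral>\<^sup>+x. ennreal ((norm (G x))\<^sup>2) \<partial>lborel"
  have "(\<integral>\<^sup>+x. ennreal ((u (x + h) - u x)\<^sup>2) \<partial>lborel) \<le>
      (\<integral>\<^sup>+x. (\<integral>\<^sup>+t. indicator {0..1::real} t * ennreal ((norm h)\<^sup>2 * (norm (G (x + t *\<^sub>R h)))\<^sup>2) \<partial>lborel) \<partial>lborel)"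
  proof (rule nn_integral_mono_AE)
    show "AE x in lborel. ennreal ((u (x + h) - u x)\<^sup>2) \<le>
      (\<integral>\<^sup>+t. indicator {0..1::real} t * ennreal ((norm h)\<^sup>2 * (norm (G (x + t *\<^sub>R h)))\<^sup>2) \<partial>lborel)"
      using translation_identity[OF u G lu hG, of h]
    proof eventually_elim
      case (elim x)
      have "ennreal ((u (x + h) - u x)\<^sup>2) \<le>
          (\<integral>\<^sup>+t. indicator {0..1} t * ennreal ((h \<bullet> G (x + t *\<^sub>R h))\<^sup>2) \<partial>lborel)"
        unfolding elim by (rule square_integral_unit_interval_le) measurable
      also have "\<dots> \<le> (\<integral>\<^sup>+t. indicator {0..1::real} t * ennreal ((norm h)\<^sup>2 * (norm (G (x + t *\<^sub>R h)))\<^sup>2) \<partial>lborel)"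
        using Cauchy_Schwarz_ineq[of h]
        by (intro nn_integral_mono mult_left_mono ennreal_leI) (auto simp: power2_norm_eq_inner)
      finally show ?case .
    qed
  qed
  also have "\<dots> = (\<integral>\<^sup>+t. (\<integral>\<^sup>+x. indicator {0..1::real} t * ennreal ((norm h)\<^sup>2 * (norm (G (x + t *\<^sub>R h)))\<^sup>2) \<partial>lborel) \<partial>lborel)"
    by (rule lborel_pair.Fubini') measurable
  also have "\<dots> = (\<integral>\<^sup>+t. indicator {0..1::real} t * (ennreal ((norm h)\<^sup>2) * ?\<Gamma>) \<partial>lborel)"
  proof (rule nn_integral_cong)
    fix t :: real
    have "(\<integral>\<^sup>+x. ennreal ((norm (G (x + t *\<^sub>R h)))\<^sup>2) \<partial>lborel) = ?\<Gamma>"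
      by (rule lborel_nn_integral_translate) measurable
    then show "(\<integral>\<^sup>+x. indicator {0..1::real} t * ennreal ((norm h)\<^sup>2 * (norm (G (x + t *\<^sub>R h)))\<^sup>2) \<partial>lborel) =
        indicator {0..1::real} t * (ennreal ((norm h)\<^sup>2) * ?\<Gamma>)"
      by (simp add: nn_integral_cmult ennreal_mult)
  qed
  also have "\<dots> = ennreal ((norm h)\<^sup>2) * ?\<Gamma>"
    by (simp add: nn_integral_multc)
  finally show ?thesis .
qed

text \<open>Average the translation estimate over \<open>h\<close> in the ball of radius \<open>\<rho>\<close>.  For fixed \<open>x\<close>, at least half of
  these \<open>h\<close> have \<open>u (x + h) = 0\<close>, because the ball has at least twice the volume of the support; for
  them the increment is \<open>- u x\<close>.\<close>

lemma faber_krahn_borel: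
  fixes u :: "real ^ 'n \<Rightarrow> real"
  assumes u[measurable]: "u \<in> borel_measurable borel" and G[measurable]: "G \<in> borel_measurable borel"
    and lu: "loc_int u" and hG: "has_distributional_gradient u G" and \<rho>: "0 < \<rho>"
    and supp: "emeasure lborel {x. u x \<noteq> 0} \<le> ennreal (measure lborel (ball (0::real^'n) \<rho>) / 2)"
  shows "(\<integral>\<^sup>+x. ennreal ((u x)\<^sup>2) \<partial>lborel) \<le> ennreal (2 * \<rho>\<^sup>2) * (\<integral>\<^sup>+x. ennreal ((norm (G x))\<^sup>2) \<partial>lborel)"
proof -
  let ?\<Gamma> = "\<integral>\<^sup>+x. ennreal ((norm (G x))\<^sup>2) \<partial>lborel"
  let ?U = "\<integral>\<^sup>+x. ennreal ((u x)\<^sup>2) \<partial>lborel"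
  let ?B = "ball (0::real^'n) \<rho>"
  define m where "m = measure lborel ?B"
  have m: "0 < m" and em: "emeasure lborel ?B = ennreal m"
    using \<rho> emeasure_lborel_ball_finite[of "0::real^'n" \<rho>]
    by (auto simp: m_def content_ball_pos emeasure_eq_ennreal_measure less_top)
  have [measurable]: "?B \<in> sets borel" by simp
  have half: "ennreal (m / 2) \<le> emeasure lborel (?B \<inter> {h. u (x + h) = 0})" for x
  proof -
    have "emeasure lborel {h. u (x + h) \<noteq> 0} = (\<integral>\<^sup>+h. indicator {h. u (x + h) \<noteq> 0} h \<partial>lborel)"
      by (rule nn_integral_indicator[symmetric]) measurable
    also have "\<dots> = (\<integral>\<^sup>+h. indicator {y. u y \<noteq> 0} (h + x) \<partial>lborel)"
      by (intro nn_integral_cong) (simp add: indicator_def add.commute)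
    also have "\<dots> = (\<integral>\<^sup>+h. indicator {y. u y \<noteq> 0} h \<partial>lborel)"
      by (rule lborel_nn_integral_translate) measurable
    also have "\<dots> \<le> ennreal (m / 2)" using supp by (simp add: m_def)
    finally have 1: "emeasure lborel {h. u (x + h) \<noteq> 0} \<le> ennreal (m / 2)" .
    have "ennreal m \<le> emeasure lborel ((?B \<inter> {h. u (x + h) = 0}) \<union> {h. u (x + h) \<noteq> 0})"
      unfolding em[symmetric] by (intro emeasure_mono) auto
    also have "\<dots> \<le> emeasure lborel (?B \<inter> {h. u (x + h) = 0}) + emeasure lborel {h. u (x + h) \<noteq> 0}"
      by (intro emeasure_subadditive) auto
    also have "\<dots> \<le> emeasure lborel (?B \<inter> {h. u (x + h) = 0}) + ennreal (m / 2)"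
      by (intro add_left_mono 1)
    finally have "ennreal (m / 2) + ennreal (m / 2) \<le> emeasure lborel (?B \<inter> {h. u (x + h) = 0}) + ennreal (m / 2)"
      using m by (simp flip: ennreal_plus)
    then show ?thesis by (simp add: ennreal_add_left_cancel_le add.commute)
  qed
  have "ennreal (m / 2) * ?U = (\<integral>\<^sup>+x. ennreal ((u x)\<^sup>2) * ennreal (m / 2) \<partial>lborel)"
    by (subst nn_integral_multc) (auto simp: mult.commute)
  also have "\<dots> \<le> (\<integral>\<^sup>+x. ennreal ((u x)\<^sup>2) * emeasure lborel (?B \<inter> {h. u (x + h) = 0}) \<partial>lborel)"
    by (intro nn_integral_mono mult_left_mono half) auto
  also have "\<dots> \<le> (\<integral>\<^sup>+x. (\<integral>\<^sup>+h. indicator ?B h * ennreal ((u (x + h) - u x)\<^sup>2) \<partial>lborel) \<partial>lborel)"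
  proof (rule nn_integral_mono)
    fix x
    have "ennreal ((u x)\<^sup>2) * emeasure lborel (?B \<inter> {h. u (x + h) = 0}) =
        (\<integral>\<^sup>+h. ennreal ((u x)\<^sup>2) * indicator (?B \<inter> {h. u (x + h) = 0}) h \<partial>lborel)"
      by (subst nn_integral_cmult_indicator) auto
    also have "\<dots> \<le> (\<integral>\<^sup>+h. indicator ?B h * ennreal ((u (x + h) - u x)\<^sup>2) \<partial>lborel)"
      by (intro nn_integral_mono) (auto split: split_indicator)
    finally show "ennreal ((u x)\<^sup>2) * emeasure lborel (?B \<inter> {h. u (x + h) = 0}) \<le>
        (\<integral>\<^sup>+h. indicator ?B h * ennreal ((u (x + h) - u x)\<^sup>2) \<partial>lborel)" .
  qed
  also have "\<dots> = (\<integral>\<^sup>+h. (\<integral>\<^sup>+x. indicator ?B h * ennreal ((u (x + h) - u x)\<^sup>2) \<partial>lborel) \<partial>lborel)"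
    by (rule lborel_pair.Fubini') measurable
  also have "\<dots> \<le> (\<integral>\<^sup>+h. indicator ?B h * (ennreal (\<rho>\<^sup>2) * ?\<Gamma>) \<partial>lborel)"
  proof (rule nn_integral_mono)
    fix h :: "real ^ 'n"
    have "(\<integral>\<^sup>+x. ennreal ((u (x + h) - u x)\<^sup>2) \<partial>lborel) \<le> ennreal (\<rho>\<^sup>2) * ?\<Gamma>" if "norm h < \<rho>"
      by (rule order_trans[OF translation_estimate[OF u G lu hG]])
        (use that in \<open>auto intro!: mult_right_mono ennreal_leI power_mono\<close>)
    then show "(\<integral>\<^sup>+x. indicator ?B h * ennreal ((u (x + h) - u x)\<^sup>2) \<partial>lborel) \<le> indicator ?B h * (ennreal (\<rho>\<^sup>2) * ?\<Gamma>)"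
      by (auto simp: nn_integral_cmult split: split_indicator)
  qed
  also have "\<dots> = ennreal m * (ennreal (\<rho>\<^sup>2) * ?\<Gamma>)"
    by (simp add: nn_integral_multc em)
  finally have "ennreal (2 / m) * (ennreal (m / 2) * ?U) \<le> ennreal (2 / m) * (ennreal m * (ennreal (\<rho>\<^sup>2) * ?\<Gamma>))"
    by (intro mult_left_mono) auto
  then show ?thesis
    using m by (simp add: mult.assoc[symmetric] flip: ennreal_mult)
qed

text \<open>Both sides are unchanged when \<open>u\<close> and \<open>G\<close> are replaced by Borel representatives.\<close>

lemma faber_krahn:
  fixes u :: "real ^ 'n \<Rightarrow> real"
  assumes lu: "loc_int u" and hG: "has_distributional_gradient u G" and \<rho>: "0 < \<rho>"
    and supp: "emeasure lebesgue {x. u x \<noteq> 0} \<le> ennreal (measure lebesgue (ball (0::real^'n) \<rho>) / 2)"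
  shows "(\<integral>\<^sup>+x. ennreal ((u x)\<^sup>2) \<partial>lebesgue) \<le> ennreal (2 * \<rho>\<^sup>2) * (\<integral>\<^sup>+x. ennreal ((norm (G x))\<^sup>2) \<partial>lebesgue)"
proof -
  have um: "u \<in> borel_measurable lebesgue" by (rule loc_int_measurable[OF lu])
  have lG: "loc_int G" using hG by (simp add: distributional_gradient_iff)
  obtain u' where u'[measurable]: "u' \<in> borel_measurable borel" and aeu: "AE x in lebesgue. u x = u' x"
    using lebesgue_measurable_ae_borel[OF um] by blast
  obtain G' where G'[measurable]: "G' \<in> borel_measurable borel" and aeG: "AE x in lebesgue. G x = G' x"
    using lebesgue_measurable_ae_borel_vec[OF loc_int_measurable[OF lG]] by blast
  have u'm: "u' \<in> borel_measurable lebesgue" and G'm: "G' \<in> borel_measurable lebesgue"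
    by (simp_all add: measurable_completion)
  have hG': "has_distributional_gradient u' G'"
    by (rule distributional_gradient_cong_AE[OF hG um u'm G'm aeu aeG])
  have lu': "loc_int u'" by (rule loc_int_cong_AE[OF lu u'm aeu])
  have "emeasure lborel {x. u' x \<noteq> 0} = emeasure lebesgue {x. u' x \<noteq> 0}"
    by simp
  also have "\<dots> = emeasure lebesgue {x. u x \<noteq> 0}"
  proof (rule emeasure_eq_AE)
    show "AE x in lebesgue. (x \<in> {x. u' x \<noteq> 0}) = (x \<in> {x. u x \<noteq> 0})"
      using aeu by eventually_elim simp
    show "{x. u' x \<noteq> 0} \<in> sets lebesgue" "{x. u x \<noteq> 0} \<in> sets lebesgue"
      using borel_measurable_neq[OF u'm, of "\<lambda>_. 0"] borel_measurable_neq[OF um, of "\<lambda>_. 0"] by simp_all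
  qed
  finally have s: "emeasure lborel {x. u' x \<noteq> 0} \<le> ennreal (measure lborel (ball (0::real^'n) \<rho>) / 2)"
    using supp by simp
  have "(\<integral>\<^sup>+x. ennreal ((u x)\<^sup>2) \<partial>lebesgue) = (\<integral>\<^sup>+x. ennreal ((u' x)\<^sup>2) \<partial>lborel)"
    by (subst nn_integral_completion[of lborel, symmetric], rule nn_integral_cong_AE)
      (use aeu in \<open>eventually_elim, simp\<close>)
  moreover have "(\<integral>\<^sup>+x. ennreal ((norm (G x))\<^sup>2) \<partial>lebesgue) = (\<integral>\<^sup>+x. ennreal ((norm (G' x))\<^sup>2) \<partial>lborel)"
    by (subst nn_integral_completion[of lborel, symmetric], rule nn_integral_cong_AE)
      (use aeG in \<open>eventually_elim, simp\<close>)
  ultimately show ?thesis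
    using faber_krahn_borel[OF u' G' lu' hG' \<rho> s] by simp
qed

section \<open>Points of density, and sets of prescribed measure\<close>

text \<open>Otherwise the balls that violate the inequality cover \<open>E\<close> finely.  Choose an open \<open>U \<supseteq> E\<close> with
  \<open>|U - E| < \<delta> |E|\<close>; by Vitali, disjoint bad balls inside \<open>U\<close> cover almost all of \<open>E\<close>, and a
  portion \<open>\<delta>\<close> of each lies in \<open>U - E\<close>.\<close>

lemma density_point:
  fixes E :: "'a::euclidean_space set"
  assumes E: "E \<in> lmeasurable" "0 < measure lebesgue E" and \<delta>: "0 < \<delta>"
  obtains x r0 where "x \<in> E" "0 < r0"
    "\<And>r. 0 < r \<Longrightarrow> r < r0 \<Longrightarrow> measure lebesgue (ball x r - E) \<le> \<delta> * measure lebesgue (ball x r)"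
proof -
  have "\<exists>x\<in>E. \<exists>r0>0. \<forall>r. 0 < r \<and> r < r0 \<longrightarrow> measure lebesgue (ball x r - E) \<le> \<delta> * measure lebesgue (ball x r)"
  proof (rule ccontr)
    assume "\<not> ?thesis"
    then have bad: "\<exists>r. 0 < r \<and> r < r0 \<and> \<delta> * measure lebesgue (ball x r) < measure lebesgue (ball x r - E)"
      if "x \<in> E" "0 < r0" for x r0
      using that by (metis not_le)
    have Es: "E \<in> sets lebesgue" using E by blast
    have "0 < \<delta> * measure lebesgue E" using E \<delta> by simp
    then obtain U where U: "open U" "E \<subseteq> U" "U - E \<in> lmeasurable"
        "emeasure lebesgue (U - E) < ennreal (\<delta> * measure lebesgue E)"
      using sets_lebesgue_outer_open[OF Es] by blast
    define K where "K = {(x, r). x \<in> E \<and> 0 < r \<and> ball x r \<subseteq> U \<and>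
        \<delta> * measure lebesgue (ball x r) < measure lebesgue (ball x r - E)}"
    have "\<exists>i. i \<in> K \<and> x \<in> ball (fst i) (snd i) \<and> snd i < d" if xE: "x \<in> E" and d: "0 < d" for x d
    proof -
      obtain e where e: "e > 0" "ball x e \<subseteq> U"
        using openE[OF U(1) subsetD[OF U(2) xE]] .
      obtain r where r: "0 < r" "r < min d e" "\<delta> * measure lebesgue (ball x r) < measure lebesgue (ball x r - E)"
        using bad[OF xE, of "min d e"] d e by auto
      then have "ball x r \<subseteq> U" using e subset_ball[of r e x] by auto
      with r xE d show ?thesis by (intro exI[of _ "(x, r)"]) (auto simp: K_def)
    qed
    then obtain C where C: "countable C" "C \<subseteq> K"
        "pairwise (\<lambda>i j. disjnt (ball (fst i) (snd i)) (ball (fst j) (snd j))) C"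
        "negligible (E - (\<Union>i\<in>C. ball (fst i) (snd i)))"
      using Vitali_covering_theorem_balls[of E K fst snd] by blast
    let ?b = "\<lambda>i. ball (fst i) (snd i) :: 'a set"
    have disj: "disjoint_family_on ?b C"
      using C(3) by (auto simp: disjoint_family_on_def pairwise_def disjnt_def)
    have fin: "emeasure lebesgue (?b i) < \<infinity>" "emeasure lebesgue (?b i - E) < \<infinity>" for i
    proof -
      show 1: "emeasure lebesgue (?b i) < \<infinity>"
        using lmeasurable_ball[of "fst i" "snd i"] by (simp add: fmeasurable_def less_top)
      have "emeasure lebesgue (?b i - E) \<le> emeasure lebesgue (?b i)"
        using Es by (intro emeasure_mono) auto
      with 1 show "emeasure lebesgue (?b i - E) < \<infinity>" by (rule le_less_trans[rotated])
    qed
    have "ennreal (measure lebesgue E) = emeasure lebesgue E"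
      using E by (simp add: emeasure_eq_measure2)
    also have "\<dots> \<le> emeasure lebesgue ((\<Union>i\<in>C. ?b i) \<union> (E - (\<Union>i\<in>C. ?b i)))"
      using C(1,4) by (intro emeasure_mono sets.Un) (auto simp: negligible_iff_null_sets)
    also have "\<dots> = emeasure lebesgue (\<Union>i\<in>C. ?b i)"
      using C(1,4) by (intro emeasure_Un_null_set) (auto simp: negligible_iff_null_sets)
    also have "\<dots> = (\<integral>\<^sup>+i. emeasure lebesgue (?b i) \<partial>count_space C)"
      using C(1) disj by (intro emeasure_UN_countable) auto
    finally have 1: "ennreal \<delta> * ennreal (measure lebesgue E) \<le> ennreal \<delta> * (\<integral>\<^sup>+i. emeasure lebesgue (?b i) \<partial>count_space C)"
      by (intro mult_left_mono) auto
    also have "\<dots> = (\<integral>\<^sup>+i. ennreal \<delta> * emeasure lebesgue (?b i) \<partial>count_space C)"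
      by (simp add: nn_integral_cmult)
    also have "\<dots> \<le> (\<integral>\<^sup>+i. emeasure lebesgue (?b i - E) \<partial>count_space C)"
    proof (rule nn_integral_mono)
      fix i assume "i \<in> space (count_space C)"
      then have "i \<in> K" using C by auto
      then have "\<delta> * measure lebesgue (?b i) \<le> measure lebesgue (?b i - E)"
        by (auto simp: K_def)
      then show "ennreal \<delta> * emeasure lebesgue (?b i) \<le> emeasure lebesgue (?b i - E)"
        using fin[of i] \<delta> by (simp add: emeasure_eq_ennreal_measure ennreal_leI flip: ennreal_mult)
    qed
    also have "\<dots> = emeasure lebesgue (\<Union>i\<in>C. ?b i - E)"
    proof (rule emeasure_UN_countable[symmetric])
      show "disjoint_family_on (\<lambda>i. ?b i - E) C"
        using disj unfolding disjoint_family_on_def by blast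
    qed (use C(1) Es in auto)
    also have "\<dots> \<le> emeasure lebesgue (U - E)"
    proof (rule emeasure_mono)
      have "?b i \<subseteq> U" if "i \<in> C" for i
        using subsetD[OF C(2) that] by (cases i) (simp add: K_def)
      then show "(\<Union>i\<in>C. ?b i - E) \<subseteq> U - E" by blast
    qed (use U in blast)
    also note U(4)
    finally show False using \<delta> by (simp flip: ennreal_mult)
  qed
  then show thesis using that by blast
qed

text \<open>The measure of \<open>E \<inter> cball 0 t\<close> is continuous in \<open>t\<close>, because that of \<open>cball 0 t\<close> is; apply the
  intermediate value theorem.\<close>

lemma borel_subset_with_measure:
  fixes E :: "'a::euclidean_space set"
  assumes E: "E \<in> sets borel" "E \<in> lmeasurable" and c: "0 \<le> c" "c < measure lebesgue E"
  obtains A where "A \<in> sets borel" "A \<subseteq> E" "measure lebesgue A = c"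
proof -
  define f where "f t = measure lebesgue (E \<inter> cball 0 t)" for t
  define v where "v t = measure lebesgue (cball (0::'a) t)" for t
  have m: "E \<inter> cball 0 t \<in> lmeasurable" for t
    using E by (intro fmeasurable_Int_fmeasurable) auto
  have "(\<lambda>n. f (real n)) \<longlonglongrightarrow> measure lebesgue (\<Union>n. E \<inter> cball 0 (real n))"
    unfolding f_def
  proof (rule Lim_measure_incseq)
    show "range (\<lambda>n. E \<inter> cball 0 (real n)) \<subseteq> sets lebesgue" using m by blast
    show "incseq (\<lambda>n. E \<inter> cball 0 (real n))" by (auto simp: incseq_def)
    have "emeasure lebesgue (\<Union>n. E \<inter> cball 0 (real n)) \<le> emeasure lebesgue E"
      using E by (intro emeasure_mono) auto
    also have "\<dots> < \<infinity>" using E by (simp add: fmeasurable_def)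
    finally show "emeasure lebesgue (\<Union>n. E \<inter> cball 0 (real n)) \<noteq> \<infinity>" by simp
  qed
  also have "(\<Union>n. E \<inter> cball 0 (real n)) = E"
    by (auto intro: real_arch_simple)
  finally have "\<forall>\<^sub>F n in sequentially. c < f (real n)"
    using c by (intro order_tendstoD)
  then obtain n where n: "c < f (real n)"
    using eventually_happens'[OF sequentially_bot] by blast
  have f0: "f 0 = 0"
    unfolding f_def by (cases "0 \<in> E") auto
  have mono: "f t - f s \<le> v t - v s" "f s \<le> f t" if "s \<le> t" for s t
  proof -
    have "measure lebesgue (E \<inter> cball 0 t - E \<inter> cball 0 s) = f t - f s"
      unfolding f_def using that m by (intro measurable_measure_Diff) auto
    moreover have "measure lebesgue (cball (0::'a) t - cball 0 s) = v t - v s"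
      unfolding v_def using that by (intro measurable_measure_Diff) auto
    moreover have "measure lebesgue (E \<inter> cball 0 t - E \<inter> cball 0 s) \<le> measure lebesgue (cball (0::'a) t - cball 0 s)"
      using m by (intro measure_mono_fmeasurable fmeasurable_Diff) (auto dest: fmeasurableD)
    ultimately show "f t - f s \<le> v t - v s" by simp
    show "f s \<le> f t"
      unfolding f_def using that m by (intro measure_mono_fmeasurable) (auto dest: fmeasurableD)
  qed
  have close: "\<bar>f s - f t\<bar> \<le> \<bar>v s - v t\<bar>" for s t
    using mono[of s t] mono[of t s] by (cases "s \<le> t") auto
  \<comment> \<open>Continuity of \<open>t \<mapsto> |cball 0 t|\<close> from the volume formula.\<close>
  have "continuous_on {0..real n} v"
  proof -
    have "continuous_on {0..real n} (\<lambda>t. unit_ball_vol (real DIM('a)) * t ^ DIM('a))"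
      by (intro continuous_intros)
    then show ?thesis
      by (rule continuous_on_eq) (simp add: v_def content_cball)
  qed
  then have "continuous_on {0..real n} f"
    unfolding continuous_on_iff dist_real_def using close by (meson le_less_trans)
  then obtain t where "0 \<le> t" "f t = c"
    using IVT'[of f 0 c "real n"] c f0 n by auto
  then show thesis
    using E by (intro that[of "E \<inter> cball 0 t"]) (auto simp: f_def)
qed

text \<open>The strict inequality leaves room to split off one piece after another.\<close>

lemma borel_disjoint_subsets_with_measures:
  fixes E :: "'a::euclidean_space set" and c :: "'k \<Rightarrow> real"
  assumes "finite J" "E \<in> sets borel" "E \<in> lmeasurable" "\<And>j. j \<in> J \<Longrightarrow> 0 \<le> c j" "sum c J < measure lebesgue E"
  shows "\<exists>A. disjoint_family_on A J \<and> (\<forall>j\<in>J. A j \<in> sets borel \<and> A j \<subseteq> E \<and> measure lebesgue (A j) = c j)"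
  using assms
proof (induction J arbitrary: E rule: finite_induct)
  case (insert j J)
  have "0 \<le> sum c J" using insert by (intro sum_nonneg) auto
  then have "c j < measure lebesgue E" using insert by simp
  then obtain B where B: "B \<in> sets borel" "B \<subseteq> E" "measure lebesgue B = c j"
    using borel_subset_with_measure[of E "c j"] insert by auto
  have Bm: "B \<in> lmeasurable" using B insert by (auto intro: fmeasurableI2)
  have mEB: "measure lebesgue (E - B) = measure lebesgue E - c j"
    using measurable_measure_Diff[of E lebesgue B] insert B by auto
  have lEB: "E - B \<in> lmeasurable" using insert B Bm by (intro fmeasurable_Diff) auto
  obtain A where A: "disjoint_family_on A J"
      "\<And>i. i \<in> J \<Longrightarrow> A i \<in> sets borel \<and> A i \<subseteq> E - B \<and> measure lebesgue (A i) = c i"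
  proof -
    have "\<exists>A. disjoint_family_on A J \<and> (\<forall>i\<in>J. A i \<in> sets borel \<and> A i \<subseteq> E - B \<and> measure lebesgue (A i) = c i)"
      using mEB lEB insert.prems insert.hyps B by (intro insert.IH) auto
    then show ?thesis using that by blast
  qed
  have "disjoint_family_on (A(j := B)) (insert j J)"
    unfolding disjoint_family_on_def
  proof (intro ballI impI)
    fix i k assume "i \<in> insert j J" "k \<in> insert j J" "i \<noteq> k"
    then consider "i = j" "k \<in> J" "k \<noteq> j" | "k = j" "i \<in> J" "i \<noteq> j"
      | "i \<in> J" "k \<in> J" "i \<noteq> j" "k \<noteq> j" by blast
    then show "(A(j := B)) i \<inter> (A(j := B)) k = {}"
    proof cases
      case 1
      then show ?thesis using A(2)[of k] by auto
    next
      case 2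
      then show ?thesis using A(2)[of i] by auto
    next
      case 3
      then show ?thesis using A(1) \<open>i \<noteq> k\<close> by (simp add: disjoint_family_on_def)
    qed
  qed
  moreover have "\<forall>i\<in>insert j J. (A(j := B)) i \<in> sets borel \<and> (A(j := B)) i \<subseteq> E \<and> measure lebesgue ((A(j := B)) i) = c i"
  proof
    fix i assume "i \<in> insert j J"
    then show "(A(j := B)) i \<in> sets borel \<and> (A(j := B)) i \<subseteq> E \<and> measure lebesgue ((A(j := B)) i) = c i"
      using A(2)[of i] B by (cases "i = j") (simp_all, blast)
  qed
  ultimately show ?case by blast
qed (simp add: disjoint_family_on_def)

section \<open>Cutting off and adding a bump\<close>

lemma norm_add_power2_le:
  fixes x y :: "'a::real_inner"
  assumes "0 < K"
  shows "(norm (x + y))\<^sup>2 \<le> (1 + 1 / K) * (norm x)\<^sup>2 + (1 + K) * (norm y)\<^sup>2"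
proof -
  have "0 \<le> (norm x - K * norm y)\<^sup>2 / K" using assms by simp
  also have "\<dots> = (norm x)\<^sup>2 / K + K * (norm y)\<^sup>2 - 2 * (norm x * norm y)"
    using assms by (simp add: power2_eq_square field_simps)
  finally have "2 * (norm x * norm y) \<le> (norm x)\<^sup>2 / K + K * (norm y)\<^sup>2" by simp
  moreover have "(norm (x + y))\<^sup>2 \<le> (norm x + norm y)\<^sup>2"
    by (intro power_mono norm_triangle_ineq norm_ge_zero)
  ultimately show ?thesis by (simp add: power2_sum algebra_simps)
qed

lemma grad_affine:
  assumes "smooth \<phi>"
  shows "grad (\<lambda>x. c + s * \<phi> x) x = s *\<^sub>R grad \<phi> x"
proof (rule grad_eqI)
  show "((\<lambda>x. c + s * \<phi> x) has_derivative (\<lambda>v. v \<bullet> s *\<^sub>R grad \<phi> x)) (at x)"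
    using smooth_has_derivative[OF assms, of x]
    by (auto intro!: derivative_eq_intros)
qed

text \<open>Apply the Faber-Krahn inequality to \<open>cutoff a (2r) \<cdot> u\<close>, which agrees with \<open>u\<close> on \<open>ball a (2r)\<close> and is
  supported in \<open>ball a (4r)\<close>.\<close>

lemma local_poincare:
  fixes u :: "real ^ 'n \<Rightarrow> real"
  assumes lu: "loc_int u" and hG: "has_distributional_gradient u G"
    and iu: "integrable lebesgue (\<lambda>x. (u x)\<^sup>2)" and iG: "integrable lebesgue (\<lambda>x. (norm (G x))\<^sup>2)"
    and r: "0 < r" and \<theta>: "0 < \<theta>"
    and supp: "measure lebesgue ({x. u x \<noteq> 0} \<inter> ball a (4 * r)) \<le> measure lebesgue (ball (0::real^'n) (\<theta> * r)) / 2"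
  shows "(LINT x:ball a (2 * r)|lebesgue. (u x)\<^sup>2) \<le> 2 * (\<theta> * r)\<^sup>2 *
    (2 * (LINT x:ball a (4 * r)|lebesgue. (norm (G x))\<^sup>2) +
     2 * (cutoff_const / (2 * r))\<^sup>2 * (LINT x:ball a (4 * r)|lebesgue. (u x)\<^sup>2))"
proof -
  let ?\<zeta> = "cutoff a (2 * r)"
  let ?B = "ball a (4 * r)"
  define v where "v x = ?\<zeta> x * u x" for x
  define H where "H x = ?\<zeta> x *\<^sub>R G x + u x *\<^sub>R grad ?\<zeta> x" for x
  define q where "q x = 2 * (indicator ?B x *\<^sub>R (norm (G x))\<^sup>2) +
    2 * (cutoff_const / (2 * r))\<^sup>2 * (indicator ?B x *\<^sub>R (u x)\<^sup>2)" for x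
  have um: "u \<in> borel_measurable lebesgue" by (rule loc_int_measurable[OF lu])
  have \<zeta>0: "?\<zeta> x = 0" "grad ?\<zeta> x = 0" if "x \<notin> ?B" for x
    using that r by (auto intro!: cutoff_eq_0 grad_cutoff_eq_0)
  have lv: "loc_int v"
    unfolding v_def[abs_def]
    using loc_int_continuous_mult[OF lu smooth_continuous[OF smooth_cutoff]] by simp
  have hH: "has_distributional_gradient v H"
    unfolding v_def[abs_def] H_def[abs_def] by (rule distributional_gradient_mult[OF lu smooth_cutoff hG])
  have B: "?B \<in> sets lebesgue" by simp
  have i1: "integrable lebesgue (\<lambda>x. indicator ?B x *\<^sub>R (norm (G x))\<^sup>2)"
    "integrable lebesgue (\<lambda>x. indicator ?B x *\<^sub>R (u x)\<^sup>2)"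
    by (intro integrable_mult_indicator B iG iu)+
  then have iq: "integrable lebesgue q"
    unfolding q_def[abs_def] by (intro Bochner_Integration.integrable_add integrable_mult_right)
  have H_le: "(norm (H x))\<^sup>2 \<le> q x" for x
  proof (cases "x \<in> ?B")
    case True
    have "(norm (H x))\<^sup>2 \<le> 2 * (norm (?\<zeta> x *\<^sub>R G x))\<^sup>2 + 2 * (norm (u x *\<^sub>R grad ?\<zeta> x))\<^sup>2"
      using norm_add_power2_le[of 1 "?\<zeta> x *\<^sub>R G x" "u x *\<^sub>R grad ?\<zeta> x"] by (simp add: H_def)
    also have "\<dots> \<le> 2 * (norm (G x))\<^sup>2 + 2 * (\<bar>u x\<bar> * (cutoff_const / (2 * r)))\<^sup>2"
      using r norm_grad_cutoff_le[of "2 * r" a x] cutoff_nonneg[of a "2 * r" x] cutoff_le_1[of a "2 * r" x]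
        mult_left_mono[OF norm_grad_cutoff_le[of "2 * r" a x] abs_ge_zero[of "u x"]]
      by (intro add_mono mult_left_mono power_mono) (auto intro!: mult_left_le_one_le)
    also have "(\<bar>u x\<bar> * (cutoff_const / (2 * r)))\<^sup>2 = (cutoff_const / (2 * r))\<^sup>2 * (u x)\<^sup>2"
      by (simp only: power_mult_distrib power2_abs mult.commute)
    finally show ?thesis using True by (simp add: q_def)
  qed (simp add: H_def \<zeta>0 q_def)
  have "(\<integral>\<^sup>+x. ennreal ((v x)\<^sup>2) \<partial>lebesgue) \<le> ennreal (2 * (\<theta> * r)\<^sup>2) * (\<integral>\<^sup>+x. ennreal ((norm (H x))\<^sup>2) \<partial>lebesgue)"
  proof (rule faber_krahn[OF lv hH])
    have s: "{x. u x \<noteq> 0} \<in> sets lebesgue"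
      using borel_measurable_neq[OF um, of "\<lambda>_. 0"] by simp
    have fin: "{x. u x \<noteq> 0} \<inter> ?B \<in> lmeasurable"
      using s by (subst Int_commute) (intro fmeasurable_Int_fmeasurable, auto)
    have "{x. v x \<noteq> 0} \<subseteq> {x. u x \<noteq> 0} \<inter> ?B"
    proof
      fix x assume "x \<in> {x. v x \<noteq> 0}"
      then have "?\<zeta> x \<noteq> 0" "u x \<noteq> 0" by (auto simp: v_def)
      then show "x \<in> {x. u x \<noteq> 0} \<inter> ?B" using \<zeta>0(1)[of x] by blast
    qed
    then have "emeasure lebesgue {x. v x \<noteq> 0} \<le> emeasure lebesgue ({x. u x \<noteq> 0} \<inter> ?B)"
      using fin by (intro emeasure_mono) auto
    also have "\<dots> = ennreal (measure lebesgue ({x. u x \<noteq> 0} \<inter> ?B))"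
      by (rule emeasure_eq_measure2[OF fin])
    also have "\<dots> \<le> ennreal (measure lebesgue (ball (0::real^'n) (\<theta> * r)) / 2)"
      using supp by (rule ennreal_leI)
    finally show "emeasure lebesgue {x. v x \<noteq> 0} \<le> ennreal (measure lebesgue (ball (0::real^'n) (\<theta> * r)) / 2)" .
  qed (use r \<theta> in simp)
  also have "\<dots> \<le> ennreal (2 * (\<theta> * r)\<^sup>2) * (\<integral>\<^sup>+x. ennreal (q x) \<partial>lebesgue)"
    by (intro mult_left_mono nn_integral_mono ennreal_leI H_le) auto
  also have "(\<integral>\<^sup>+x. ennreal (q x) \<partial>lebesgue) = ennreal (LINT x|lebesgue. q x)"
    using order_trans[OF zero_le_power2 H_le] by (intro nn_integral_eq_integral iq) auto
  finally have 1: "(\<integral>\<^sup>+x. ennreal ((v x)\<^sup>2) \<partial>lebesgue) \<le> ennreal (2 * (\<theta> * r)\<^sup>2 * (LINT x|lebesgue. q x))"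
    using order_trans[OF zero_le_power2 H_le] by (simp add: ennreal_mult integral_nonneg_AE)
  have "ennreal (LINT x:ball a (2 * r)|lebesgue. (u x)\<^sup>2) = (\<integral>\<^sup>+x. ennreal (indicator (ball a (2 * r)) x *\<^sub>R (u x)\<^sup>2) \<partial>lebesgue)"
    unfolding set_lebesgue_integral_def
    by (intro nn_integral_eq_integral[symmetric] integrable_mult_indicator iu) auto
  also have "\<dots> \<le> (\<integral>\<^sup>+x. ennreal ((v x)\<^sup>2) \<partial>lebesgue)"
  proof (intro nn_integral_mono ennreal_leI)
    fix x
    show "indicator (ball a (2 * r)) x *\<^sub>R (u x)\<^sup>2 \<le> (v x)\<^sup>2"
      using cutoff_eq_1[of "2 * r" a x] r by (auto simp: v_def split: split_indicator)
  qed
  also note 1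
  finally have "(LINT x:ball a (2 * r)|lebesgue. (u x)\<^sup>2) \<le> 2 * (\<theta> * r)\<^sup>2 * (LINT x|lebesgue. q x)"
    using order_trans[OF zero_le_power2 H_le] by (subst (asm) ennreal_le_iff) (auto intro!: mult_nonneg_nonneg integral_nonneg_AE)
  also have "(LINT x|lebesgue. q x) = 2 * (LINT x:?B|lebesgue. (norm (G x))\<^sup>2) +
     2 * (cutoff_const / (2 * r))\<^sup>2 * (LINT x:?B|lebesgue. (u x)\<^sup>2)"
    unfolding q_def[abs_def] set_lebesgue_integral_def
    using i1 by (subst Bochner_Integration.integral_add) auto
  finally show ?thesis .
qed

text \<open>By iteration, \<open>\<alpha>\<close> at scale \<open>4\<^bsup>-i\<^esup>\<close> is at most \<open>O(4\<^bsup>-i(m+1)\<^esup>)\<close>, but the term \<open>\<gamma> r\<^sup>m\<close> forces it to be at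
  least of order \<open>4\<^bsup>-im\<^esup>\<close>.\<close>

lemma decay_contradiction:
  fixes \<alpha> :: "real \<Rightarrow> real"
  assumes pos: "0 < \<gamma>" "0 < r0" and nonneg: "\<And>r. 0 \<le> \<alpha> r"
    and decay: "\<And>r. 0 < r \<Longrightarrow> r \<le> r0 \<Longrightarrow> \<alpha> r + \<gamma> * r ^ m \<le> \<alpha> (4 * r) / 4 ^ (m + 1)"
  shows False
proof -
  define s where "s k = 4 * r0 / 4 ^ k" for k :: nat
  define q :: real where "q = 4 ^ (m + 1)"
  have q: "q > 0" by (simp add: q_def)
  have s: "0 < s (Suc k)" "s (Suc k) \<le> r0" "4 * s (Suc k) = s k" for k
  proof -
    have "(1::real) \<le> 4 ^ k" by simp
    then show "0 < s (Suc k)" "s (Suc k) \<le> r0" "4 * s (Suc k) = s k"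
      using pos by (simp_all add: s_def field_simps)
  qed
  have step: "\<alpha> (s (Suc k)) + \<gamma> * s (Suc k) ^ m \<le> \<alpha> (s k) / q" for k
    using decay[OF s(1,2), of k] by (simp only: s(3) q_def)
  have \<gamma>s: "0 \<le> \<gamma> * s (Suc k) ^ m" for k
    using pos s(1)[of k] by simp
  have iter: "\<alpha> (s k) \<le> \<alpha> (s 0) / q ^ k" for k
  proof (induction k)
    case (Suc k)
    have "\<alpha> (s (Suc k)) \<le> \<alpha> (s k) / q" using step[of k] \<gamma>s[of k] by linarith
    also have "\<dots> \<le> \<alpha> (s 0) / q ^ k / q" using Suc q by (intro divide_right_mono) auto
    finally show ?case by (simp add: mult.commute)
  qed simp
  have "\<gamma> * (4 * r0) ^ m * 4 ^ Suc k \<le> \<alpha> (s 0)" for k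
  proof -
    have "\<gamma> * s (Suc k) ^ m \<le> \<alpha> (s k) / q" using step[of k] nonneg[of "s (Suc k)"] by linarith
    also have "\<dots> \<le> \<alpha> (s 0) / q ^ k / q" using iter q by (intro divide_right_mono) auto
    finally have "\<gamma> * s (Suc k) ^ m * q ^ Suc k \<le> \<alpha> (s 0)"
      using q by (simp add: field_simps)
    moreover have "s (Suc k) ^ m * q ^ Suc k = (4 * r0) ^ m * 4 ^ Suc k"
    proof -
      have "q ^ Suc k = (4 ^ Suc k) ^ m * 4 ^ Suc k"
        unfolding q_def by (simp only: power_add power_mult_distrib power_one_right power_mult[symmetric] mult.commute[of m])
      then show ?thesis by (simp add: s_def power_divide del: power_Suc)
    qed
    ultimately show ?thesis by (simp only: mult.assoc)
  qed
  moreover obtain k where "\<alpha> (s 0) / (\<gamma> * (4 * r0) ^ m) < 4 ^ k"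
    using real_arch_pow[of 4] by auto
  moreover have "(4::real) ^ k \<le> 4 ^ Suc k" for k by simp
  moreover have "0 < \<gamma> * (4 * r0) ^ m" using pos by simp
  ultimately show False
    by (smt (verit) mult.commute pos_divide_less_eq mult_left_mono)
qed

text \<open>The change made to a single component: \<open>u\<close> is cut off so as to vanish on \<open>ball a r\<close>, and a bump of
  height \<open>\<tau> r\<^sup>2\<close> supported in that ball is added.  The case \<open>\<tau> = 0\<close> serves the components that only
  give way.  The coefficients are already truncated to \<open>\<Omega>\<close>.\<close>

locale competitor =
  fixes u :: "real ^ 'n \<Rightarrow> real" and G :: "real ^ 'n \<Rightarrow> real ^ 'n"
    and f g :: "real ^ 'n \<Rightarrow> real" and \<Omega> :: "(real ^ 'n) set" and M r \<tau> :: real and a :: "real ^ 'n"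
  assumes lu: "loc_int u" and hG: "has_distributional_gradient u G"
    and iu: "integrable lebesgue (\<lambda>x. (u x)\<^sup>2)" and iG: "integrable lebesgue (\<lambda>x. (norm (G x))\<^sup>2)"
    and fm: "f \<in> borel_measurable lebesgue" and gm: "g \<in> borel_measurable lebesgue"
    and \<Omega>: "\<Omega> \<in> lmeasurable"
    and f_le: "\<And>x. \<bar>f x\<bar> \<le> M" and g_le: "\<And>x. \<bar>g x\<bar> \<le> M * indicator \<Omega> x"
    and r: "0 < r" "r \<le> 1" and \<tau>: "0 \<le> \<tau>"
begin

text \<open>\<open>v\<close> is the modified function and \<open>H\<close> its gradient.\<close>

definition "\<zeta> = cutoff a r"
definition "bump x = \<tau> * r\<^sup>2 * cutoff a (r / 2) x"
definition "v x = (1 - \<zeta> x) * u x + bump x"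
definition "H x = (1 - \<zeta> x) *\<^sub>R G x - u x *\<^sub>R grad \<zeta> x + grad bump x"

lemma smooth_\<zeta>: "smooth \<zeta>" and smooth_bump: "smooth bump"
  unfolding \<zeta>_def bump_def[abs_def] by (intro smooth_cutoff smooth_cmult)+

lemma grad_bump: "grad bump x = (\<tau> * r\<^sup>2) *\<^sub>R grad (cutoff a (r / 2)) x"
  using grad_affine[OF smooth_cutoff, of 0 "\<tau> * r\<^sup>2" a "r / 2" x] by (simp add: bump_def[abs_def])

lemma v_distributional_gradient: "has_distributional_gradient v H"
proof -
  have sm: "smooth (\<lambda>x. 1 + (- 1) * \<zeta> x)"
    by (intro smooth_add smooth_const smooth_cmult smooth_\<zeta>)
  have "has_distributional_gradient (\<lambda>x. (1 + (- 1) * \<zeta> x) * u x + bump x)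
      (\<lambda>x. ((1 + (- 1) * \<zeta> x) *\<^sub>R G x + u x *\<^sub>R grad (\<lambda>x. 1 + (- 1) * \<zeta> x) x) + grad bump x)"
  proof (rule distributional_gradient_add)
    show "loc_int (\<lambda>x. (1 + (- 1) * \<zeta> x) * u x)"
      using loc_int_continuous_mult[OF lu smooth_continuous[OF sm]] by simp
    show "loc_int bump" by (rule loc_int_continuous[OF smooth_continuous[OF smooth_bump]])
  qed (rule distributional_gradient_mult[OF lu sm hG] distributional_gradient_smooth[OF smooth_bump])+
  then show ?thesis
    unfolding v_def[abs_def] H_def[abs_def] grad_affine[OF smooth_\<zeta>] by simp
qed

lemma u_meas: "u \<in> borel_measurable lebesgue"
  by (rule loc_int_measurable[OF lu])

lemma \<zeta>_meas: "\<zeta> \<in> borel_measurable lebesgue" and bump_meas: "bump \<in> borel_measurable lebesgue"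
  by (intro continuous_lebesgue_measurable smooth_continuous smooth_\<zeta> smooth_bump)+

lemma v_meas: "v \<in> borel_measurable lebesgue"
  unfolding v_def[abs_def]
  by (intro borel_measurable_add borel_measurable_times borel_measurable_diff u_meas \<zeta>_meas bump_meas
      borel_measurable_const)

lemma H_meas: "H \<in> borel_measurable lebesgue"
  using v_distributional_gradient loc_int_measurable by (auto simp: distributional_gradient_iff)

lemma \<zeta>_bounds: "0 \<le> \<zeta> x" "\<zeta> x \<le> 1"
  by (simp_all add: \<zeta>_def cutoff_nonneg cutoff_le_1)

lemma bump_bounds: "0 \<le> bump x" "bump x \<le> \<tau> * r\<^sup>2"
  using \<tau> cutoff_nonneg[of a "r / 2" x] cutoff_le_1[of a "r / 2" x]
  by (auto simp: bump_def intro!: mult_left_le)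

lemma competitor_inside: "dist a x < r \<Longrightarrow> v x = bump x" "dist a x < r \<Longrightarrow> H x = grad bump x"
  using cutoff_eq_1[of r a x] grad_cutoff_eq_0[of r a x] r by (auto simp: v_def H_def \<zeta>_def)

lemma competitor_outside: "r \<le> dist a x \<Longrightarrow> bump x = 0" "r \<le> dist a x \<Longrightarrow> grad bump x = 0"
  using cutoff_eq_0[of "r / 2" a x] grad_cutoff_eq_0[of "r / 2" a x] r by (auto simp: bump_def grad_bump)

lemma competitor_far: "2 * r \<le> dist a x \<Longrightarrow> v x = u x" "2 * r \<le> dist a x \<Longrightarrow> H x = G x"
  using cutoff_eq_0[of r a x] grad_cutoff_eq_0[of r a x] competitor_outside[of x] r by (auto simp: v_def H_def \<zeta>_def)

text \<open>On \<open>ball a r\<close> only the bump is left, so the term \<open>|G|\<^sup>2\<close> is gained; the cost of the cut-off arises in the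
  annulus between radius \<open>r\<close> and \<open>2r\<close>.  The parameter \<open>K\<close> comes from the weighted inequality
  \<open>2ab \<le> a\<^sup>2 / K + K b\<^sup>2\<close> applied to the cross term.\<close>

lemma grad_H_bound:
  assumes K: "0 < K"
  shows "(norm (H x))\<^sup>2 \<le> (norm (G x))\<^sup>2 - indicator (ball a r) x * (norm (G x))\<^sup>2
    + 1 / K * (indicator (ball a (2 * r)) x * (norm (G x))\<^sup>2)
    + (1 + K) * (cutoff_const / r)\<^sup>2 * (indicator (ball a (2 * r)) x * (u x)\<^sup>2)
    + 4 * cutoff_const\<^sup>2 * \<tau>\<^sup>2 * r\<^sup>2 * indicator (ball a r) x"
proof -
  consider "dist a x < r" | "r \<le> dist a x" "dist a x < 2 * r" | "2 * r \<le> dist a x" by linarith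
  then show ?thesis
  proof cases
    case 1
    have "norm (grad bump x) \<le> \<tau> * r\<^sup>2 * (cutoff_const / (r / 2))"
      using mult_left_mono[OF norm_grad_cutoff_le[of "r / 2" a x], of "\<tau> * r\<^sup>2"] r \<tau>
      by (simp add: grad_bump abs_mult del: divide_divide_eq_right)
    then have "(norm (grad bump x))\<^sup>2 \<le> (\<tau> * r\<^sup>2 * (cutoff_const / (r / 2)))\<^sup>2"
      by (intro power_mono) auto
    also have "\<dots> = 4 * cutoff_const\<^sup>2 * \<tau>\<^sup>2 * r\<^sup>2"
      using r by (simp add: power2_eq_square field_simps)
    moreover have "0 \<le> 1 / K * (norm (G x))\<^sup>2" "0 \<le> (1 + K) * (cutoff_const / r)\<^sup>2 * (u x)\<^sup>2"
      using K by simp_all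
    ultimately show ?thesis using 1 r by (simp add: competitor_inside)
  next
    case 2
    have "H x = (1 - \<zeta> x) *\<^sub>R G x + (- u x) *\<^sub>R grad \<zeta> x"
      using 2 by (simp add: H_def competitor_outside)
    then have "(norm (H x))\<^sup>2 \<le> (1 + 1 / K) * (norm ((1 - \<zeta> x) *\<^sub>R G x))\<^sup>2 + (1 + K) * (norm ((- u x) *\<^sub>R grad \<zeta> x))\<^sup>2"
      using norm_add_power2_le[OF K] by metis
    also have "\<dots> \<le> (1 + 1 / K) * (norm (G x))\<^sup>2 + (1 + K) * (\<bar>u x\<bar> * (cutoff_const / r))\<^sup>2"
      using \<zeta>_bounds[of x] mult_left_mono[OF norm_grad_cutoff_le[of r a x] abs_ge_zero[of "u x"]] r K
      by (intro add_mono mult_left_mono power_mono) (auto simp: \<zeta>_def intro!: mult_left_le_one_le)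
    also have "(\<bar>u x\<bar> * (cutoff_const / r))\<^sup>2 = (cutoff_const / r)\<^sup>2 * (u x)\<^sup>2"
      by (simp only: power_mult_distrib power2_abs mult.commute)
    finally show ?thesis using 2 by (simp add: distrib_right)
  next
    case 3
    then show ?thesis using r by (simp add: competitor_far)
  qed
qed

text \<open>The linear term of the potential is traded for a quadratic one and a multiple of \<open>r\<^sup>2\<close> that lives on the
  small set \<open>{u \<noteq> 0}\<close> only: expand \<open>0 \<le> (|u| / r - r)\<^sup>2\<close>.\<close>

lemma abs_u_le: "\<bar>u x\<bar> \<le> (u x)\<^sup>2 / r\<^sup>2 + r\<^sup>2 * indicator {x. u x \<noteq> 0} x"
proof (cases "u x = 0")
  case False
  have "0 \<le> (\<bar>u x\<bar> / r - r)\<^sup>2" by simp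
  also have "\<dots> = (u x)\<^sup>2 / r\<^sup>2 + r\<^sup>2 - 2 * \<bar>u x\<bar>"
    using r by (simp add: power2_diff power_divide)
  finally show ?thesis using False by simp
qed simp

text \<open>All terms except the last two account for the removal of \<open>u\<close>; since \<open>r \<le> 1\<close>, the powers \<open>1\<close> and \<open>r\<^sup>4\<close>
  are absorbed by \<open>1 / r\<^sup>2\<close> and \<open>r\<^sup>2\<close>.\<close>

lemma potential_bound:
  "(v x)\<^sup>2 * f x - v x * g x \<le> (u x)\<^sup>2 * f x - u x * g x
    + 2 * M / r\<^sup>2 * (indicator (ball a (2 * r)) x * (u x)\<^sup>2)
    + M * r\<^sup>2 * indicator ({x. u x \<noteq> 0} \<inter> ball a (2 * r)) x
    + M * \<tau>\<^sup>2 * r\<^sup>2 * indicator (ball a r) x - bump x * g x"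
proof -
  have M: "0 \<le> M" using f_le[of x] by linarith
  have g: "\<bar>g x\<bar> \<le> M" using g_le[of x] M by (auto split: split_indicator_asm)
  have r1: "1 \<le> 1 / r\<^sup>2" using r power_mono[of r 1 2] by (simp add: field_simps)
  have u2: "(u x)\<^sup>2 \<le> (u x)\<^sup>2 / r\<^sup>2"
    using mult_left_mono[OF r1, of "(u x)\<^sup>2"] by simp
  have key: "M * (u x)\<^sup>2 + M * \<bar>u x\<bar> \<le> 2 * M / r\<^sup>2 * (u x)\<^sup>2 + M * r\<^sup>2 * indicator {x. u x \<noteq> 0} x"
  proof -
    have "2 * M / r\<^sup>2 * (u x)\<^sup>2 = M * ((u x)\<^sup>2 / r\<^sup>2) + M * ((u x)\<^sup>2 / r\<^sup>2)"
      by simp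
    moreover have "M * ((u x)\<^sup>2 / r\<^sup>2 + r\<^sup>2 * indicator {x. u x \<noteq> 0} x) =
        M * ((u x)\<^sup>2 / r\<^sup>2) + M * r\<^sup>2 * indicator {x. u x \<noteq> 0} x"
      by (simp only: distrib_left mult.assoc)
    ultimately show ?thesis
      using mult_left_mono[OF u2 M] mult_left_mono[OF abs_u_le[of x] M] by linarith
  qed
  have uf: "\<bar>(u x)\<^sup>2 * f x\<bar> \<le> M * (u x)\<^sup>2"
    using mult_right_mono[OF f_le[of x], of "(u x)\<^sup>2"] by (simp add: abs_mult mult.commute)
  have ug: "\<bar>u x * g x\<bar> \<le> M * \<bar>u x\<bar>"
    using mult_right_mono[OF g, of "\<bar>u x\<bar>"] by (simp add: abs_mult mult.commute)
  consider "dist a x < r" | "r \<le> dist a x" "dist a x < 2 * r" | "2 * r \<le> dist a x" by linarith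
  then show ?thesis
  proof cases
    case 1
    have "(bump x)\<^sup>2 \<le> (\<tau> * r\<^sup>2)\<^sup>2"
      using bump_bounds[of x] by (intro power_mono) auto
    also have "\<dots> = \<tau>\<^sup>2 * r\<^sup>2 * r\<^sup>2" by (simp add: power2_eq_square)
    also have "\<dots> \<le> \<tau>\<^sup>2 * r\<^sup>2 * 1"
      using r power_mono[of r 1 2] by (intro mult_left_mono) auto
    finally have "M * (bump x)\<^sup>2 \<le> M * (\<tau>\<^sup>2 * r\<^sup>2)" using M by (intro mult_left_mono) auto
    moreover have "(bump x)\<^sup>2 * f x \<le> M * (bump x)\<^sup>2"
      using mult_right_mono[OF abs_le_D1[OF f_le[of x]], of "(bump x)\<^sup>2"] by (simp add: mult.commute)
    ultimately have "(bump x)\<^sup>2 * f x \<le> M * \<tau>\<^sup>2 * r\<^sup>2" by simp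
    moreover have "- ((u x)\<^sup>2 * f x - u x * g x) \<le> M * (u x)\<^sup>2 + M * \<bar>u x\<bar>"
      using uf ug by linarith
    ultimately show ?thesis using 1 r key by (simp add: competitor_inside indicator_inter_arith)
  next
    case 2
    have \<zeta>: "0 \<le> 1 - \<zeta> x" "1 - \<zeta> x \<le> 1" using \<zeta>_bounds[of x] by auto
    have "((v x)\<^sup>2 * f x - v x * g x) - ((u x)\<^sup>2 * f x - u x * g x) =
        (1 - (1 - \<zeta> x)\<^sup>2) * (- ((u x)\<^sup>2 * f x)) + \<zeta> x * (u x * g x)"
      using 2 by (simp add: v_def competitor_outside power2_eq_square algebra_simps)
    also have "\<dots> \<le> 1 * (M * (u x)\<^sup>2) + 1 * (M * \<bar>u x\<bar>)"
    proof (rule add_mono)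
      have z2: "0 \<le> 1 - (1 - \<zeta> x)\<^sup>2" "1 - (1 - \<zeta> x)\<^sup>2 \<le> 1"
        using power_mono[OF \<zeta>(2,1), of 2] by auto
      have "(1 - (1 - \<zeta> x)\<^sup>2) * (- ((u x)\<^sup>2 * f x)) \<le> (1 - (1 - \<zeta> x)\<^sup>2) * (M * (u x)\<^sup>2)"
        using z2 uf by (intro mult_left_mono) auto
      also have "\<dots> \<le> 1 * (M * (u x)\<^sup>2)" using z2 M by (intro mult_right_mono) auto
      finally show "(1 - (1 - \<zeta> x)\<^sup>2) * (- ((u x)\<^sup>2 * f x)) \<le> 1 * (M * (u x)\<^sup>2)" .
      have "\<zeta> x * (u x * g x) \<le> \<zeta> x * (M * \<bar>u x\<bar>)"
        using \<zeta>_bounds[of x] ug by (intro mult_left_mono) auto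
      also have "\<dots> \<le> 1 * (M * \<bar>u x\<bar>)" using \<zeta>_bounds[of x] M by (intro mult_right_mono) auto
      finally show "\<zeta> x * (u x * g x) \<le> 1 * (M * \<bar>u x\<bar>)" .
    qed
    finally show ?thesis using 2 key by (simp add: competitor_outside indicator_inter_arith)
  next
    case 3
    then show ?thesis using r by (simp add: competitor_far competitor_outside)
  qed
qed

lemma bump_square_integrable: "integrable lebesgue (\<lambda>x. (bump x)\<^sup>2)"
proof -
  have "test_function (\<lambda>x. bump x * cutoff a r x)"
    by (intro test_function_mult smooth_bump test_function_cutoff r)
  then have "integrable lebesgue (\<lambda>x. (bump x * cutoff a r x) *\<^sub>R bump x)"
    by (rule loc_int_test[OF loc_int_continuous[OF smooth_continuous[OF smooth_bump]]])
  moreover have "(bump x * cutoff a r x) *\<^sub>R bump x = (bump x)\<^sup>2" for x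
    using competitor_outside(1)[of x] cutoff_eq_1[OF r(1), of a x] by (cases "r \<le> dist a x") (auto simp: power2_eq_square)
  ultimately show ?thesis by simp
qed

lemma v_square_integrable: "integrable lebesgue (\<lambda>x. (v x)\<^sup>2)"
proof (rule Bochner_Integration.integrable_bound)
  show "integrable lebesgue (\<lambda>x. 2 * (u x)\<^sup>2 + 2 * (bump x)\<^sup>2)"
    by (intro Bochner_Integration.integrable_add integrable_mult_right iu bump_square_integrable)
  show "(\<lambda>x. (v x)\<^sup>2) \<in> borel_measurable lebesgue"
    by (intro borel_measurable_power v_meas)
  show "AE x in lebesgue. norm ((v x)\<^sup>2) \<le> norm (2 * (u x)\<^sup>2 + 2 * (bump x)\<^sup>2)"
  proof (intro AE_I2)
    fix x
    have "(v x)\<^sup>2 \<le> 2 * ((1 - \<zeta> x) * u x)\<^sup>2 + 2 * (bump x)\<^sup>2"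
      using norm_add_power2_le[of 1 "(1 - \<zeta> x) * u x" "bump x"] by (simp add: v_def)
    also have "((1 - \<zeta> x) * u x)\<^sup>2 \<le> (u x)\<^sup>2"
      using \<zeta>_bounds[of x] by (simp add: power_mult_distrib mult_left_le_one_le power_le_one)
    finally show "norm ((v x)\<^sup>2) \<le> norm (2 * (u x)\<^sup>2 + 2 * (bump x)\<^sup>2)" by simp
  qed
qed

lemma potential_integrable:
  assumes "w \<in> borel_measurable lebesgue" "integrable lebesgue (\<lambda>x. (w x)\<^sup>2)"
  shows "integrable lebesgue (\<lambda>x. (w x)\<^sup>2 * f x - w x * g x)" "integrable lebesgue (\<lambda>x. w x * g x)"
proof -
  have M: "0 \<le> M" using f_le[of undefined] by linarith
  have 1: "integrable lebesgue (\<lambda>x. (w x)\<^sup>2 * f x)"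
  proof (rule Bochner_Integration.integrable_bound)
    show "integrable lebesgue (\<lambda>x. (w x)\<^sup>2 * M)" using assms(2) by simp
    show "(\<lambda>x. (w x)\<^sup>2 * f x) \<in> borel_measurable lebesgue"
      by (intro borel_measurable_times borel_measurable_power assms(1) fm)
    show "AE x in lebesgue. norm ((w x)\<^sup>2 * f x) \<le> norm ((w x)\<^sup>2 * M)"
      using f_le M by (intro AE_I2) (auto simp: abs_mult intro!: mult_left_mono)
  qed
  show 2: "integrable lebesgue (\<lambda>x. w x * g x)"
  proof (rule Bochner_Integration.integrable_bound)
    show "integrable lebesgue (\<lambda>x. M * ((w x)\<^sup>2 + indicator \<Omega> x))"
      using \<Omega> by (intro integrable_mult_right Bochner_Integration.integrable_add assms(2) integrable_real_indicator)
        (auto simp: fmeasurable_def)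
    show "(\<lambda>x. w x * g x) \<in> borel_measurable lebesgue"
      by (intro borel_measurable_times assms(1) gm)
    show "AE x in lebesgue. norm (w x * g x) \<le> norm (M * ((w x)\<^sup>2 + indicator \<Omega> x))"
    proof (intro AE_I2)
      fix x
      have "\<bar>w x\<bar> \<le> (w x)\<^sup>2 + 1"
        using zero_le_power2[of "\<bar>w x\<bar> - 1"] norm_ge_zero[of "w x"]
        unfolding power2_diff power2_abs one_power2 mult_1_right real_norm_def by linarith
      then have "\<bar>w x\<bar> * indicator \<Omega> x \<le> (w x)\<^sup>2 + indicator \<Omega> x"
        by (auto split: split_indicator)
      then have "\<bar>w x\<bar> * \<bar>g x\<bar> \<le> M * ((w x)\<^sup>2 + indicator \<Omega> x)"
        using mult_left_mono[OF g_le[of x], of "\<bar>w x\<bar>"] mult_left_mono[OF _ M] by (smt (verit) abs_ge_zero mult.left_commute)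
      then show "norm (w x * g x) \<le> norm (M * ((w x)\<^sup>2 + indicator \<Omega> x))"
        using M by (simp add: abs_mult)
    qed
  qed
  from 1 2 show "integrable lebesgue (\<lambda>x. (w x)\<^sup>2 * f x - w x * g x)" by simp
qed

text \<open>Integrate the two pointwise bounds.\<close>

lemma competitor_energy:
  assumes K: "0 < K"
  shows "integrable lebesgue (\<lambda>x. (norm (H x))\<^sup>2)"
    and "(LINT x|lebesgue. (norm (H x))\<^sup>2) + (LINT x|lebesgue. (v x)\<^sup>2 * f x - v x * g x) \<le>
      (LINT x|lebesgue. (norm (G x))\<^sup>2) + (LINT x|lebesgue. (u x)\<^sup>2 * f x - u x * g x)
      - (LINT x:ball a r|lebesgue. (norm (G x))\<^sup>2) + 1 / K * (LINT x:ball a (2 * r)|lebesgue. (norm (G x))\<^sup>2)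
      + ((1 + K) * cutoff_const\<^sup>2 + 2 * M) / r\<^sup>2 * (LINT x:ball a (2 * r)|lebesgue. (u x)\<^sup>2)
      + M * r\<^sup>2 * measure lebesgue ({x. u x \<noteq> 0} \<inter> ball a (2 * r))
      + (4 * cutoff_const\<^sup>2 + M) * \<tau>\<^sup>2 * r\<^sup>2 * measure lebesgue (ball a r)
      - (LINT x|lebesgue. bump x * g x)"
proof -
  let ?i1 = "\<lambda>x. indicator (ball a r) x * (norm (G x))\<^sup>2"
  let ?i2 = "\<lambda>x. indicator (ball a (2 * r)) x * (norm (G x))\<^sup>2"
  let ?i3 = "\<lambda>x. indicator (ball a (2 * r)) x * (u x)\<^sup>2"
  let ?S = "{x. u x \<noteq> 0} \<inter> ball a (2 * r)"
  let ?i4 = "indicator ?S :: real ^ 'n \<Rightarrow> real"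
  let ?i5 = "indicator (ball a r) :: real ^ 'n \<Rightarrow> real"
  have i1: "integrable lebesgue ?i1" and i2: "integrable lebesgue ?i2" and i3: "integrable lebesgue ?i3"
    using integrable_mult_indicator[OF _ iG, of "ball a r"] integrable_mult_indicator[OF _ iG, of "ball a (2 * r)"]
      integrable_mult_indicator[OF _ iu, of "ball a (2 * r)"] by simp_all
  have "{x. u x \<noteq> 0} \<in> sets lebesgue"
    using borel_measurable_neq[OF u_meas, of "\<lambda>_. 0"] by simp
  then have S: "?S \<in> lmeasurable"
    by (subst Int_commute) (intro fmeasurable_Int_fmeasurable, auto)
  then have i4: "integrable lebesgue ?i4" "(LINT x|lebesgue. ?i4 x) = measure lebesgue ?S"
    by (auto simp: fmeasurable_def)
  have i5: "integrable lebesgue ?i5" "(LINT x|lebesgue. ?i5 x) = measure lebesgue (ball a r)"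
    using lmeasurable_ball[of a r] by (auto simp: fmeasurable_def)
  note pu = potential_integrable[OF u_meas iu]
  note pv = potential_integrable[OF v_meas v_square_integrable]
  note pb = potential_integrable[OF bump_meas bump_square_integrable]
  let ?R1 = "\<lambda>x. (norm (G x))\<^sup>2 - ?i1 x + 1 / K * ?i2 x + (1 + K) * (cutoff_const / r)\<^sup>2 * ?i3 x
    + 4 * cutoff_const\<^sup>2 * \<tau>\<^sup>2 * r\<^sup>2 * ?i5 x"
  let ?R2 = "\<lambda>x. (u x)\<^sup>2 * f x - u x * g x + 2 * M / r\<^sup>2 * ?i3 x + M * r\<^sup>2 * ?i4 x + M * \<tau>\<^sup>2 * r\<^sup>2 * ?i5 x - bump x * g x"
  have R1: "integrable lebesgue ?R1"
    by (intro Bochner_Integration.integrable_add Bochner_Integration.integrable_diff integrable_mult_right iG i1 i2 i3 i5)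
  have R2: "integrable lebesgue ?R2"
    by (intro Bochner_Integration.integrable_add Bochner_Integration.integrable_diff[OF _ pb(2)] integrable_mult_right pu(1) i3 i4 i5)
  show iH: "integrable lebesgue (\<lambda>x. (norm (H x))\<^sup>2)"
  proof (rule Bochner_Integration.integrable_bound[OF R1])
    show "(\<lambda>x. (norm (H x))\<^sup>2) \<in> borel_measurable lebesgue"
      using measurable_compose[OF H_meas, of norm borel] by (intro borel_measurable_power) auto
    show "AE x in lebesgue. norm ((norm (H x))\<^sup>2) \<le> norm (?R1 x)"
      using grad_H_bound[OF K] by (intro AE_I2) (smt (verit) real_norm_def zero_le_power2)
  qed
  have "(LINT x|lebesgue. (norm (H x))\<^sup>2) \<le> (LINT x|lebesgue. ?R1 x)"
    by (intro integral_mono iH R1 grad_H_bound K)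
  also have "\<dots> = (LINT x|lebesgue. (norm (G x))\<^sup>2) - (LINT x|lebesgue. ?i1 x) + 1 / K * (LINT x|lebesgue. ?i2 x)
    + (1 + K) * (cutoff_const / r)\<^sup>2 * (LINT x|lebesgue. ?i3 x) + 4 * cutoff_const\<^sup>2 * \<tau>\<^sup>2 * r\<^sup>2 * measure lebesgue (ball a r)"
    by (simp only: Bochner_Integration.integral_add Bochner_Integration.integral_diff integral_mult_right_zero
        Bochner_Integration.integrable_add Bochner_Integration.integrable_diff integrable_mult_right iG i1 i2 i3 i5)
  finally have 1: "(LINT x|lebesgue. (norm (H x))\<^sup>2) \<le> \<dots>" .
  have "(LINT x|lebesgue. (v x)\<^sup>2 * f x - v x * g x) \<le> (LINT x|lebesgue. ?R2 x)"
    by (intro integral_mono pv R2 potential_bound)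
  also have "\<dots> = (LINT x|lebesgue. (u x)\<^sup>2 * f x - u x * g x) + 2 * M / r\<^sup>2 * (LINT x|lebesgue. ?i3 x)
    + M * r\<^sup>2 * measure lebesgue ?S + M * \<tau>\<^sup>2 * r\<^sup>2 * measure lebesgue (ball a r) - (LINT x|lebesgue. bump x * g x)"
    by (simp only: Bochner_Integration.integral_add[of lebesgue "\<lambda>x. (u x)\<^sup>2 * f x - u x * g x"]
        Bochner_Integration.integral_add[of lebesgue "\<lambda>x. (u x)\<^sup>2 * f x - u x * g x + 2 * M / r\<^sup>2 * ?i3 x"]
        Bochner_Integration.integral_add[of lebesgue "\<lambda>x. (u x)\<^sup>2 * f x - u x * g x + 2 * M / r\<^sup>2 * ?i3 x + M * r\<^sup>2 * ?i4 x"]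
        Bochner_Integration.integral_diff[OF _ pb(2)] integral_mult_right_zero
        Bochner_Integration.integrable_add integrable_mult_right pu(1) i3 i4 i5)
  finally have 2: "(LINT x|lebesgue. (v x)\<^sup>2 * f x - v x * g x) \<le> \<dots>" .
  have 3: "(1 + K) * (cutoff_const / r)\<^sup>2 * X + 2 * M / r\<^sup>2 * X = ((1 + K) * cutoff_const\<^sup>2 + 2 * M) / r\<^sup>2 * X" for X
    by (simp add: power_divide add_divide_distrib algebra_simps)
  show "(LINT x|lebesgue. (norm (H x))\<^sup>2) + (LINT x|lebesgue. (v x)\<^sup>2 * f x - v x * g x) \<le>
      (LINT x|lebesgue. (norm (G x))\<^sup>2) + (LINT x|lebesgue. (u x)\<^sup>2 * f x - u x * g x)
      - (LINT x:ball a r|lebesgue. (norm (G x))\<^sup>2) + 1 / K * (LINT x:ball a (2 * r)|lebesgue. (norm (G x))\<^sup>2)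
      + ((1 + K) * cutoff_const\<^sup>2 + 2 * M) / r\<^sup>2 * (LINT x:ball a (2 * r)|lebesgue. (u x)\<^sup>2)
      + M * r\<^sup>2 * measure lebesgue ({x. u x \<noteq> 0} \<inter> ball a (2 * r))
      + (4 * cutoff_const\<^sup>2 + M) * \<tau>\<^sup>2 * r\<^sup>2 * measure lebesgue (ball a r)
      - (LINT x|lebesgue. bump x * g x)"
    using 1 2 unfolding set_lebesgue_integral_def real_scaleR_def 3[symmetric]
    by (simp add: distrib_right)
qed

lemma square_integrable_L2_loc:
  assumes "w \<in> borel_measurable lebesgue" "integrable lebesgue (\<lambda>x. (w x)\<^sup>2)"
  shows "w \<in> L2_loc"
  using assms unfolding L2_loc_def set_integrable_def
  by (auto intro!: integrable_mult_indicator[where f="\<lambda>x. (w x)\<^sup>2", unfolded real_scaleR_def] fmeasurableD lmeasurable_compact)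

text \<open>What the rest of the argument needs to know about \<open>v\<close>.\<close>

lemma exists_competitor:
  assumes K: "0 < K"
  obtains w Hw where "w \<in> W12" "has_distributional_gradient w Hw"
    "\<And>x. u x = 0 \<Longrightarrow> r \<le> dist a x \<Longrightarrow> w x = 0" "\<And>x. \<tau> = 0 \<Longrightarrow> dist a x < r \<Longrightarrow> w x = 0"
    "\<And>x. 0 \<le> u x \<Longrightarrow> 0 \<le> w x"
    "(LINT x|lebesgue. (norm (Hw x))\<^sup>2) + (LINT x|lebesgue. (w x)\<^sup>2 * f x - w x * g x) \<le>
      (LINT x|lebesgue. (norm (G x))\<^sup>2) + (LINT x|lebesgue. (u x)\<^sup>2 * f x - u x * g x)
      - (LINT x:ball a r|lebesgue. (norm (G x))\<^sup>2) + 1 / K * (LINT x:ball a (2 * r)|lebesgue. (norm (G x))\<^sup>2)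
      + ((1 + K) * cutoff_const\<^sup>2 + 2 * M) / r\<^sup>2 * (LINT x:ball a (2 * r)|lebesgue. (u x)\<^sup>2)
      + M * r\<^sup>2 * measure lebesgue ({x. u x \<noteq> 0} \<inter> ball a (2 * r))
      + (4 * cutoff_const\<^sup>2 + M) * \<tau>\<^sup>2 * r\<^sup>2 * measure lebesgue (ball a r)
      - \<tau> * r\<^sup>2 * (LINT x|lebesgue. cutoff a (r / 2) x * g x)"
proof -
  have bump: "(LINT x|lebesgue. bump x * g x) = \<tau> * r\<^sup>2 * (LINT x|lebesgue. cutoff a (r / 2) x * g x)"
    unfolding bump_def[abs_def] mult.assoc by simp
  show thesis
  proof (rule that[of v H])
    show "v \<in> W12"
      using square_integrable_L2_loc[OF v_meas v_square_integrable] v_distributional_gradient competitor_energy(1)[OF K]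
      by (auto simp: W12_def)
    show "v x = 0" if "u x = 0" "r \<le> dist a x" for x
      using that competitor_outside(1)[of x] by (simp add: v_def)
    show "v x = 0" if "\<tau> = 0" "dist a x < r" for x
    proof -
      have "bump x = 0" unfolding bump_def using that(1) by simp
      then show ?thesis using competitor_inside(1)[OF that(2)] by simp
    qed
    show "0 \<le> v x" if "0 \<le> u x" for x
      using that \<zeta>_bounds[of x] bump_bounds[of x] by (simp add: v_def)
  qed (fact v_distributional_gradient competitor_energy(2)[OF K, unfolded bump])+
qed

end

section \<open>Admissible pairs\<close>

lemma volume_ball:
  "0 \<le> r \<Longrightarrow> measure lebesgue (ball (x :: real ^ 'n) r) = unit_ball_vol (real CARD('n)) * r ^ CARD('n)"
  by (simp add: content_ball)

text \<open>Membership in \<open>W12\<close> only gives \<open>u \<in> L\<^sup>2\<close> locally, while \<open>\<Omega>\<close> may be unbounded.  As \<open>\<Omega>\<close> has finite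
  measure, the Faber-Krahn inequality for a ball of twice that measure makes \<open>u\<^sup>2\<close> integrable.  For the
  gradient, uniqueness transfers integrability from one representative to any other.\<close>

lemma W12_square_integrable:
  fixes u :: "real ^ 'n \<Rightarrow> real"
  assumes u: "u \<in> W12" and \<Omega>: "\<Omega> \<in> lmeasurable" and z: "AE x in lebesgue. x \<notin> \<Omega> \<longrightarrow> u x = 0"
    and hG: "has_distributional_gradient u G"
  shows "integrable lebesgue (\<lambda>x. (norm (G x))\<^sup>2)" "integrable lebesgue (\<lambda>x. (u x)\<^sup>2)"
proof -
  obtain G' where G': "has_distributional_gradient u G'" "integrable lebesgue (\<lambda>x. (norm (G' x))\<^sup>2)"
    using u by (auto simp: W12_def)
  have "loc_int G" using hG by (simp add: distributional_gradient_iff)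
  then have nG: "(\<lambda>x. norm (G x)) \<in> borel_measurable lebesgue"
    using measurable_compose[OF loc_int_measurable, of G norm borel] by auto
  show iG: "integrable lebesgue (\<lambda>x. (norm (G x))\<^sup>2)"
  proof (rule integrable_cong_AE_imp[OF G'(2)])
    show "(\<lambda>x. (norm (G x))\<^sup>2) \<in> borel_measurable lebesgue"
      by (intro borel_measurable_power nG)
    show "AE x in lebesgue. (norm (G' x))\<^sup>2 = (norm (G x))\<^sup>2"
      using distributional_gradient_unique[OF G'(1) hG] by eventually_elim simp
  qed
  have lu: "loc_int u" using u L2_loc_loc_int by (auto simp: W12_def)
  have um: "u \<in> borel_measurable lebesgue" by (rule loc_int_measurable[OF lu])
  define \<omega> where "\<omega> = unit_ball_vol (real CARD('n))"
  have \<omega>: "0 < \<omega>" by (simp add: \<omega>_def)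
  define \<rho> where "\<rho> = max 1 (2 * measure lebesgue \<Omega> / \<omega>)"
  have \<rho>: "1 \<le> \<rho>" "2 * measure lebesgue \<Omega> / \<omega> \<le> \<rho>" by (auto simp: \<rho>_def)
  have "2 * measure lebesgue \<Omega> \<le> \<omega> * \<rho>" using \<rho>(2) \<omega> by (simp add: field_simps)
  also have "\<dots> \<le> \<omega> * \<rho> ^ CARD('n)"
    using \<rho>(1) \<omega> self_le_power[of \<rho> "CARD('n)"] by (intro mult_left_mono) auto
  finally have vol: "measure lebesgue \<Omega> \<le> measure lebesgue (ball (0::real^'n) \<rho>) / 2"
    using \<rho>(1) by (simp add: volume_ball \<omega>_def del: measure_completion)
  have "emeasure lebesgue {x. u x \<noteq> 0} \<le> emeasure lebesgue \<Omega>"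
  proof (rule emeasure_mono_AE)
    show "AE x in lebesgue. x \<in> {x. u x \<noteq> 0} \<longrightarrow> x \<in> \<Omega>"
      using z by eventually_elim auto
  qed (use \<Omega> in auto)
  also have "\<dots> = ennreal (measure lebesgue \<Omega>)" by (rule emeasure_eq_measure2[OF \<Omega>])
  also have "\<dots> \<le> ennreal (measure lebesgue (ball (0::real^'n) \<rho>) / 2)" by (rule ennreal_leI[OF vol])
  finally have "(\<integral>\<^sup>+x. ennreal ((u x)\<^sup>2) \<partial>lebesgue) \<le> ennreal (2 * \<rho>\<^sup>2) * (\<integral>\<^sup>+x. ennreal ((norm (G x))\<^sup>2) \<partial>lebesgue)"
    using \<rho>(1) by (intro faber_krahn[OF lu hG]) auto
  also have "\<dots> = ennreal (2 * \<rho>\<^sup>2) * ennreal (LINT x|lebesgue. (norm (G x))\<^sup>2)"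
    by (subst nn_integral_eq_integral[OF iG]) auto
  also have "\<dots> < \<infinity>" by (simp add: ennreal_mult_less_top)
  finally show "integrable lebesgue (\<lambda>x. (u x)\<^sup>2)"
    by (intro integrableI_bounded borel_measurable_power um) simp
qed

text \<open>The energy in terms of any distributional gradients, and with the coefficients truncated to \<open>\<Omega>\<close>: they
  are arbitrary outside \<open>\<Omega>\<close>, possibly not even measurable there, but \<open>u\<close> vanishes.\<close>

lemma J_functional_eq:
  fixes \<Omega> :: "(real ^ 'n) set" and u :: "'k::finite \<Rightarrow> real ^ 'n \<Rightarrow> real"
  assumes \<Omega>: "\<Omega> \<in> sets lebesgue" and adm: "(u, W) \<in> admissible_pairs S \<Omega>"
    and hG: "\<And>i. has_distributional_gradient (u i) (G i)"
    and f: "\<And>i. f i \<in> borel_measurable (lebesgue_on \<Omega>)" and g: "\<And>i. g i \<in> borel_measurable (lebesgue_on \<Omega>)"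
  shows "J_functional f g F (u, W) = (\<Sum>i\<in>UNIV. LINT x|lebesgue. (norm (G i x))\<^sup>2) +
    (\<Sum>i\<in>UNIV. LINT x|lebesgue. (u i x)\<^sup>2 * (indicator \<Omega> x * f i x) - u i x * (indicator \<Omega> x * g i x)) + F W"
proof -
  have "(LINT x|lebesgue. (norm (weak_gradient (u i) x))\<^sup>2) = (LINT x|lebesgue. (norm (G i x))\<^sup>2)" for i
  proof (rule integral_cong_AE)
    have "has_distributional_gradient (u i) (weak_gradient (u i))"
      unfolding weak_gradient_def using someI[of "has_distributional_gradient (u i)", OF hG] .
    then have 1: "loc_int (weak_gradient (u i))" and 2: "loc_int (G i)"
      using hG[of i] by (auto simp: distributional_gradient_iff)
    have "(\<lambda>x. norm (H x)) \<in> borel_measurable lebesgue" if "loc_int H" for H :: "real ^ 'n \<Rightarrow> real ^ 'n"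
      using measurable_compose[OF loc_int_measurable[OF that], of norm borel] by auto
    from this[OF 1] this[OF 2] show "(\<lambda>x. (norm (weak_gradient (u i) x))\<^sup>2) \<in> borel_measurable lebesgue"
      "(\<lambda>x. (norm (G i x))\<^sup>2) \<in> borel_measurable lebesgue" by (auto intro: borel_measurable_power)
    show "AE x in lebesgue. (norm (weak_gradient (u i) x))\<^sup>2 = (norm (G i x))\<^sup>2"
      using weak_gradient_unique[OF hG[of i]] by eventually_elim simp
  qed
  moreover have "(LINT x|lebesgue. (u i x)\<^sup>2 * f i x - u i x * g i x) =
      (LINT x|lebesgue. (u i x)\<^sup>2 * (indicator \<Omega> x * f i x) - u i x * (indicator \<Omega> x * g i x))" (is "?L = ?R") for i
  proof -
    have u: "u i \<in> borel_measurable lebesgue"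
      using adm by (auto simp: admissible_pairs_def W12_def L2_loc_def)
    have fg: "(\<lambda>x. indicator \<Omega> x * f i x) \<in> borel_measurable lebesgue" "(\<lambda>x. indicator \<Omega> x * g i x) \<in> borel_measurable lebesgue"
      using iffD1[OF borel_measurable_restrict_space_iff f[of i]] iffD1[OF borel_measurable_restrict_space_iff g[of i]]
        \<Omega> by simp_all
    have W: "W i \<subseteq> \<Omega>" using adm by (auto simp: admissible_pairs_def disjoint_tuples_def)
    have "AE x in lebesgue. x \<notin> W i \<longrightarrow> u i x = 0"
      using adm by (auto simp: admissible_pairs_def)
    then have ae: "AE x in lebesgue. (u i x)\<^sup>2 * (indicator \<Omega> x * f i x) - u i x * (indicator \<Omega> x * g i x)
        = (u i x)\<^sup>2 * f i x - u i x * g i x"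
      by eventually_elim (use W in \<open>auto split: split_indicator\<close>)
    have m: "(\<lambda>x. (u i x)\<^sup>2 * (indicator \<Omega> x * f i x) - u i x * (indicator \<Omega> x * g i x)) \<in> borel_measurable lebesgue"
      by (intro borel_measurable_diff borel_measurable_times borel_measurable_power u fg)
    from borel_measurable_AE[OF m ae] m ae show "?L = ?R"
      by (intro integral_cong_AE[symmetric])
  qed
  ultimately show ?thesis by (simp add: J_functional_def)
qed

lemma measure_disjoint_UN_lmeasurable:
  assumes "finite I" "\<And>i. i \<in> I \<Longrightarrow> A i \<in> lmeasurable" "disjoint_family_on A I"
  shows "measure lebesgue (\<Union>i\<in>I. A i) = (\<Sum>i\<in>I. measure lebesgue (A i))"
proof (rule measure_finite_Union)
  show "A ` I \<subseteq> sets lebesgue" using assms(2) by blast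
  show "emeasure lebesgue (A i) \<noteq> \<infinity>" if "i \<in> I" for i
    using fmeasurableD2[OF assms(2)[OF that]] unfolding infinity_ennreal_def .
qed (fact assms)+

text \<open>The region \<open>k\<close> receives \<open>B\<close>, and each other region \<open>W j\<close> is compensated for \<open>W j \<inter> B\<close> by a piece \<open>A j\<close> of
  \<open>E - B\<close> of the same measure.  Since \<open>W\<close> fills \<open>\<Omega>\<close>, the pieces have total measure \<open>|B - W k|\<close>, which is
  exactly what \<open>W k\<close> gains.\<close>

lemma volume_exchange:
  fixes W :: "'k::finite \<Rightarrow> (real ^ 'n) set"
  assumes \<Omega>: "\<Omega> \<in> lmeasurable" and W: "W \<in> disjoint_tuples \<Omega>" and fills: "emeasure lebesgue (\<Omega> - (\<Union>i. W i)) = 0"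
    and B: "B \<in> sets borel" "B \<subseteq> \<Omega>" and E: "E \<in> sets borel" "E \<subseteq> W k"
    and small: "2 * measure lebesgue B < measure lebesgue E"
  obtains V where "V \<in> disjoint_tuples \<Omega>" "\<And>i. measure lebesgue (V i) = measure lebesgue (W i)"
    "B \<subseteq> V k" "W k - E \<subseteq> V k" "\<And>j. j \<noteq> k \<Longrightarrow> W j - B \<subseteq> V j"
proof -
  have Wb: "W i \<in> sets borel" and W\<Omega>: "W i \<subseteq> \<Omega>" and disj: "i \<noteq> j \<Longrightarrow> W i \<inter> W j = {}" for i j
    using W by (auto simp: disjoint_tuples_def disjoint_family_on_def)
  have lm: "A \<in> lmeasurable" if "A \<in> sets borel" "A \<subseteq> \<Omega>" for A
    using that \<Omega> by (auto intro: fmeasurableI2)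
  define J where "J = UNIV - {k}"
  define c where "c j = measure lebesgue (W j \<inter> B)" for j
  have djB: "disjoint_family_on (\<lambda>j. W j \<inter> B) J"
    using disj by (auto simp: disjoint_family_on_def)
  have lWB: "W j \<inter> B \<in> lmeasurable" for j
    using Wb B W\<Omega> by (intro lm) auto
  have lB: "B \<in> lmeasurable" and lE: "E \<in> lmeasurable"
    using B E W\<Omega>[of k] by (auto intro: lm)
  have sum_c: "sum c J = measure lebesgue (\<Union>j\<in>J. W j \<inter> B)"
    unfolding c_def using lWB djB
    by (intro measure_disjoint_UN_lmeasurable[symmetric]) (auto simp: J_def)
  have sum_eq: "sum c J = measure lebesgue (B - W k)"
  proof -
    have "measure lebesgue (\<Union>j\<in>J. W j \<inter> B) = measure lebesgue (B - W k)"
    proof (rule measure_eq_AE)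
      have "\<Omega> - (\<Union>i. W i) \<in> null_sets lebesgue"
        using fills \<Omega> Wb by (auto simp: null_sets_def)
      then have "AE x in lebesgue. x \<notin> \<Omega> - (\<Union>i. W i)" by (rule AE_not_in)
      then show "AE x in lebesgue. (x \<in> (\<Union>j\<in>J. W j \<inter> B)) = (x \<in> B - W k)"
      proof eventually_elim
        case (elim x)
        show ?case
        proof
          assume "x \<in> (\<Union>j\<in>J. W j \<inter> B)"
          then obtain j where "j \<noteq> k" "x \<in> W j" "x \<in> B" unfolding J_def by blast
          then show "x \<in> B - W k" using disj[of j k] by blast
        next
          assume x: "x \<in> B - W k"
          then have "x \<in> \<Omega>" using B(2) by blast
          then obtain i where i: "x \<in> W i" using elim by blast
          then have "i \<in> J" using x by (auto simp: J_def)
          with i x show "x \<in> (\<Union>j\<in>J. W j \<inter> B)" by blast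
        qed
      qed
      show "(\<Union>j\<in>J. W j \<inter> B) \<in> sets lebesgue" "B - W k \<in> sets lebesgue"
        using Wb B by (auto intro!: sets.finite_UN)
    qed
    then show ?thesis using sum_c by simp
  qed
  have "sum c J \<le> measure lebesgue B"
    unfolding sum_eq using lB Wb by (intro measure_mono_fmeasurable) auto
  moreover have "measure lebesgue E \<le> measure lebesgue (E - B) + measure lebesgue B"
  proof -
    have "measure lebesgue E \<le> measure lebesgue ((E - B) \<union> B)"
      using lE lB by (intro measure_mono_fmeasurable fmeasurable.Un fmeasurable_Diff) auto
    also have "\<dots> \<le> measure lebesgue (E - B) + measure lebesgue B"
      using lE lB by (intro measure_Un_le) auto
    finally show ?thesis .
  qed
  ultimately have lt: "sum c J < measure lebesgue (E - B)" using small by linarith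
  have "\<exists>A. disjoint_family_on A J \<and> (\<forall>j\<in>J. A j \<in> sets borel \<and> A j \<subseteq> E - B \<and> measure lebesgue (A j) = c j)"
    using lE lB B E
    by (intro borel_disjoint_subsets_with_measures lt fmeasurable_Diff) (auto simp: J_def c_def)
  then obtain A where A: "disjoint_family_on A J"
      "\<And>j. j \<in> J \<Longrightarrow> A j \<in> sets borel" "\<And>j. j \<in> J \<Longrightarrow> A j \<subseteq> E - B" "\<And>j. j \<in> J \<Longrightarrow> measure lebesgue (A j) = c j"
    by blast
  have lA: "A j \<in> lmeasurable" if "j \<in> J" for j
    using A(2,3)[OF that] E W\<Omega>[of k] by (intro lm) auto
  define UA where "UA = (\<Union>j\<in>J. A j)"
  have UAb: "UA \<in> sets borel" unfolding UA_def using A(2) by (intro sets.finite_UN) auto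
  have UAE: "UA \<subseteq> E - B" unfolding UA_def using A(3) by blast
  have lUA: "UA \<in> lmeasurable" using UAb UAE E W\<Omega>[of k] by (intro lm) auto
  have mUA: "measure lebesgue UA = sum c J"
  proof -
    have "measure lebesgue UA = (\<Sum>j\<in>J. measure lebesgue (A j))"
      unfolding UA_def using lA A(1) by (intro measure_disjoint_UN_lmeasurable) (auto simp: J_def)
    then show ?thesis using A(4) by simp
  qed
  define V where "V j = (if j = k then (W k \<union> B) - UA else (W j - B) \<union> A j)" for j
  have AW: "A j \<subseteq> W k - B" if "j \<in> J" for j
    using A(3)[OF that] E by blast
  show thesis
  proof (rule that[of V])
    show "V \<in> disjoint_tuples \<Omega>"
      unfolding disjoint_tuples_def
    proof (intro CollectI conjI allI)
      fix i
      show "V i \<in> sets borel"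
        using Wb B UAb A(2)[of i] by (auto simp: V_def J_def)
      show "V i \<subseteq> \<Omega>"
        using W\<Omega>[of i] W\<Omega>[of k] B AW[of i] by (auto simp: V_def J_def)
    next
      have kj: "V k \<inter> V j = {}" if "j \<noteq> k" for j
      proof -
        have j: "j \<in> J" using that by (simp add: J_def)
        have "A j \<subseteq> UA" using j by (auto simp: UA_def)
        then show ?thesis using that disj[of j k] AW[OF j] by (auto simp: V_def)
      qed
      have ij: "V i \<inter> V j = {}" if "i \<noteq> k" "j \<noteq> k" "i \<noteq> j" for i j
      proof -
        have J: "i \<in> J" "j \<in> J" using that by (auto simp: J_def)
        have "A i \<inter> A j = {}" using A(1) J that by (auto simp: disjoint_family_on_def)
        moreover have "W i \<inter> A j = {}" "W j \<inter> A i = {}"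
          using AW[OF J(1)] AW[OF J(2)] disj[OF that(1)] disj[OF that(2)] by blast+
        ultimately show ?thesis using that disj[OF that(3)] by (auto simp: V_def)
      qed
      show "disjoint_family V"
        unfolding disjoint_family_on_def using kj ij by (metis Int_commute)
    qed
    show "B \<subseteq> V k" "W k - E \<subseteq> V k" using UAE by (auto simp: V_def)
    show "W j - B \<subseteq> V j" if "j \<noteq> k" for j using that by (auto simp: V_def)
    show "measure lebesgue (V i) = measure lebesgue (W i)" for i
    proof (cases "i = k")
      case True
      have lW: "W k \<in> lmeasurable" "W k \<union> B \<in> lmeasurable" "B - W k \<in> lmeasurable"
        using Wb B W\<Omega>[of k] by (auto intro!: lm)
      have "measure lebesgue (W k \<union> (B - W k)) = measure lebesgue (W k) + measure lebesgue (B - W k)"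
        using lW by (intro measure_Un3[THEN trans]) auto
      then have "measure lebesgue (W k \<union> B) = measure lebesgue (W k) + sum c J"
        by (simp add: sum_eq)
      moreover have "measure lebesgue ((W k \<union> B) - UA) = measure lebesgue (W k \<union> B) - measure lebesgue UA"
        using lW lUA UAE E by (intro measurable_measure_Diff) auto
      ultimately show ?thesis using mUA True by (simp add: V_def)
    next
      case False
      then have i: "i \<in> J" by (simp add: J_def)
      have lW: "W i \<in> lmeasurable" "W i - B \<in> lmeasurable"
        using Wb B W\<Omega>[of i] by (auto intro!: lm)
      have "measure lebesgue (W i - W i \<inter> B) = measure lebesgue (W i) - c i"
        unfolding c_def using lW lWB[of i] by (intro measurable_measure_Diff) auto
      moreover have "W i - W i \<inter> B = W i - B" by blast
      ultimately have "measure lebesgue (W i) = measure lebesgue (W i - B) + c i" by simp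
      moreover have "(W i - B) \<inter> A i = {}" using AW[OF i] disj[OF False] by blast
      then have "measure lebesgue ((W i - B) \<union> A i) = measure lebesgue (W i - B) + measure lebesgue (A i)"
        using lW lA[OF i] by (simp add: measure_Un3)
      ultimately show ?thesis using A(4)[OF i] False by (simp add: V_def)
    qed
  qed
qed

section \<open>Non-vanishing of minimizers\<close>

text \<open>Compare the energy of the minimizer with that of the competitor built at the ball \<open>ball a r\<close>.  The
  right-hand side collects the cost of the cut-off, of the linear term on \<open>{u j \<noteq> 0}\<close> and of the bump;
  the second term on the left is the gain from the bump, which equals
  \<open>\<tau> r\<^sup>2\<close> on the ball of half the radius.\<close>

lemma minimizer_inequality:
  fixes \<Omega> :: "(real ^ 'n) set" and u f g :: "'k::finite \<Rightarrow> real ^ 'n \<Rightarrow> real"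
  assumes \<Omega>: "\<Omega> \<in> lmeasurable"
    and fm: "\<And>i. f i \<in> borel_measurable (lebesgue_on \<Omega>)" and gm: "\<And>i. g i \<in> borel_measurable (lebesgue_on \<Omega>)"
    and fM: "\<And>i x. x \<in> \<Omega> \<Longrightarrow> \<bar>f i x\<bar> \<le> M" and gM: "\<And>i x. x \<in> \<Omega> \<Longrightarrow> \<bar>g i x\<bar> \<le> M"
    and F: "\<And>V. V \<in> disjoint_tuples \<Omega> \<Longrightarrow> F V = Ft (\<lambda>i. measure lebesgue (V i))"
    and min: "is_minimizer (J_functional f g F) (admissible_pairs S \<Omega>) (u, W)"
    and fills: "emeasure lebesgue (\<Omega> - (\<Union>i. W i)) = 0"
    and g_pos: "\<And>i. AE x in lebesgue. x \<in> \<Omega> \<longrightarrow> g i x > 0"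
    and hG: "\<And>i. has_distributional_gradient (u i) (G i)"
    and E: "E \<in> sets borel" "E \<subseteq> W k" "\<And>x i. x \<in> E \<Longrightarrow> u i x = 0" "\<And>x. x \<in> E \<Longrightarrow> c0 \<le> g k x"
    and r: "0 < r" "r \<le> 1" "ball a r \<subseteq> \<Omega>" "2 * measure lebesgue (ball a r) < measure lebesgue E"
    and K: "0 < K" and \<tau>: "0 \<le> \<tau>" and M: "0 \<le> M"
  shows "(\<Sum>j\<in>UNIV. LINT x:ball a r|lebesgue. (norm (G j x))\<^sup>2) + \<tau> * r\<^sup>2 * (c0 * measure lebesgue (E \<inter> ball a (r / 2))) \<le>
     1 / K * (\<Sum>j\<in>UNIV. LINT x:ball a (2 * r)|lebesgue. (norm (G j x))\<^sup>2)
     + ((1 + K) * cutoff_const\<^sup>2 + 2 * M) / r\<^sup>2 * (\<Sum>j\<in>UNIV. LINT x:ball a (2 * r)|lebesgue. (u j x)\<^sup>2)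
     + M * r\<^sup>2 * (\<Sum>j\<in>UNIV. measure lebesgue ({x. u j x \<noteq> 0} \<inter> ball a (2 * r)))
     + (4 * cutoff_const\<^sup>2 + M) * \<tau>\<^sup>2 * r\<^sup>2 * measure lebesgue (ball a r)"
proof -
  have adm: "(u, W) \<in> admissible_pairs S \<Omega>"
    and opt: "\<And>w V. (w, V) \<in> admissible_pairs S \<Omega> \<Longrightarrow> J_functional f g F (u, W) \<le> J_functional f g F (w, V)"
    using min by (auto simp: is_minimizer_def)
  have W: "W \<in> disjoint_tuples \<Omega>" and uW12: "u i \<in> W12"
    and uz: "AE x in lebesgue. x \<notin> W i \<longrightarrow> u i x = 0"
    and uS: "i \<in> S \<Longrightarrow> AE x in lebesgue. 0 \<le> u i x" for i
    using adm by (auto simp: admissible_pairs_def)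
  have W\<Omega>: "W i \<subseteq> \<Omega>" for i using W by (auto simp: disjoint_tuples_def)
  have \<Omega>s: "\<Omega> \<in> sets lebesgue" using \<Omega> by blast
  define f0 where "f0 i x = indicator \<Omega> x * f i x" for i x
  define g0 where "g0 i x = indicator \<Omega> x * g i x" for i x
  have f0m: "f0 i \<in> borel_measurable lebesgue" and g0m: "g0 i \<in> borel_measurable lebesgue" for i
    using iffD1[OF borel_measurable_restrict_space_iff fm[of i]] iffD1[OF borel_measurable_restrict_space_iff gm[of i]] \<Omega>s
    by (simp_all add: f0_def[abs_def] g0_def[abs_def])
  have uz\<Omega>: "AE x in lebesgue. x \<notin> \<Omega> \<longrightarrow> u i x = 0" for i
    using uz[of i] by eventually_elim (use W\<Omega>[of i] in blast)
  \<comment> \<open>Only the component \<open>k\<close> receives a bump.\<close>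
  define \<tau>' where "\<tau>' j = (if j = k then \<tau> else 0)" for j
  have comp: "competitor (u j) (G j) (f0 j) (g0 j) \<Omega> M r (\<tau>' j)" for j
  proof
    show "loc_int (u j)" using uW12[of j] L2_loc_loc_int by (auto simp: W12_def)
    show "\<bar>f0 j x\<bar> \<le> M" "\<bar>g0 j x\<bar> \<le> M * indicator \<Omega> x" for x
      using fM[of x j] gM[of x j] M by (auto simp: f0_def g0_def split: split_indicator)
    show "0 \<le> \<tau>' j" using \<tau> by (simp add: \<tau>'_def)
  qed (fact hG f0m g0m \<Omega> r W12_square_integrable[OF uW12 \<Omega> uz\<Omega> hG])+
  define D1 where "D1 j = (LINT x:ball a r|lebesgue. (norm (G j x))\<^sup>2)" for j
  define D2 where "D2 j = (LINT x:ball a (2 * r)|lebesgue. (norm (G j x))\<^sup>2)" for j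
  define I2 where "I2 j = (LINT x:ball a (2 * r)|lebesgue. (u j x)\<^sup>2)" for j
  define m2 where "m2 j = measure lebesgue ({x. u j x \<noteq> 0} \<inter> ball a (2 * r))" for j
  define C where "C = ((1 + K) * cutoff_const\<^sup>2 + 2 * M) / r\<^sup>2"
  define X where "X = (LINT x|lebesgue. cutoff a (r / 2) x * g0 k x)"
  \<comment> \<open>The net effect of the bump; the rest of the energy balance is the same for all components.\<close>
  define P where "P = (4 * cutoff_const\<^sup>2 + M) * \<tau>\<^sup>2 * r\<^sup>2 * measure lebesgue (ball a r) - \<tau> * r\<^sup>2 * X"
  define En where "En j w H = (LINT x|lebesgue. (norm (H x))\<^sup>2) + (LINT x|lebesgue. (w x)\<^sup>2 * f0 j x - w x * g0 j x)"
    for j and w :: "real ^ 'n \<Rightarrow> real" and H :: "real ^ 'n \<Rightarrow> real ^ 'n"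
  have "\<exists>w H. w \<in> W12 \<and> has_distributional_gradient w H \<and> (\<forall>x. u j x = 0 \<longrightarrow> r \<le> dist a x \<longrightarrow> w x = 0) \<and>
      (\<forall>x. \<tau>' j = 0 \<longrightarrow> dist a x < r \<longrightarrow> w x = 0) \<and> (\<forall>x. 0 \<le> u j x \<longrightarrow> 0 \<le> w x) \<and>
      En j w H \<le> En j (u j) (G j) - D1 j + 1 / K * D2 j + C * I2 j + M * r\<^sup>2 * m2 j + (if j = k then P else 0)" for j
  proof -
    obtain w H where wH: "w \<in> W12" "has_distributional_gradient w H"
      "\<And>x. u j x = 0 \<Longrightarrow> r \<le> dist a x \<Longrightarrow> w x = 0" "\<And>x. \<tau>' j = 0 \<Longrightarrow> dist a x < r \<Longrightarrow> w x = 0"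
      "\<And>x. 0 \<le> u j x \<Longrightarrow> 0 \<le> w x"
      "En j w H \<le> En j (u j) (G j) - D1 j + 1 / K * D2 j + C * I2 j + M * r\<^sup>2 * m2 j
        + (4 * cutoff_const\<^sup>2 + M) * (\<tau>' j)\<^sup>2 * r\<^sup>2 * measure lebesgue (ball a r)
        - \<tau>' j * r\<^sup>2 * (LINT x|lebesgue. cutoff a (r / 2) x * g0 j x)"
      using competitor.exists_competitor[OF comp K, of j a thesis]
      unfolding En_def D1_def D2_def I2_def m2_def C_def by blast
    have "(4 * cutoff_const\<^sup>2 + M) * (\<tau>' j)\<^sup>2 * r\<^sup>2 * measure lebesgue (ball a r)
        - \<tau>' j * r\<^sup>2 * (LINT x|lebesgue. cutoff a (r / 2) x * g0 j x) = (if j = k then P else 0)"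
      by (simp add: \<tau>'_def P_def X_def)
    with wH show ?thesis by (intro exI[of _ w] exI[of _ H]) auto
  qed
  then obtain w H where w: "\<And>j. w j \<in> W12" and hH: "\<And>j. has_distributional_gradient (w j) (H j)"
    and w_out: "\<And>j x. u j x = 0 \<Longrightarrow> r \<le> dist a x \<Longrightarrow> w j x = 0"
    and w_in: "\<And>j x. \<tau>' j = 0 \<Longrightarrow> dist a x < r \<Longrightarrow> w j x = 0"
    and w_pos: "\<And>j x. 0 \<le> u j x \<Longrightarrow> 0 \<le> w j x"
    and En: "\<And>j. En j (w j) (H j) \<le> En j (u j) (G j) - D1 j + 1 / K * D2 j + C * I2 j + M * r\<^sup>2 * m2 j + (if j = k then P else 0)"
    by metis
  obtain V where V: "V \<in> disjoint_tuples \<Omega>" "\<And>i. measure lebesgue (V i) = measure lebesgue (W i)"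
    "ball a r \<subseteq> V k" "W k - E \<subseteq> V k" "\<And>j. j \<noteq> k \<Longrightarrow> W j - ball a r \<subseteq> V j"
    using volume_exchange[OF \<Omega> W fills _ r(3) E(1,2) r(4)] by auto
  \<comment> \<open>Outside \<open>V j\<close> one is in \<open>ball a r\<close> with no bump, outside the old region, or in a piece of \<open>E\<close>.\<close>
  have wV: "AE x in lebesgue. x \<notin> V j \<longrightarrow> w j x = 0" for j
    using uz[of j]
  proof eventually_elim
    case (elim x)
    show ?case
    proof
      assume x: "x \<notin> V j"
      show "w j x = 0"
      proof (cases "j = k")
        case True
        then have "x \<notin> ball a r" "x \<notin> W k \<or> x \<in> E" using x V(3,4) by blast+
        then show ?thesis using elim E(3)[of x j] True by (intro w_out) auto
      next
        case False
        then have \<tau>0: "\<tau>' j = 0" by (simp add: \<tau>'_def)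
        show ?thesis
        proof (cases "x \<in> ball a r")
          case True
          then show ?thesis by (intro w_in \<tau>0) simp
        next
          case out: False
          then have "x \<notin> W j" using x V(5)[OF False] by blast
          then show ?thesis using elim out by (intro w_out) auto
        qed
      qed
    qed
  qed
  have adm': "(w, V) \<in> admissible_pairs S \<Omega>"
    unfolding admissible_pairs_def
  proof (intro CollectI case_prodI conjI allI ballI)
    fix i assume "i \<in> S"
    from uS[OF this] show "AE x in lebesgue. 0 \<le> w i x"
      by eventually_elim (rule w_pos)
  qed (fact V(1) w wV)+
  have "F V = F W" using F[OF V(1)] F[OF W] V(2) by simp
  moreover have "J_functional f g F (u, W) = (\<Sum>j\<in>UNIV. En j (u j) (G j)) + F W"
    using J_functional_eq[OF \<Omega>s adm hG fm gm] by (simp add: En_def f0_def g0_def sum.distrib)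
  moreover have "J_functional f g F (w, V) = (\<Sum>j\<in>UNIV. En j (w j) (H j)) + F V"
    using J_functional_eq[OF \<Omega>s adm' hH fm gm] by (simp add: En_def f0_def g0_def sum.distrib)
  moreover have "(\<Sum>j\<in>UNIV. En j (w j) (H j)) \<le>
      (\<Sum>j\<in>UNIV. En j (u j) (G j) - D1 j + 1 / K * D2 j + C * I2 j + M * r\<^sup>2 * m2 j + (if j = k then P else 0))"
    by (intro sum_mono En)
  moreover have "\<dots> = (\<Sum>j\<in>UNIV. En j (u j) (G j)) - (\<Sum>j\<in>UNIV. D1 j) + 1 / K * (\<Sum>j\<in>UNIV. D2 j)
      + C * (\<Sum>j\<in>UNIV. I2 j) + M * r\<^sup>2 * (\<Sum>j\<in>UNIV. m2 j) + P"
    by (simp only: sum.distrib sum_subtractf sum_distrib_left[symmetric]) simp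
  ultimately have main: "(\<Sum>j\<in>UNIV. D1 j) \<le> 1 / K * (\<Sum>j\<in>UNIV. D2 j)
      + C * (\<Sum>j\<in>UNIV. I2 j) + M * r\<^sup>2 * (\<Sum>j\<in>UNIV. m2 j) + P"
    using opt[OF adm'] by linarith
  have "c0 * measure lebesgue (E \<inter> ball a (r / 2)) \<le> X"
  proof -
    let ?EB = "E \<inter> ball a (r / 2)"
    have EB: "?EB \<in> lmeasurable"
      using E by (subst Int_commute) (intro fmeasurable_Int_fmeasurable, auto)
    then have "c0 * measure lebesgue ?EB = (LINT x|lebesgue. c0 * indicator ?EB x)"
      by (simp add: fmeasurable_def)
    also have "\<dots> \<le> X"
      unfolding X_def
    proof (rule integral_mono_AE)
      show "integrable lebesgue (\<lambda>x. c0 * indicator ?EB x)"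
        using EB by (intro integrable_mult_right) (auto simp: fmeasurable_def)
      have "loc_int (g0 k)"
        unfolding loc_int_def set_integrable_def
      proof
        fix R
        show "integrable lebesgue (\<lambda>x. indicat_real (cball 0 R) x *\<^sub>R g0 k x)"
        proof (rule Bochner_Integration.integrable_bound)
          show "integrable lebesgue (\<lambda>x. M * indicator \<Omega> x)"
            using \<Omega> by (intro integrable_mult_right) (auto simp: fmeasurable_def)
          show "(\<lambda>x. indicat_real (cball 0 R) x *\<^sub>R g0 k x) \<in> borel_measurable lebesgue"
            by (intro borel_measurable_scaleR borel_measurable_indicator g0m) simp
          show "AE x in lebesgue. norm (indicat_real (cball 0 R) x *\<^sub>R g0 k x) \<le> norm (M * indicator \<Omega> x)"
            using gM[of _ k] M by (intro AE_I2) (auto simp: g0_def split: split_indicator)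
        qed
      qed
      then show "integrable lebesgue (\<lambda>x. cutoff a (r / 2) x * g0 k x)"
        using loc_int_test[OF _ test_function_cutoff, of "g0 k" "r / 2" a] r(1) by simp
      show "AE x in lebesgue. c0 * indicator ?EB x \<le> cutoff a (r / 2) x * g0 k x"
        using g_pos[of k]
      proof eventually_elim
        case (elim x)
        show ?case
        proof (cases "x \<in> ?EB")
          case True
          then have "x \<in> \<Omega>" using E(2) W\<Omega> by blast
          then show ?thesis
            using True E(4)[of x] r(1) cutoff_eq_1[of "r / 2" a x] by (simp add: g0_def)
        next
          case False
          have "0 \<le> g0 k x" using elim by (auto simp: g0_def split: split_indicator)
          then show ?thesis using False cutoff_nonneg[of a "r / 2" x] by simp
        qed
      qed
    qed
    finally show ?thesis .
  qed
  then have "\<tau> * r\<^sup>2 * (c0 * measure lebesgue (E \<inter> ball a (r / 2))) \<le> \<tau> * r\<^sup>2 * X"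
    using \<tau> by (intro mult_left_mono) auto
  with main show ?thesis
    unfolding P_def D1_def D2_def I2_def m2_def C_def by linarith
qed

text \<open>Up to null sets, the zero set of \<open>u\<close> is the countable union of the sets \<open>A k m\<close> of points of \<open>W k\<close> where
  all \<open>u i\<close> vanish and \<open>g k \<ge> 1 / (m + 1)\<close>.  One of them is not null, and it contains a Borel set of the
  same measure.\<close>

lemma exists_vanishing_set:
  fixes \<Omega> :: "(real ^ 'n) set" and u g :: "'k::finite \<Rightarrow> real ^ 'n \<Rightarrow> real"
  assumes \<Omega>: "\<Omega> \<in> lmeasurable" and um: "\<And>i. u i \<in> borel_measurable lebesgue"
    and gm: "\<And>i. g i \<in> borel_measurable (lebesgue_on \<Omega>)"
    and W: "\<And>i. W i \<in> sets borel" "\<And>i. W i \<subseteq> \<Omega>"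
    and fills: "emeasure lebesgue (\<Omega> - (\<Union>i. W i)) = 0"
    and g_pos: "\<And>i. AE x in lebesgue. x \<in> \<Omega> \<longrightarrow> g i x > 0"
    and neg: "\<not> (AE x in lebesgue. x \<in> \<Omega> \<longrightarrow> (\<exists>i. u i x \<noteq> 0))"
  obtains k E c where "0 < c" "E \<in> sets borel" "E \<subseteq> W k" "0 < measure lebesgue E"
    "\<And>x i. x \<in> E \<Longrightarrow> u i x = 0" "\<And>x. x \<in> E \<Longrightarrow> c \<le> g k x"
proof -
  have \<Omega>s: "\<Omega> \<in> sets lebesgue" using \<Omega> by blast
  define A where "A k m = {x \<in> W k. (\<forall>i. u i x = 0) \<and> 1 / real (Suc m) \<le> indicator \<Omega> x * g k x}" for k m
  have As: "A k m \<in> sets lebesgue" for k m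
  proof -
    have g0: "(\<lambda>x. indicator \<Omega> x * g k x) \<in> borel_measurable lebesgue"
      using iffD1[OF borel_measurable_restrict_space_iff gm[of k]] \<Omega>s by simp
    have 1: "{x. 1 / real (Suc m) \<le> indicator \<Omega> x * g k x} \<in> sets lebesgue"
      using borel_measurable_le[OF borel_measurable_const g0, of "1 / real (Suc m)"] by simp
    have 2: "{x. u i x = 0} \<in> sets lebesgue" for i
      using borel_measurable_eq[OF um[of i] borel_measurable_const, of 0] by simp
    have "A k m = W k \<inter> (\<Inter>i. {x. u i x = 0}) \<inter> {x. 1 / real (Suc m) \<le> indicator \<Omega> x * g k x}"
      by (auto simp: A_def)
    also have "\<dots> \<in> sets lebesgue"
      using W(1)[of k] 1 2 by (intro sets.Int sets.finite_INT) auto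
    finally show ?thesis .
  qed
  have "\<exists>k m. A k m \<notin> null_sets lebesgue"
  proof (rule ccontr)
    assume "\<not> ?thesis"
    then have "AE x in lebesgue. x \<notin> A k m" for k m by (blast intro: AE_not_in)
    then have a1: "AE x in lebesgue. \<forall>k m. x \<notin> A k m" by (simp add: AE_all_countable)
    have "\<Omega> - (\<Union>i. W i) \<in> null_sets lebesgue"
      using fills \<Omega>s W(1) by (intro null_setsI sets.Diff sets.finite_UN) auto
    then have a2: "AE x in lebesgue. x \<notin> \<Omega> - (\<Union>i. W i)" by (rule AE_not_in)
    have a3: "AE x in lebesgue. \<forall>i. x \<in> \<Omega> \<longrightarrow> g i x > 0"
      unfolding AE_all_countable using g_pos by blast
    have "AE x in lebesgue. x \<in> \<Omega> \<longrightarrow> (\<exists>i. u i x \<noteq> 0)"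
      using a1 a2 a3
    proof eventually_elim
      case (elim x)
      show ?case
      proof (intro impI, rule ccontr)
        assume x: "x \<in> \<Omega>" and n: "\<not> (\<exists>i. u i x \<noteq> 0)"
        obtain k where k: "x \<in> W k" using elim(2) x by blast
        have "0 < g k x" using elim(3) x by blast
        then obtain m where "inverse (real (Suc m)) < g k x" using reals_Archimedean by blast
        then have "x \<in> A k m" using k x n by (simp add: A_def inverse_eq_divide)
        then show False using elim(1) by blast
      qed
    qed
    with neg show False by contradiction
  qed
  then obtain k m where km: "A k m \<notin> null_sets lebesgue" by blast
  define E where "E = main_part lborel (A k m)"
  have Eb: "E \<in> sets borel" using main_part_sets[OF As[of k m]] by (simp add: E_def)
  have EA: "E \<subseteq> A k m"
    using main_part_null_part_Un[OF As[of k m]] unfolding E_def by blast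
  have "emeasure lebesgue E = emeasure lebesgue (A k m)"
    using Eb As[of k m] by (simp add: E_def)
  then have "emeasure lebesgue E \<noteq> 0" using km As[of k m] by (metis null_setsI)
  moreover have "E \<in> lmeasurable"
    using Eb EA W(2)[of k] \<Omega> by (intro fmeasurableI2[OF \<Omega>]) (auto simp: A_def)
  ultimately have "0 < measure lebesgue E"
    by (metis emeasure_eq_measure2 ennreal_0 zero_less_measure_iff)
  show thesis
  proof (rule that[of "1 / real (Suc m)" E k])
    show "1 / real (Suc m) \<le> g k x" if "x \<in> E" for x
    proof -
      have "x \<in> A k m" using that EA by blast
      then show ?thesis using W(2)[of k] by (auto simp: A_def)
    qed
  qed (use EA Eb \<open>0 < measure lebesgue E\<close> in \<open>auto simp: A_def\<close>)
qed

theorem proposition12p3: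
  fixes \<Omega> :: "(real ^ 'n) set"
    and f g :: "'k::finite \<Rightarrow> real ^ 'n \<Rightarrow> real"
    and F :: "('k \<Rightarrow> (real ^ 'n) set) \<Rightarrow> real"
    and S :: "'k set"
    and u :: "'k \<Rightarrow> real ^ 'n \<Rightarrow> real"
    and W :: "'k \<Rightarrow> (real ^ 'n) set"
  assumes "CARD('n) \<ge> 2"
    and "open \<Omega>"
    and "emeasure lebesgue \<Omega> < \<infinity>"
    and "\<And>i. f i \<in> borel_measurable (lebesgue_on \<Omega>)"
    and "\<And>i. g i \<in> borel_measurable (lebesgue_on \<Omega>)"
    and "\<And>i. bounded (f i ` \<Omega>)"
    and "\<And>i. bounded (g i ` \<Omega>)"
    and "\<exists>Ft :: ('k \<Rightarrow> real) \<Rightarrow> real. \<forall>V\<in>disjoint_tuples \<Omega>. F V = Ft (\<lambda>i. measure lebesgue (V i))"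
    and "is_minimizer (J_functional f g F) (admissible_pairs S \<Omega>) (u, W)"
    and "emeasure lebesgue (\<Omega> - (\<Union>i. W i)) = 0"
    and "\<And>i. AE x in lebesgue. x \<in> \<Omega> \<longrightarrow> g i x > 0"
  shows "AE x in lebesgue. x \<in> \<Omega> \<longrightarrow> (\<chi> i. u i x) \<noteq> 0"
proof (rule ccontr)
  assume "\<not> (AE x in lebesgue. x \<in> \<Omega> \<longrightarrow> (\<chi> i. u i x) \<noteq> 0)"
  then have neg: "\<not> (AE x in lebesgue. x \<in> \<Omega> \<longrightarrow> (\<exists>i. u i x \<noteq> 0))"
    by (simp add: vec_eq_iff)
  have \<Omega>: "\<Omega> \<in> lmeasurable"
    using assms(2,3) by (intro fmeasurableI) auto
  have adm: "(u, W) \<in> admissible_pairs S \<Omega>"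
    using assms(9) by (simp add: is_minimizer_def)
  have W: "W i \<in> sets borel" "W i \<subseteq> \<Omega>" and uW12: "u i \<in> W12"
    and uz: "AE x in lebesgue. x \<notin> W i \<longrightarrow> u i x = 0" for i
    using adm by (auto simp: admissible_pairs_def disjoint_tuples_def)
  have lu: "loc_int (u i)" for i
    using uW12[of i] L2_loc_loc_int by (auto simp: W12_def)
  have uz\<Omega>: "AE x in lebesgue. x \<notin> \<Omega> \<longrightarrow> u i x = 0" for i
    using uz[of i] by eventually_elim (use W(2)[of i] in blast)
  have "\<exists>G. has_distributional_gradient (u i) G" for i
    using uW12[of i] by (auto simp: W12_def)
  then obtain G where hG: "\<And>i. has_distributional_gradient (u i) (G i)" by metis
  note int = W12_square_integrable[OF uW12 \<Omega> uz\<Omega> hG]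
  obtain Ft where Ft: "\<And>V. V \<in> disjoint_tuples \<Omega> \<Longrightarrow> F V = Ft (\<lambda>i. measure lebesgue (V i))"
    using assms(8) by blast
  have "bounded (\<Union>i. f i ` \<Omega> \<union> g i ` \<Omega>)"
    using assms(6,7) by (intro bounded_UN) auto
  then obtain M where M: "0 < M" "\<forall>y\<in>(\<Union>i. f i ` \<Omega> \<union> g i ` \<Omega>). norm y \<le> M"
    using bounded_pos by blast
  have fM: "\<bar>f i x\<bar> \<le> M" and gM: "\<bar>g i x\<bar> \<le> M" if "x \<in> \<Omega>" for i x
    using M(2) that by fastforce+
  obtain c E k where c: "0 < c" and E: "E \<in> sets borel" "E \<subseteq> W k" "0 < measure lebesgue E"
    "\<And>x i. x \<in> E \<Longrightarrow> u i x = 0" "\<And>x. x \<in> E \<Longrightarrow> c \<le> g k x"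
    by (rule exists_vanishing_set[where u=u and g=g and W=W, OF \<Omega> loc_int_measurable[OF lu] assms(5) W assms(10,11) neg]) (rule that; assumption)
  have lE: "E \<in> lmeasurable"
    using E(1,2) W(2)[of k] by (intro fmeasurableI2[OF \<Omega>]) auto
  \<comment> \<open>The constants: \<open>\<tau>\<close> balances the cost \<open>Q \<tau>\<^sup>2\<close> of the bump against half of its gain, and \<open>2 \<gamma> r\<^bsup>n+2\<^esup>\<close> is
    what then remains.  \<open>\<epsilon>\<close> is the decay rate wanted in the end; \<open>K\<close> spends one half of it on the gradient
    term, and \<open>\<theta>\<close> the other half on the term with \<open>I\<close>.  Finally \<open>\<delta>\<close>, the allowed defect of density, is
    small enough for \<open>E\<close> to fill half of the ball where the bump is constant, for the linear term to cost at most
    \<open>\<gamma> r\<^bsup>n+2\<^esup>\<close>, and for the Faber-Krahn radius to be \<open>\<theta> r\<close>.\<close>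
  define n where "n = CARD('n)"
  define N where "N = real (CARD('k))"
  define \<omega> where "\<omega> = unit_ball_vol (real n)"
  define Q where "Q = 4 * cutoff_const\<^sup>2 + M"
  define \<tau> where "\<tau> = c / (2 ^ (n + 2) * Q)"
  define \<gamma> where "\<gamma> = \<tau> * c * \<omega> / 2 ^ (n + 3)"
  define \<epsilon> :: real where "\<epsilon> = 1 / 4 ^ (n + 3)"
  define K where "K = 2 / \<epsilon>"
  define C1 where "C1 = (1 + K) * cutoff_const\<^sup>2 + 2 * M + 1"
  define \<theta> where "\<theta> = sqrt (\<epsilon> / (4 * C1 * (2 + 8 * cutoff_const\<^sup>2)))"
  define \<delta> where "\<delta> = min (1 / 2) (min (\<gamma> / (N * M * 2 ^ n * \<omega>)) (\<theta> ^ n / (2 * 4 ^ n)))"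
  have n: "n = CARD('n)" by (rule n_def)
  have \<omega>: "0 < \<omega>" and N: "0 < N" and Q: "0 < Q" and \<epsilon>: "0 < \<epsilon>"
    using M by (auto simp: \<omega>_def N_def Q_def \<epsilon>_def add_nonneg_pos)
  have \<tau>: "0 < \<tau>" and K: "0 < K" using c Q \<epsilon> by (auto simp: \<tau>_def K_def)
  have \<gamma>: "0 < \<gamma>" using \<tau> c \<omega> by (simp add: \<gamma>_def)
  have C1: "0 < C1" using K M by (simp add: C1_def add_nonneg_pos)
  have \<theta>: "0 < \<theta>" "C1 * (2 * \<theta>\<^sup>2 * (2 + 8 * cutoff_const\<^sup>2)) = \<epsilon> / 2"
  proof -
    define q where "q = 2 + 8 * cutoff_const\<^sup>2"
    have q: "0 < q" by (simp add: q_def add_pos_nonneg)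
    then show "0 < \<theta>" using \<epsilon> C1 by (simp add: \<theta>_def flip: q_def)
    have "\<theta>\<^sup>2 = \<epsilon> / (4 * C1 * q)"
      using q \<epsilon> C1 by (simp add: \<theta>_def flip: q_def)
    then show "C1 * (2 * \<theta>\<^sup>2 * (2 + 8 * cutoff_const\<^sup>2)) = \<epsilon> / 2"
      using q C1 by (simp add: field_simps flip: q_def)
  qed
  have \<delta>: "0 < \<delta>" "\<delta> \<le> 1 / 2" "\<delta> \<le> \<gamma> / (N * M * 2 ^ n * \<omega>)" "\<delta> \<le> \<theta> ^ n / (2 * 4 ^ n)"
  proof -
    show "0 < \<delta>" using \<gamma> N M(1) \<omega> \<theta>(1) by (simp add: \<delta>_def)
    show "\<delta> \<le> 1 / 2" unfolding \<delta>_def by (rule min.cobounded1)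
    show "\<delta> \<le> \<gamma> / (N * M * 2 ^ n * \<omega>)" "\<delta> \<le> \<theta> ^ n / (2 * 4 ^ n)"
      unfolding \<delta>_def by (meson min.cobounded1 min.cobounded2 order_trans)+
  qed
  obtain a r1 where a: "a \<in> E" and r1: "0 < r1"
    and dens: "\<And>r. 0 < r \<Longrightarrow> r < r1 \<Longrightarrow> measure lebesgue (ball a r - E) \<le> \<delta> * measure lebesgue (ball a r)"
    by (rule density_point[OF lE E(3) \<delta>(1)]) (rule that; assumption)
  have "a \<in> \<Omega>" using a E(2) W(2) by blast
  then obtain r2 where r2: "0 < r2" "ball a r2 \<subseteq> \<Omega>" by (rule openE[OF assms(2)])
  \<comment> \<open>Small enough for the density estimate up to radius \<open>4r\<close>, for the ball to lie in \<open>\<Omega>\<close>, and for its volume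
    to be less than half of \<open>|E|\<close>.\<close>
  define r0 where "r0 = min (min 1 (r1 / 5)) (min r2 (measure lebesgue E / (4 * \<omega>)))"
  have r0: "0 < r0" "r0 \<le> 1" "4 * r0 < r1" "r0 \<le> r2" "r0 \<le> measure lebesgue E / (4 * \<omega>)"
    using r1 r2(1) E(3) \<omega> by (auto simp: r0_def)
  have vol: "measure lebesgue (ball x r) = \<omega> * r ^ n" if "0 \<le> r" for x :: "real ^ 'n" and r
    using volume_ball[OF that, of x] by (simp only: n \<omega>_def)
  define D where "D r = (\<Sum>j\<in>UNIV. LINT x:ball a r|lebesgue. (norm (G j x))\<^sup>2)" for r
  define I where "I r = (\<Sum>j\<in>UNIV. LINT x:ball a r|lebesgue. (u j x)\<^sup>2)" for r
  define \<alpha> where "\<alpha> r = D r + I r / r\<^sup>2" for r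
  have set_mono: "(LINT x:ball a s|lebesgue. h x) \<le> (LINT x:ball a t|lebesgue. h x)"
    "0 \<le> (LINT x:ball a s|lebesgue. h x)"
    if "integrable lebesgue h" "\<And>x. 0 \<le> h x" "s \<le> t" for s t and h :: "real ^ 'n \<Rightarrow> real"
  proof -
    show "(LINT x:ball a s|lebesgue. h x) \<le> (LINT x:ball a t|lebesgue. h x)"
      unfolding set_lebesgue_integral_def
      using that by (intro integral_mono integrable_mult_indicator) (auto split: split_indicator)
    show "0 \<le> (LINT x:ball a s|lebesgue. h x)"
      unfolding set_lebesgue_integral_def using that by (intro Bochner_Integration.integral_nonneg) auto
  qed
  have D_mono: "D s \<le> D t" and I_mono: "I s \<le> I t" if "s \<le> t" for s t
    unfolding D_def I_def using set_mono(1)[OF int(1) _ that] set_mono(1)[OF int(2) _ that] by (auto intro!: sum_mono)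
  have D_nonneg: "0 \<le> D s" and I_nonneg: "0 \<le> I s" for s
    unfolding D_def I_def using set_mono(2)[OF int(1) _ order_refl] set_mono(2)[OF int(2) _ order_refl] by (auto intro!: sum_nonneg)
  have nz: "measure lebesgue ({x. u j x \<noteq> 0} \<inter> ball a s) \<le> \<delta> * (\<omega> * s ^ n)" if "0 < s" "s < r1" for j s
  proof -
    have "measure lebesgue ({x. u j x \<noteq> 0} \<inter> ball a s) \<le> measure lebesgue (ball a s - E)"
    proof (rule measure_mono_fmeasurable)
      show "{x. u j x \<noteq> 0} \<inter> ball a s \<subseteq> ball a s - E" using E(4) by blast
      have "{x. u j x \<noteq> 0} \<in> sets lebesgue"
        using borel_measurable_neq[OF loc_int_measurable[OF lu[of j]], of "\<lambda>_. 0"] by simp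
      then show "{x. u j x \<noteq> 0} \<inter> ball a s \<in> sets lebesgue" by auto
      show "ball a s - E \<in> lmeasurable" using E(1) by (intro fmeasurable_Diff) auto
    qed
    also have "\<dots> \<le> \<delta> * measure lebesgue (ball a s)" by (rule dens[OF that])
    finally show ?thesis using vol[of s a] that by simp
  qed
  have decay: "\<alpha> r + \<gamma> * r ^ (n + 2) \<le> \<alpha> (4 * r) / 4 ^ (n + 2 + 1)" if r: "0 < r" "r \<le> r0" for r
  proof -
    have rr: "r \<le> 1" "4 * r < r1" "r \<le> r2" "r \<le> measure lebesgue E / (4 * \<omega>)"
      using r r0 by linarith+
    have ball\<Omega>: "ball a r \<subseteq> \<Omega>" using r2(2) subset_ball[OF rr(3), of a] by blast
    have small: "2 * measure lebesgue (ball a r) < measure lebesgue E"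
    proof -
      have "r ^ n \<le> r ^ 1" using r rr n zero_less_card_finite by (intro power_decreasing) (auto simp: Suc_le_eq)
      then have "2 * (\<omega> * r ^ n) \<le> 2 * (\<omega> * r)" using \<omega> by (intro mult_left_mono) auto
      also have "\<dots> \<le> measure lebesgue E / 2" using rr(4) \<omega> by (simp add: field_simps)
      also have "\<dots> < measure lebesgue E" using E(3) by simp
      finally show ?thesis using vol[of r a] r by simp
    qed
    note ineq = minimizer_inequality[where f=f and g=g and u=u and W=W and G=G and F=F and Ft=Ft, OF \<Omega> assms(4,5) fM gM Ft assms(9-11) hG E(1,2,4,5) r(1) rr(1) ball\<Omega> small K
        less_imp_le[OF \<tau>] less_imp_le[OF M(1)]]
    \<comment> \<open>At least half of \<open>ball a (r / 2)\<close> lies in \<open>E\<close>, where \<open>g k \<ge> c\<close>; the cost of the bump eats up half of the gain.\<close>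
    have gain: "\<tau> * r\<^sup>2 * (c * measure lebesgue (E \<inter> ball a (r / 2))) - Q * \<tau>\<^sup>2 * r\<^sup>2 * measure lebesgue (ball a r) \<ge> 2 * \<gamma> * r ^ (n + 2)"
    proof -
      have "measure lebesgue (ball a (r / 2) - E) \<le> \<delta> * measure lebesgue (ball a (r / 2))"
        using r rr by (intro dens) auto
      also have "\<dots> \<le> 1 / 2 * measure lebesgue (ball a (r / 2))"
        using \<delta>(2) by (intro mult_right_mono) auto
      finally have "measure lebesgue (ball a (r / 2) - E) \<le> measure lebesgue (ball a (r / 2)) / 2" by simp
      moreover have "measure lebesgue (ball a (r / 2)) \<le> measure lebesgue (ball a (r / 2) - E) + measure lebesgue (E \<inter> ball a (r / 2))"
      proof -
        have eq: "ball a (r / 2) = (ball a (r / 2) - E) \<union> (E \<inter> ball a (r / 2))" by blast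
        show ?thesis using E(1) by (subst eq, intro measure_Un_le) auto
      qed
      ultimately have "\<omega> * (r / 2) ^ n / 2 \<le> measure lebesgue (E \<inter> ball a (r / 2))"
        using vol[of "r / 2" a] r by simp
      then have "\<tau> * r\<^sup>2 * (c * (\<omega> * (r / 2) ^ n / 2)) \<le> \<tau> * r\<^sup>2 * (c * measure lebesgue (E \<inter> ball a (r / 2)))"
        using \<tau> c by (intro mult_left_mono) auto
      moreover have "\<tau> * r\<^sup>2 * (c * (\<omega> * (r / 2) ^ n / 2)) = 4 * \<gamma> * r ^ (n + 2)"
        by (simp add: \<gamma>_def power_add power_divide field_simps power2_eq_square)
      moreover have "Q * \<tau>\<^sup>2 * r\<^sup>2 * measure lebesgue (ball a r) = 2 * \<gamma> * r ^ (n + 2)"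
      proof -
        have "Q * \<tau> = c / 2 ^ (n + 2)" using Q by (simp add: \<tau>_def)
        then have "Q * \<tau>\<^sup>2 * r\<^sup>2 * (\<omega> * r ^ n) = c / 2 ^ (n + 2) * \<tau> * r\<^sup>2 * (\<omega> * r ^ n)"
          by (simp add: power2_eq_square mult.assoc[symmetric])
        also have "\<dots> = 2 * \<gamma> * r ^ (n + 2)"
          by (simp add: \<gamma>_def power_add field_simps power2_eq_square)
        finally show ?thesis using vol[of r a] r by simp
      qed
      ultimately show ?thesis by linarith
    qed
    \<comment> \<open>The linear term is only felt off \<open>E\<close>, that is, on a portion \<open>\<delta>\<close> of the ball.\<close>
    have waste: "M * r\<^sup>2 * (\<Sum>j\<in>UNIV. measure lebesgue ({x. u j x \<noteq> 0} \<inter> ball a (2 * r))) \<le> \<gamma> * r ^ (n + 2)"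
    proof -
      have "(\<Sum>j\<in>UNIV. measure lebesgue ({x. u j x \<noteq> 0} \<inter> ball a (2 * r))) \<le> (\<Sum>j\<in>(UNIV::'k set). \<delta> * (\<omega> * (2 * r) ^ n))"
        using r rr by (intro sum_mono nz) auto
      also have "\<dots> = N * \<delta> * (\<omega> * (2 * r) ^ n)" by (simp add: N_def)
      finally have "M * r\<^sup>2 * (\<Sum>j\<in>UNIV. measure lebesgue ({x. u j x \<noteq> 0} \<inter> ball a (2 * r))) \<le> M * r\<^sup>2 * (N * \<delta> * (\<omega> * (2 * r) ^ n))"
        using M by (intro mult_left_mono) auto
      also have "\<dots> = (\<delta> * (N * M * 2 ^ n * \<omega>)) * r ^ (n + 2)"
        by (simp add: power_add power_mult_distrib power2_eq_square mult_ac)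
      also have "\<dots> \<le> \<gamma> * r ^ (n + 2)"
        using \<delta>(3) N M \<omega> r by (intro mult_right_mono) (auto simp: field_simps)
      finally show ?thesis .
    qed
    \<comment> \<open>The constant \<open>8\<close> is \<open>2 / 4\<close>, from the cut-off radius \<open>2r\<close>, times \<open>16\<close>, from \<open>I (4r)\<close> being divided by \<open>(4r)\<^sup>2\<close>.\<close>
    have poin: "I (2 * r) / r\<^sup>2 \<le> 2 * \<theta>\<^sup>2 * (2 + 8 * cutoff_const\<^sup>2) * \<alpha> (4 * r)"
    proof -
      have "I (2 * r) \<le> (\<Sum>j\<in>UNIV. 2 * (\<theta> * r)\<^sup>2 * (2 * (LINT x:ball a (4 * r)|lebesgue. (norm (G j x))\<^sup>2) +
          2 * (cutoff_const / (2 * r))\<^sup>2 * (LINT x:ball a (4 * r)|lebesgue. (u j x)\<^sup>2)))"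
        unfolding I_def
      proof (intro sum_mono local_poincare lu hG int r(1) \<theta>(1))
        fix j
        have "measure lebesgue ({x. u j x \<noteq> 0} \<inter> ball a (4 * r)) \<le> \<delta> * (\<omega> * (4 * r) ^ n)"
          using r rr by (intro nz) auto
        also have "\<dots> \<le> \<theta> ^ n / (2 * 4 ^ n) * (\<omega> * (4 * r) ^ n)"
          using \<delta>(4) \<omega> r by (intro mult_right_mono) auto
        also have "\<dots> = \<omega> * (\<theta> * r) ^ n / 2"
          by (simp add: power_mult_distrib)
        also have "\<dots> = measure lebesgue (ball (0::real^'n) (\<theta> * r)) / 2"
          using vol[of "\<theta> * r" 0] \<theta>(1) r by simp
        finally show "measure lebesgue ({x. u j x \<noteq> 0} \<inter> ball a (4 * r)) \<le> measure lebesgue (ball (0::real^'n) (\<theta> * r)) / 2" .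
      qed
      also have "\<dots> = 2 * (\<theta> * r)\<^sup>2 * (2 * D (4 * r) + 2 * (cutoff_const / (2 * r))\<^sup>2 * I (4 * r))"
        by (simp only: D_def I_def sum.distrib sum_distrib_left[symmetric])
      finally have "I (2 * r) / r\<^sup>2 \<le> 2 * (\<theta> * r)\<^sup>2 * (2 * D (4 * r) + 2 * (cutoff_const / (2 * r))\<^sup>2 * I (4 * r)) / r\<^sup>2"
        using r by (intro divide_right_mono) auto
      also have "\<dots> = 2 * \<theta>\<^sup>2 * (2 * D (4 * r) + 8 * cutoff_const\<^sup>2 * (I (4 * r) / (4 * r)\<^sup>2))"
        using r by (simp add: field_simps power2_eq_square)
      also have "\<dots> \<le> 2 * \<theta>\<^sup>2 * ((2 + 8 * cutoff_const\<^sup>2) * \<alpha> (4 * r))"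
      proof (rule mult_left_mono)
        have "0 \<le> I (4 * r) / (4 * r)\<^sup>2" using I_nonneg by simp
        then have "0 \<le> 8 * cutoff_const\<^sup>2 * D (4 * r) + 2 * (I (4 * r) / (4 * r)\<^sup>2)"
          using D_nonneg[of "4 * r"] by (intro add_nonneg_nonneg mult_nonneg_nonneg) auto
        then show "2 * D (4 * r) + 8 * cutoff_const\<^sup>2 * (I (4 * r) / (4 * r)\<^sup>2) \<le> (2 + 8 * cutoff_const\<^sup>2) * \<alpha> (4 * r)"
          unfolding \<alpha>_def distrib_left distrib_right by linarith
      qed simp
      finally show ?thesis by (simp only: mult.assoc)
    qed
    have Kinv: "1 / K = \<epsilon> / 2" by (simp add: K_def)
    have "D r + I r / r\<^sup>2 + \<gamma> * r ^ (n + 2) \<le> \<epsilon> / 2 * D (2 * r) + (C1 - 1) * (I (2 * r) / r\<^sup>2) + I r / r\<^sup>2"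
      using ineq gain waste unfolding D_def[symmetric] I_def[symmetric] Kinv Q_def[symmetric]
      by (simp add: C1_def)
    also have "\<dots> \<le> \<epsilon> / 2 * D (2 * r) + C1 * (I (2 * r) / r\<^sup>2)"
    proof -
      have "I r / r\<^sup>2 \<le> I (2 * r) / r\<^sup>2"
        using I_mono[of r "2 * r"] r by (intro divide_right_mono) auto
      then show ?thesis unfolding left_diff_distrib by linarith
    qed
    also have "\<dots> \<le> \<epsilon> / 2 * \<alpha> (4 * r) + C1 * (2 * \<theta>\<^sup>2 * (2 + 8 * cutoff_const\<^sup>2) * \<alpha> (4 * r))"
    proof (intro add_mono mult_left_mono poin)
      show "D (2 * r) \<le> \<alpha> (4 * r)"
        using D_mono[of "2 * r" "4 * r"] I_nonneg[of "4 * r"] r by (simp add: \<alpha>_def add_increasing2)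
    qed (use \<epsilon> C1 in auto)
    also have "\<dots> = \<epsilon> * \<alpha> (4 * r)"
    proof -
      have "C1 * (2 * \<theta>\<^sup>2 * (2 + 8 * cutoff_const\<^sup>2) * \<alpha> (4 * r)) =
          C1 * (2 * \<theta>\<^sup>2 * (2 + 8 * cutoff_const\<^sup>2)) * \<alpha> (4 * r)"
        by (simp only: mult.assoc)
      also have "\<dots> = \<epsilon> / 2 * \<alpha> (4 * r)" by (simp only: \<theta>(2))
      finally show ?thesis by linarith
    qed
    also have "\<dots> = \<alpha> (4 * r) / 4 ^ (n + 2 + 1)"
      by (simp add: \<epsilon>_def power_add)
    finally show ?thesis by (simp only: \<alpha>_def[of r])
  qed
  have "0 \<le> \<alpha> r" for r using D_nonneg[of r] I_nonneg[of r] by (simp add: \<alpha>_def)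
  from decay_contradiction[OF \<gamma> r0(1) this decay] show False .
qed

end
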